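(* Let $\Omega\subset\mathbb{C}^m$ be a bounded domain. If $K_1,K_2:\Omega\times\Omega\to\mathbb{C}$ are two sharp kernels, then for every integer $k\ge 0$ the kernel $J_k(K_1,K_2)_{|\mathrm{res}\,\Delta}$ is also a sharp kernel.
   Context: Kernels are sesqui-analytic: holomorphic in the first and anti-holomorphic in the second set of $m$ variables. A kernel $K:\Omega\times\Omega\to\mathcal{M}_n(\mathbb{C})$ is positive definite if for all distinct $z_1,\dots,z_N\in\Omega$ and all $\eta_1,\dots,\eta_N\in\mathbb{C}^n$, not all zero, $\sum_{p,q}\langle K(z_p,z_q)\eta_q,\eta_p\rangle>0$. $(\mathcal{H},K)$ is the associated reproducing kernel Hilbert space of $\mathbb{C}^n$-valued holomorphic functions on $\Omega$, with $\langle f,K(\cdot,w)\eta\rangle=\langle f(w),\eta\rangle$. For a commuting tuple $\boldsymbol{T}=(T_1,\dots,T_m)$ of bounded operators on a Hilbert space $\mathcal{H}$, $D_{\boldsymbol{T}}:\mathcal{H}\to\mathcal{H}\oplus\cdots\oplus\mathcal{H}$ is $D_{\boldsymbol{T}}x=(T_1x,\dots,T_mx)$. A positive definite kernel $K:\Omega\times\Omega\to\mathcal{M}_n(\mathbb{C})$ is sharp if (i) the multiplication operator $M_{z_i}$ is bounded on $(\mathcal{H},K)$ for $i=1,\dots,m$, and (ii) $\ker D_{(\boldsymbol{M}_z-w)^*}=\mathrm{ran}\,K(\cdot,w):=\{K(\cdot,w)\eta:\eta\in\mathbb{C}^n\}$ for all $w\in\Omega$, where $(\boldsymbol{M}_z-w)^*=((M_{z_1}-w_1)^*,\dots,(M_{z_m}-w_m)^*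 )$. For scalar non-negative definite kernels $K_1,K_2$ on $\Omega\times\Omega$ and $k\ge0$, with $d=\binom{m+k}{m}$, $J_k(K_1,K_2)_{|\mathrm{res}\,\Delta}:\Omega\times\Omega\to\mathcal{M}_d(\mathbb{C})$ is the kernel $$J_k(K_1,K_2)_{|\mathrm{res}\,\Delta}(z,w)=\big(K_1(z,w)\,\partial^{\boldsymbol{i}}\bar\partial^{\boldsymbol{j}}K_2(z,w)\big)_{\boldsymbol{i},\boldsymbol{j}},$$ where the rows and columns are indexed by the multi-indices $\boldsymbol{i},\boldsymbol{j}\in\mathbb{Z}_+^m$ with $|\boldsymbol{i}|,|\boldsymbol{j}|\le k$, $\partial^{\boldsymbol{i}}=\prod_l(\partial/\partial z_l)^{i_l}$ and $\bar\partial^{\boldsymbol{j}}=\prod_l(\partial/\partial\bar w_l)^{j_l}$. *)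

theory Defs
  imports "HOL-Analysis.Analysis" "HOL-Library.Function_Algebras"
begin

subsection \<open>Functions of several complex variables\<close>

definition holomorphic_several :: "(complex ^ 'm \<Rightarrow> complex) \<Rightarrow> (complex ^ 'm) set \<Rightarrow> bool" where
  "holomorphic_several f \<Omega> \<longleftrightarrow>
     (\<forall>z\<in>\<Omega>. \<exists>L. (f has_derivative L) (at z) \<and> (\<forall>c v. L (c *s v) = c * L v))"

definition antiholomorphic_several :: "(complex ^ 'm \<Rightarrow> complex) \<Rightarrow> (complex ^ 'm) set \<Rightarrow> bool" where
  "antiholomorphic_several f \<Omega> \<longleftrightarrow>
     (\<forall>z\<in>\<Omega>. \<exists>L. (f has_derivative L) (at z) \<and> (\<forall>c v. L (c *s v) = cnj c * L v))"

text \<open>The Wirtinger derivatives, with \<open>z\<^sub>l = x\<^sub>l + \<i> y\<^sub>l\<close>.\<close>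

definition partial_x :: "'m \<Rightarrow> (complex ^ 'm \<Rightarrow> complex) \<Rightarrow> complex ^ 'm \<Rightarrow> complex" where
  "partial_x l f z = vector_derivative (\<lambda>t::real. f (z + axis l (of_real t))) (at 0)"

definition partial_y :: "'m \<Rightarrow> (complex ^ 'm \<Rightarrow> complex) \<Rightarrow> complex ^ 'm \<Rightarrow> complex" where
  "partial_y l f z = vector_derivative (\<lambda>t::real. f (z + axis l (\<i> * of_real t))) (at 0)"

definition dz :: "'m \<Rightarrow> (complex ^ 'm \<Rightarrow> complex) \<Rightarrow> complex ^ 'm \<Rightarrow> complex" where
  "dz l f z = (partial_x l f z - \<i> * partial_y l f z) / 2"

definition dzbar :: "'m \<Rightarrow> (complex ^ 'm \<Rightarrow> complex) \<Rightarrow> complex ^ 'm \<Rightarrow> complex" where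
  "dzbar l f z = (partial_x l f z + \<i> * partial_y l f z) / 2"

text \<open>
  The coordinates are indexed by a finite type without a distinguished order, so the composition
  \<open>\<Prod>\<^sub>l D\<^sub>l\<^bsup>i\<^sub>l\<^esup>\<close> is taken along an arbitrary fixed enumeration. On (anti)holomorphic functions
  the partial derivatives commute and the enumeration is immaterial.
\<close>

definition coord_enum :: "'m::finite list" where
  "coord_enum = (SOME ls. distinct ls \<and> set ls = UNIV)"

definition multi_deriv :: "('m::finite \<Rightarrow> 'f \<Rightarrow> 'f) \<Rightarrow> ('m \<Rightarrow> nat) \<Rightarrow> 'f \<Rightarrow> 'f" where
  "multi_deriv D i f = foldr (\<lambda>l. D l ^^ i l) coord_enum f"

definition multi_indices :: "nat \<Rightarrow> ('m::finite \<Rightarrow> nat) set" where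
  "multi_indices k = {i. (\<Sum>l\<in>UNIV. i l) \<le> k}"


subsection \<open>Matrix-valued kernels\<close>

text \<open>
  The space \<open>\<complex>\<^sup>n\<close> is the space of functions on a finite index set \<open>I\<close> with \<open>n\<close> elements, extended
  by \<open>0\<close>. A kernel with values in \<open>\<M>\<^sub>n(\<complex>)\<close> is a function \<open>K\<close>, where \<open>K z w i j\<close> is the entry
  in row \<open>i\<close> and column \<open>j\<close> of the matrix \<open>K(z,w)\<close>.
\<close>

type_synonym ('m, 'i) kernel = "complex ^ 'm \<Rightarrow> complex ^ 'm \<Rightarrow> 'i \<Rightarrow> 'i \<Rightarrow> complex"

type_synonym ('m, 'i) vfun = "complex ^ 'm \<Rightarrow> 'i \<Rightarrow> complex"

definition cvec :: "'i set \<Rightarrow> ('i \<Rightarrow> complex) set" where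
  "cvec I = {\<eta>. \<forall>i. i \<notin> I \<longrightarrow> \<eta> i = 0}"

definition cvec_inner :: "'i set \<Rightarrow> ('i \<Rightarrow> complex) \<Rightarrow> ('i \<Rightarrow> complex) \<Rightarrow> complex" where
  "cvec_inner I \<eta> \<zeta> = (\<Sum>i\<in>I. \<eta> i * cnj (\<zeta> i))"

definition mat_app :: "'i set \<Rightarrow> ('i \<Rightarrow> 'i \<Rightarrow> complex) \<Rightarrow> ('i \<Rightarrow> complex) \<Rightarrow> 'i \<Rightarrow> complex" where
  "mat_app I A \<eta> = (\<lambda>i. if i \<in> I then \<Sum>j\<in>I. A i j * \<eta> j else 0)"

definition sesqui_analytic :: "(complex ^ 'm) set \<Rightarrow> 'i set \<Rightarrow> ('m, 'i) kernel \<Rightarrow> bool" where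
  "sesqui_analytic \<Omega> I K \<longleftrightarrow>
     (\<forall>i\<in>I. \<forall>j\<in>I.
        (\<forall>w\<in>\<Omega>. holomorphic_several (\<lambda>z. K z w i j) \<Omega>) \<and>
        (\<forall>z\<in>\<Omega>. antiholomorphic_several (\<lambda>w. K z w i j) \<Omega>))"

text \<open>The finite set \<open>Z\<close> consists of the distinct points \<open>z\<^sub>1, \<dots>, z\<^sub>N\<close>.\<close>

definition positive_definite_kernel :: "(complex ^ 'm) set \<Rightarrow> 'i set \<Rightarrow> ('m, 'i) kernel \<Rightarrow> bool" where
  "positive_definite_kernel \<Omega> I K \<longleftrightarrow>
     (\<forall>Z \<eta>. finite Z \<and> Z \<subseteq> \<Omega> \<and> (\<forall>z\<in>Z. \<eta> z \<in> cvec I) \<and> (\<exists>z\<in>Z. \<eta> z \<noteq> 0) \<longrightarrow>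
        (let s = \<Sum>p\<in>Z. \<Sum>q\<in>Z. cvec_inner I (mat_app I (K p q) (\<eta> q)) (\<eta> p)
         in s \<in> \<real> \<and> 0 < Re s))"

text \<open>\<open>K(\<cdot>,w)\<eta>\<close>. Functions on \<open>\<Omega>\<close> are extended by \<open>0\<close>.\<close>

definition kernel_section ::
  "(complex ^ 'm) set \<Rightarrow> 'i set \<Rightarrow> ('m, 'i) kernel \<Rightarrow> complex ^ 'm \<Rightarrow> ('i \<Rightarrow> complex) \<Rightarrow> ('m, 'i) vfun" where
  "kernel_section \<Omega> I K w \<eta> = (\<lambda>z. if z \<in> \<Omega> then mat_app I (K z w) \<eta> else 0)"


subsection \<open>Hilbert spaces of vector-valued functions\<close>

definition fscale :: "complex \<Rightarrow> ('x \<Rightarrow> 'i \<Rightarrow> complex) \<Rightarrow> 'x \<Rightarrow> 'i \<Rightarrow> complex" where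
  "fscale c f = (\<lambda>x i. c * f x i)"

definition hnorm :: "('v \<Rightarrow> 'v \<Rightarrow> complex) \<Rightarrow> 'v \<Rightarrow> real" where
  "hnorm ip f = sqrt (Re (ip f f))"

locale hilbert_function_space =
  fixes H :: "('x \<Rightarrow> 'i \<Rightarrow> complex) set"
    and ip :: "('x \<Rightarrow> 'i \<Rightarrow> complex) \<Rightarrow> ('x \<Rightarrow> 'i \<Rightarrow> complex) \<Rightarrow> complex"
  assumes zero_mem: "0 \<in> H"
    and add_mem: "f \<in> H \<Longrightarrow> g \<in> H \<Longrightarrow> f + g \<in> H"
    and scale_mem: "f \<in> H \<Longrightarrow> fscale c f \<in> H"
    and ip_add: "f \<in> H \<Longrightarrow> g \<in> H \<Longrightarrow> h \<in> H \<Longrightarrow> ip (f + g) h = ip f h + ip g h"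
    and ip_scale: "f \<in> H \<Longrightarrow> g \<in> H \<Longrightarrow> ip (fscale c f) g = c * ip f g"
    and ip_cnj: "f \<in> H \<Longrightarrow> g \<in> H \<Longrightarrow> ip g f = cnj (ip f g)"
    and ip_pos: "f \<in> H \<Longrightarrow> f \<noteq> 0 \<Longrightarrow> 0 < Re (ip f f)"
    and complete: "\<lbrakk>\<And>n::nat. u n \<in> H;
        \<And>e. e > 0 \<Longrightarrow> \<exists>N. \<forall>m\<ge>N. \<forall>n\<ge>N. hnorm ip (u m - u n) < e\<rbrakk>
      \<Longrightarrow> \<exists>f\<in>H. (\<lambda>n. hnorm ip (u n - f)) \<longlonglongrightarrow> 0"

locale rkhs = hilbert_function_space H ip
  for H :: "('m::finite, 'i) vfun set" and ip :: "('m, 'i) vfun \<Rightarrow> ('m, 'i) vfun \<Rightarrow> complex" +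
  fixes \<Omega> :: "(complex ^ 'm) set" and I :: "'i set" and K :: "('m, 'i) kernel"
  assumes outside_domain: "f \<in> H \<Longrightarrow> z \<notin> \<Omega> \<Longrightarrow> f z = 0"
    and values_cvec: "f \<in> H \<Longrightarrow> f z \<in> cvec I"
    and holomorphic: "f \<in> H \<Longrightarrow> i \<in> I \<Longrightarrow> holomorphic_several (\<lambda>z. f z i) \<Omega>"
    and section_mem: "w \<in> \<Omega> \<Longrightarrow> \<eta> \<in> cvec I \<Longrightarrow> kernel_section \<Omega> I K w \<eta> \<in> H"
    and reproducing: "f \<in> H \<Longrightarrow> w \<in> \<Omega> \<Longrightarrow> \<eta> \<in> cvec I \<Longrightarrow>
        ip f (kernel_section \<Omega> I K w \<eta>) = cvec_inner I (f w) \<eta>"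

definition bounded_operator ::
  "('x \<Rightarrow> 'i \<Rightarrow> complex) set \<Rightarrow> (('x \<Rightarrow> 'i \<Rightarrow> complex) \<Rightarrow> ('x \<Rightarrow> 'i \<Rightarrow> complex) \<Rightarrow> complex) \<Rightarrow>
   (('x \<Rightarrow> 'i \<Rightarrow> complex) \<Rightarrow> ('x \<Rightarrow> 'i \<Rightarrow> complex)) \<Rightarrow> bool" where
  "bounded_operator H ip T \<longleftrightarrow>
     (\<forall>f\<in>H. T f \<in> H) \<and>
     (\<forall>f\<in>H. \<forall>g\<in>H. T (f + g) = T f + T g) \<and>
     (\<forall>f\<in>H. \<forall>c. T (fscale c f) = fscale c (T f)) \<and>
     (\<exists>C. \<forall>f\<in>H. hnorm ip (T f) \<le> C * hnorm ip f)"

text \<open>The Hilbert space adjoint; the description is proper if \<open>T\<close> is a bounded operator on \<open>H\<close>.\<close>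

definition hilbert_adjoint :: "'v set \<Rightarrow> ('v \<Rightarrow> 'v \<Rightarrow> complex) \<Rightarrow> ('v \<Rightarrow> 'v) \<Rightarrow> 'v \<Rightarrow> 'v" where
  "hilbert_adjoint H ip T g = (THE h. h \<in> H \<and> (\<forall>f\<in>H. ip (T f) g = ip f h))"

text \<open>\<open>D\<^sub>T x = (T\<^sub>1 x, \<dots>, T\<^sub>m x)\<close> and its kernel in \<open>H\<close>.\<close>

definition D_tuple :: "('m \<Rightarrow> 'v \<Rightarrow> 'v) \<Rightarrow> 'v \<Rightarrow> 'm \<Rightarrow> 'v" where
  "D_tuple T x = (\<lambda>l. T l x)"

definition ker_D :: "'v set \<Rightarrow> ('m \<Rightarrow> 'v \<Rightarrow> 'v::zero) \<Rightarrow> 'v set" where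
  "ker_D H T = {x \<in> H. D_tuple T x = 0}"

definition mult_op :: "'m::finite \<Rightarrow> ('m, 'i) vfun \<Rightarrow> ('m, 'i) vfun" where
  "mult_op l f = (\<lambda>z i. z $ l * f z i)"

definition mult_shift_adjoint ::
  "('m::finite, 'i) vfun set \<Rightarrow> (('m, 'i) vfun \<Rightarrow> ('m, 'i) vfun \<Rightarrow> complex) \<Rightarrow>
   complex ^ 'm \<Rightarrow> 'm \<Rightarrow> ('m, 'i) vfun \<Rightarrow> ('m, 'i) vfun" where
  "mult_shift_adjoint H ip w l = hilbert_adjoint H ip (\<lambda>f. mult_op l f - fscale (w $ l) f)"


subsection \<open>Sharp kernels\<close>

text \<open>
  The space \<open>(\<H>, K)\<close> exists and is unique for a positive definite kernel (Moore-Aronszajn), so the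
  existential quantifier over \<open>H\<close> and \<open>ip\<close> only introduces a name for it. The values of \<open>ip\<close> outside
  \<open>H\<close> play no role.
\<close>

definition sharp_kernel :: "(complex ^ 'm::finite) set \<Rightarrow> 'i set \<Rightarrow> ('m, 'i) kernel \<Rightarrow> bool" where
  "sharp_kernel \<Omega> I K \<longleftrightarrow>
     finite I \<and> sesqui_analytic \<Omega> I K \<and> positive_definite_kernel \<Omega> I K \<and>
     (\<exists>H ip. rkhs H ip \<Omega> I K \<and>
        (\<forall>l. bounded_operator H ip (mult_op l)) \<and>
        (\<forall>w\<in>\<Omega>. ker_D H (mult_shift_adjoint H ip w) = kernel_section \<Omega> I K w ` cvec I))"

text \<open>A scalar kernel is a kernel with values in the \<open>1 \<times> 1\<close> matrices, with index set
  \<open>UNIV :: unit set\<close>.\<close>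

definition scalar_kernel :: "(complex ^ 'm \<Rightarrow> complex ^ 'm \<Rightarrow> complex) \<Rightarrow> ('m, unit) kernel" where
  "scalar_kernel K = (\<lambda>z w _ _. K z w)"

text \<open>The dependence of \<open>J\<^sub>k\<close> on \<open>k\<close> is only through its index set \<open>multi_indices k\<close>.\<close>

definition J_res ::
  "(complex ^ 'm::finite \<Rightarrow> complex ^ 'm \<Rightarrow> complex) \<Rightarrow> (complex ^ 'm \<Rightarrow> complex ^ 'm \<Rightarrow> complex) \<Rightarrow>
   ('m, 'm \<Rightarrow> nat) kernel" where
  "J_res K1 K2 = (\<lambda>z w i j.
     K1 z w * multi_deriv dz i (\<lambda>z'. multi_deriv dzbar j (\<lambda>w'. K2 z' w') w) z)"

end

theory Submission
  imports Defs "HOL-Complex_Analysis.Cauchy_Integral_Formula" "HOL-Library.Multiset"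
begin

text \<open>
  Let \<open>H\<^sub>1\<close> and \<open>H\<^sub>2\<close> be the Hilbert spaces of \<open>K\<^sub>1\<close> and \<open>K\<^sub>2\<close>. Differentiation at a point is a
  bounded functional on \<open>H\<^sub>2\<close>, so it is given by a vector: \<open>\<partial>\<^sup>j v(w) = \<langle>v, \<kappa>\<^sub>j(w)\<rangle>\<close>. Then the mixed derivatives of
  \<open>K\<^sub>2\<close> are the Gram matrix of the \<open>\<kappa>\<^sub>j(w)\<close>, and the entry \<open>(i, j)\<close> of the jet kernel at \<open>(z, w)\<close> is the inner
  product of \<open>K\<^sub>1(\<cdot>,w) \<otimes> \<kappa>\<^sub>j(w)\<close> with \<open>K\<^sub>1(\<cdot>,z) \<otimes> \<kappa>\<^sub>i(z)\<close> in \<open>H\<^sub>1 \<otimes> H\<^sub>2\<close> (lemmas \<open>mixed_derivative_kernel\<close> and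
  \<open>J_inner\<close>). In other words, its Hilbert space is the image of \<open>H\<^sub>1 \<otimes> H\<^sub>2\<close> under the map that sends \<open>u \<otimes> v\<close>
  to \<open>u\<close> times the jet of \<open>v\<close> of order \<open>k\<close>. This yields non-negativity, boundedness of the multiplication
  operators, which act on the first factor, and strict positivity, because functions in \<open>H\<^sub>1\<close> separate
  points and jets of functions in \<open>H\<^sub>2\<close> are arbitrary: both spaces are closed under multiplication by
  polynomials.

  For the joint kernel, let \<open>f\<close> be orthogonal to the ranges of all \<open>M\<^sub>l - w\<^sub>l\<close>. For fixed \<open>v\<close> the functional
  \<open>u \<mapsto> \<langle>u \<sqdot> jet v, f\<rangle>\<close> on \<open>H\<^sub>1\<close> kills the ranges of \<open>M\<^sub>l - w\<^sub>l\<close>, so sharpness of \<open>K\<^sub>1\<close> makes it a multiple of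
  evaluation at \<open>w\<close>, and
  \<open>\<langle>u \<sqdot> jet v, f\<rangle> = u(w) \<langle>v, g\<rangle>\<close> for some \<open>g \<in> H\<^sub>2\<close>. A product of \<open>k + 1\<close> of the operators
  \<open>1 \<otimes> M\<^sub>b - M\<^sub>b \<otimes> 1\<close> produces functions that vanish to order \<open>k + 1\<close> on the diagonal, which the jet map
  annihilates. Hence every product of \<open>k + 1\<close> of the operators \<open>(M\<^sub>b - w\<^sub>b)\<^sup>*\<close> annihilates \<open>g\<close>. By
  \<open>generalized_joint_kernel\<close>, where sharpness of \<open>K\<^sub>2\<close> enters, \<open>g\<close> is a combination of the \<open>\<kappa>\<^sub>j(w)\<close>
  with \<open>|j| \<le> k\<close>; and this says that \<open>f\<close> is a section of the jet kernel at \<open>w\<close> (lemma \<open>joint_kernel_J\<close>).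

  The tools are the Riesz and uniform boundedness theorems for Hilbert spaces of functions, the algebraic
  tensor product with its inner product, the theorem of Weierstrass on limits of holomorphic functions of
  several variables, and the theorem of Moore and Aronszajn.
\<close>

section \<open>Hilbert spaces of functions\<close>

text \<open>
  The Cauchy-Schwarz inequality in the form in which it holds for semi-definite forms: \<open>a\<close> and \<open>d\<close> are the
  squared seminorms of two vectors, \<open>b\<close> is their product.
\<close>

lemma semi_cauchy_schwarz:
  fixes a d :: real and b :: complex
  assumes pos: "\<And>c. 0 \<le> a + 2 * Re (c * b) + (cmod c)\<^sup>2 * d" and "0 \<le> d"
  shows "(cmod b)\<^sup>2 \<le> a * d"
proof (cases "d = 0")
  case False
  then have d: "d > 0" using assms(2) by simp
  define c where "c = - cnj b / of_real d"
  have "c * b = - of_real ((cmod b)\<^sup>2 / d)"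
    unfolding c_def using complex_norm_square[of b] by (simp add: mult.commute)
  then have 1: "Re (c * b) = - ((cmod b)\<^sup>2 / d)"
    by (metis Re_complex_of_real of_real_minus)
  have 2: "(cmod c)\<^sup>2 * d = (cmod b)\<^sup>2 / d"
    using d unfolding c_def by (simp add: norm_divide power_divide power2_eq_square)
  have "0 \<le> a - (cmod b)\<^sup>2 / d" using pos[of c] 1 2 by simp
  then show ?thesis using d by (simp add: field_simps)
next
  case True
  have "b = 0"
  proof (rule ccontr)
    assume b: "b \<noteq> 0"
    define c where "c = of_real (- (a + 1) / (2 * (cmod b)\<^sup>2)) * cnj b"
    have "c * b = of_real (- (a + 1) / (2 * (cmod b)\<^sup>2)) * of_real ((cmod b)\<^sup>2)"
      unfolding c_def using complex_norm_square[of b] by (simp add: mult.commute mult.left_commute)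
    also have "\<dots> = of_real (- (a + 1) / 2)"
      using b by (simp only: of_real_mult[symmetric]) (simp add: field_simps)
    finally have "c * b = of_real (- (a + 1) / 2)" .
    then have "Re (c * b) = - (a + 1) / 2" by (simp only: Re_complex_of_real)
    then show False using pos[of c] True by simp
  qed
  then show ?thesis using True by simp
qed

lemma fscale_apply [simp]: "fscale c f x i = c * f x i"
  by (simp add: fscale_def)

lemma fscale_0 [simp]: "fscale 0 f = 0"
  by (simp add: fscale_def fun_eq_iff)

lemma fscale_zero_right [simp]: "fscale c 0 = 0"
  by (simp add: fscale_def fun_eq_iff)

lemma fscale_1 [simp]: "fscale 1 f = f"
  by (simp add: fscale_def)

lemma fscale_fscale [simp]: "fscale c (fscale d f) = fscale (c * d) f"
  by (simp add: fscale_def mult.assoc)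

lemma fscale_add_right: "fscale c (f + g) = fscale c f + fscale c g"
  by (simp add: fscale_def fun_eq_iff algebra_simps)

lemma fscale_diff_right: "fscale c (f - g) = fscale c f - fscale c g"
  by (simp add: fscale_def fun_eq_iff algebra_simps)

lemma diff_eq_add_fscale: "f - g = f + fscale (-1) (g :: 'x \<Rightarrow> 'i \<Rightarrow> complex)"
  by (simp add: fscale_def fun_eq_iff)

lemma fscale_sum: "fscale c (\<Sum>x\<in>A. f x) = (\<Sum>x\<in>A. fscale c (f x))"
  by (rule sum_comp_morphism[of "fscale c", unfolded comp_def, symmetric])
    (rule fscale_zero_right fscale_add_right)+

context hilbert_function_space
begin

lemma diff_mem: "f \<in> H \<Longrightarrow> g \<in> H \<Longrightarrow> f - g \<in> H"
  unfolding diff_eq_add_fscale by (intro add_mem scale_mem)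

lemma ip_zero_left [simp]: "g \<in> H \<Longrightarrow> ip 0 g = 0"
  using ip_scale[of g g 0] by simp

lemma ip_zero_right [simp]: "g \<in> H \<Longrightarrow> ip g 0 = 0"
  using ip_cnj[of 0 g] zero_mem by simp

lemma ip_diff: "f \<in> H \<Longrightarrow> g \<in> H \<Longrightarrow> h \<in> H \<Longrightarrow> ip (f - g) h = ip f h - ip g h"
  unfolding diff_eq_add_fscale by (simp add: ip_add ip_scale scale_mem)

lemma ip_add_right: "f \<in> H \<Longrightarrow> g \<in> H \<Longrightarrow> h \<in> H \<Longrightarrow> ip h (f + g) = ip h f + ip h g"
  by (metis ip_cnj ip_add complex_cnj_add add_mem)

lemma ip_scale_right: "f \<in> H \<Longrightarrow> g \<in> H \<Longrightarrow> ip f (fscale c g) = cnj c * ip f g"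
  by (metis ip_cnj ip_scale complex_cnj_mult scale_mem)

lemma ip_diff_right: "f \<in> H \<Longrightarrow> g \<in> H \<Longrightarrow> h \<in> H \<Longrightarrow> ip h (f - g) = ip h f - ip h g"
  unfolding diff_eq_add_fscale by (simp add: ip_add_right ip_scale_right scale_mem)

lemma sum_mem: "(\<And>x. x \<in> A \<Longrightarrow> f x \<in> H) \<Longrightarrow> (\<Sum>x\<in>A. f x) \<in> H"
  by (induction A rule: infinite_finite_induct) (auto intro: zero_mem add_mem)

lemma ip_sum:
  "(\<And>x. x \<in> A \<Longrightarrow> f x \<in> H) \<Longrightarrow> g \<in> H \<Longrightarrow> ip (\<Sum>x\<in>A. f x) g = (\<Sum>x\<in>A. ip (f x) g)"
  by (induction A rule: infinite_finite_induct) (auto simp: ip_add sum_mem)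

lemma ip_sum_right:
  assumes "\<And>x. x \<in> A \<Longrightarrow> f x \<in> H" "g \<in> H"
  shows "ip g (\<Sum>x\<in>A. f x) = (\<Sum>x\<in>A. ip g (f x))"
proof -
  have "ip g (\<Sum>x\<in>A. f x) = cnj (ip (\<Sum>x\<in>A. f x) g)"
    by (intro ip_cnj sum_mem assms)
  also have "ip (\<Sum>x\<in>A. f x) g = (\<Sum>x\<in>A. ip (f x) g)"
    by (rule ip_sum[OF assms])
  also have "cnj \<dots> = (\<Sum>x\<in>A. cnj (ip (f x) g))" by simp
  also have "\<dots> = (\<Sum>x\<in>A. ip g (f x))"
    by (intro sum.cong refl ip_cnj[symmetric] assms)
  finally show ?thesis .
qed

lemma ip_self: "f \<in> H \<Longrightarrow> ip f f = of_real ((hnorm ip f)\<^sup>2)"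
proof -
  assume f: "f \<in> H"
  have "0 \<le> Re (ip f f)" using ip_pos[OF f] f by (cases "f = 0") auto
  moreover have "Im (ip f f) = 0" using ip_cnj[OF f f] by (simp add: complex_eq_iff)
  ultimately show ?thesis by (simp add: hnorm_def complex_eq_iff)
qed

lemma hnorm_nonneg [simp]: "f \<in> H \<Longrightarrow> 0 \<le> hnorm ip f"
  using ip_pos[of f] by (cases "f = 0") (auto simp: hnorm_def)

lemma hnorm_eq_0: "f \<in> H \<Longrightarrow> hnorm ip f = 0 \<longleftrightarrow> f = 0"
  using ip_pos[of f] by (cases "f = 0") (auto simp: hnorm_def)

lemma hnorm_sq_add_scaled:
  assumes "f \<in> H" "g \<in> H"
  shows "(hnorm ip (f + fscale c g))\<^sup>2
    = (hnorm ip f)\<^sup>2 + 2 * Re (c * ip g f) + (cmod c)\<^sup>2 * (hnorm ip g)\<^sup>2"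
proof -
  note m = assms scale_mem[OF assms(2)] add_mem
  have "of_real ((hnorm ip (f + fscale c g))\<^sup>2)
      = ip f f + (c * ip g f + cnj (c * ip g f)) + (c * cnj c) * ip g g"
    using m by (subst ip_self[symmetric])
      (auto simp: ip_add ip_add_right ip_scale ip_scale_right ip_cnj[of g f] algebra_simps)
  also have "\<dots> = of_real ((hnorm ip f)\<^sup>2 + 2 * Re (c * ip g f) + (cmod c)\<^sup>2 * (hnorm ip g)\<^sup>2)"
    using assms by (simp add: ip_self complex_add_cnj complex_norm_square[symmetric] del: complex_cnj_mult)
  finally show ?thesis by (simp only: of_real_eq_iff)
qed

lemma cauchy_schwarz:
  assumes "f \<in> H" "g \<in> H"
  shows "cmod (ip f g) \<le> hnorm ip f * hnorm ip g"
proof -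
  have "(cmod (ip f g))\<^sup>2 \<le> (hnorm ip g)\<^sup>2 * (hnorm ip f)\<^sup>2"
    using hnorm_sq_add_scaled[OF assms(2,1)]
    by (intro semi_cauchy_schwarz) (metis zero_le_power2, simp)
  then have "(cmod (ip f g))\<^sup>2 \<le> (hnorm ip f * hnorm ip g)\<^sup>2"
    by (simp add: power_mult_distrib mult.commute)
  then show ?thesis using assms by (simp add: power2_le_iff_abs_le)
qed

lemma hnorm_scale: "f \<in> H \<Longrightarrow> hnorm ip (fscale c f) = cmod c * hnorm ip f"
proof -
  assume f: "f \<in> H"
  have "(hnorm ip (fscale c f))\<^sup>2 = (cmod c * hnorm ip f)\<^sup>2"
    using hnorm_sq_add_scaled[OF zero_mem f, of c] f zero_mem hnorm_eq_0[OF zero_mem]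
    by (simp add: power_mult_distrib)
  then show ?thesis using f by (simp add: scale_mem)
qed

lemma hnorm_triangle:
  assumes "f \<in> H" "g \<in> H"
  shows "hnorm ip (f + g) \<le> hnorm ip f + hnorm ip g"
proof -
  have "(hnorm ip (f + g))\<^sup>2 = (hnorm ip f)\<^sup>2 + 2 * Re (ip g f) + (hnorm ip g)\<^sup>2"
    using hnorm_sq_add_scaled[OF assms, of 1] by simp
  also have "Re (ip g f) \<le> hnorm ip f * hnorm ip g"
    using cauchy_schwarz[OF assms(2,1)] complex_Re_le_cmod[of "ip g f"] by (simp add: mult.commute)
  finally have "(hnorm ip (f + g))\<^sup>2 \<le> (hnorm ip f + hnorm ip g)\<^sup>2"
    by (simp add: power2_sum)
  then show ?thesis using assms by (simp add: power2_le_iff_abs_le add_mem)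
qed

lemma hnorm_minus_commute: "f \<in> H \<Longrightarrow> g \<in> H \<Longrightarrow> hnorm ip (f - g) = hnorm ip (g - f)"
  using hnorm_scale[of "g - f" "-1"] diff_mem[of g f]
  by (simp add: fscale_def fun_diff_def)

lemma eq_if_ip_eq:
  assumes "g \<in> H" "h \<in> H" "\<And>f. f \<in> H \<Longrightarrow> ip f g = ip f h"
  shows "g = h"
proof -
  have "ip (g - h) (g - h) = 0"
    using assms diff_mem[OF assms(1,2)] by (simp add: ip_diff_right)
  then have "g - h = 0" using ip_pos[OF diff_mem[OF assms(1,2)]] by fastforce
  then show ?thesis by simp
qed

definition bounded_functional :: "(('x \<Rightarrow> 'i \<Rightarrow> complex) \<Rightarrow> complex) \<Rightarrow> bool" where
  "bounded_functional \<phi> \<longleftrightarrow>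
     (\<forall>f\<in>H. \<forall>g\<in>H. \<phi> (f + g) = \<phi> f + \<phi> g) \<and> (\<forall>f\<in>H. \<forall>c. \<phi> (fscale c f) = c * \<phi> f) \<and>
     (\<exists>C. \<forall>f\<in>H. cmod (\<phi> f) \<le> C * hnorm ip f)"

lemma parallelogram:
  assumes "f \<in> H" "g \<in> H"
  shows "(hnorm ip (f - g))\<^sup>2 + (hnorm ip (f + g))\<^sup>2 = 2 * (hnorm ip f)\<^sup>2 + 2 * (hnorm ip g)\<^sup>2"
  using hnorm_sq_add_scaled[OF assms, of 1] hnorm_sq_add_scaled[OF assms, of "-1"]
  unfolding diff_eq_add_fscale by simp

text \<open>
  The representing vector minimises \<open>\<parallel>f\<parallel>\<^sup>2 - 2 Re (\<phi> f)\<close>: by the parallelogram law a minimising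
  sequence is Cauchy, and the vanishing of the first variation at its limit is the claim.
\<close>

lemma riesz:
  assumes "bounded_functional \<phi>"
  shows "\<exists>g\<in>H. \<forall>f\<in>H. \<phi> f = ip f g"
proof -
  have add: "\<phi> (f + g) = \<phi> f + \<phi> g" if "f \<in> H" "g \<in> H" for f g
    using assms that by (auto simp: bounded_functional_def)
  have sc: "\<phi> (fscale c f) = c * \<phi> f" if "f \<in> H" for c f
    using assms that by (auto simp: bounded_functional_def)
  obtain C0 where C0: "\<And>f. f \<in> H \<Longrightarrow> cmod (\<phi> f) \<le> C0 * hnorm ip f"
    using assms unfolding bounded_functional_def by blast
  define J where "J f = (hnorm ip f)\<^sup>2 - 2 * Re (\<phi> f)" for f
  define d where "d = Inf (J ` H)"
  have lower: "- C0\<^sup>2 \<le> J f" if "f \<in> H" for f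
  proof -
    have "Re (\<phi> f) \<le> C0 * hnorm ip f"
      using C0[OF that] complex_Re_le_cmod order_trans by blast
    then have "J f \<ge> (hnorm ip f)\<^sup>2 - 2 * (C0 * hnorm ip f)" by (simp add: J_def)
    also have "(hnorm ip f)\<^sup>2 - 2 * (C0 * hnorm ip f) = (hnorm ip f - C0)\<^sup>2 - C0\<^sup>2"
      by (simp add: power2_diff)
    finally show ?thesis by (smt (verit) zero_le_power2)
  qed
  have bdd: "bdd_below (J ` H)" using lower by (auto intro!: bdd_belowI)
  have d_le: "d \<le> J f" if "f \<in> H" for f
    unfolding d_def using bdd that by (auto intro: cInf_lower)
  have "\<exists>u. u \<in> H \<and> J u < d + 1 / (real n + 1)" for n :: nat
  proof -
    have "Inf (J ` H) < d + 1 / (real n + 1)" by (simp add: d_def)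
    then show ?thesis using zero_mem bdd by (subst (asm) cInf_less_iff) auto
  qed
  then obtain u where u: "\<And>n::nat. u n \<in> H" and uJ: "\<And>n. J (u n) < d + 1 / (real n + 1)"
    by metis
  have close: "(hnorm ip (f - g))\<^sup>2 \<le> 2 * (J f - d) + 2 * (J g - d)" if "f \<in> H" "g \<in> H" for f g
  proof -
    define h where "h = fscale (1/2) (f + g)"
    have h: "h \<in> H" using that by (simp add: h_def add_mem scale_mem)
    have n: "(hnorm ip (f + g))\<^sup>2 = 4 * (hnorm ip h)\<^sup>2"
      unfolding h_def using that
      by (subst hnorm_scale) (auto simp: add_mem power_mult_distrib power2_eq_square norm_divide)
    have p: "4 * Re (\<phi> h) = 2 * Re (\<phi> f) + 2 * Re (\<phi> g)"
      unfolding h_def using that by (simp add: sc add add_mem field_simps)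
    have "J h \<ge> d" by (rule d_le[OF h])
    then show ?thesis using parallelogram[OF that] n p unfolding J_def by argo
  qed
  have "\<exists>N. \<forall>m\<ge>N. \<forall>n\<ge>N. hnorm ip (u m - u n) < e" if e: "e > 0" for e
  proof -
    obtain N :: nat where N: "inverse (of_nat (Suc N)) < e\<^sup>2 / 4"
      using reals_Archimedean[of "e\<^sup>2 / 4"] e by auto
    have "hnorm ip (u m - u n) < e" if "m \<ge> N" "n \<ge> N" for m n
    proof -
      have b: "J (u k) - d < e\<^sup>2 / 4" if "k \<ge> N" for k
      proof -
        have "1 / (real k + 1) \<le> 1 / (real N + 1)" using that by (simp add: frac_le)
        then show ?thesis using uJ[of k] N by (simp add: inverse_eq_divide add.commute)
      qed
      have "(hnorm ip (u m - u n))\<^sup>2 < e\<^sup>2"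
        using close[OF u u, of m n] b[OF that(1)] b[OF that(2)] by argo
      then show ?thesis using e by (simp add: power_less_imp_less_base)
    qed
    then show ?thesis by blast
  qed
  then obtain g where g: "g \<in> H" and lim: "(\<lambda>n. hnorm ip (u n - g)) \<longlonglongrightarrow> 0"
    using complete[of u] u by blast
  have Jg: "J g \<le> d"
  proof (rule LIMSEQ_le_const)
    define r where "r n = hnorm ip (u n - g)" for n
    show "(\<lambda>n. d + 1 / (real n + 1) + 2 * hnorm ip g * r n + 2 * C0 * r n) \<longlonglongrightarrow> d"
    proof -
      have "(\<lambda>n. 1 / (real n + 1)) \<longlonglongrightarrow> 0"
        using LIMSEQ_inverse_real_of_nat by (simp add: inverse_eq_divide add.commute)
      moreover have "r \<longlonglongrightarrow> 0" using lim by (simp add: r_def[abs_def])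
      ultimately have "(\<lambda>n. d + 1 / (real n + 1) + 2 * hnorm ip g * r n + 2 * C0 * r n)
          \<longlonglongrightarrow> d + 0 + 2 * hnorm ip g * 0 + 2 * C0 * 0"
        by (intro tendsto_add tendsto_mult tendsto_const)
      then show ?thesis by simp
    qed
    show "\<exists>N. \<forall>n\<ge>N. J g \<le> d + 1 / (real n + 1) + 2 * hnorm ip g * r n + 2 * C0 * r n"
    proof (intro exI allI impI)
      fix n
      have m: "u n - g \<in> H" by (simp add: u g diff_mem)
      have s: "u n = g + fscale 1 (u n - g)" by simp
      have A: "(hnorm ip (u n))\<^sup>2 = (hnorm ip g)\<^sup>2 + 2 * Re (ip (u n - g) g) + (r n)\<^sup>2"
        using hnorm_sq_add_scaled[OF g m, of 1] by (simp add: r_def)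
      have B: "\<phi> (u n) = \<phi> g + \<phi> (u n - g)"
        using add[OF g m] by simp
      have e: "J (u n) = J g + 2 * Re (ip (u n - g) g) + (r n)\<^sup>2 - 2 * Re (\<phi> (u n - g))"
        unfolding J_def A B by simp
      have "- Re (ip (u n - g) g) \<le> hnorm ip g * r n"
        using cauchy_schwarz[OF m g] abs_Re_le_cmod[of "ip (u n - g) g"] by (simp add: r_def mult.commute)
      moreover have "Re (\<phi> (u n - g)) \<le> C0 * r n"
        using C0[OF m] complex_Re_le_cmod[of "\<phi> (u n - g)"] by (simp add: r_def)
      ultimately have "J g \<le> J (u n) + 2 * hnorm ip g * r n + 2 * C0 * r n"
        using e zero_le_power2[of "r n"] by linarith
      then show "J g \<le> d + 1 / (real n + 1) + 2 * hnorm ip g * r n + 2 * C0 * r n"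
        using uJ[of n] by linarith
    qed
  qed
  have "\<phi> f = ip f g" if f: "f \<in> H" for f
  proof -
    have "0 \<le> 0 + 2 * Re (c * (ip f g - \<phi> f)) + (cmod c)\<^sup>2 * (hnorm ip f)\<^sup>2" for c
    proof -
      have "J g \<le> J (g + fscale c f)"
        using Jg d_le[of "g + fscale c f"] g f by (force simp: add_mem scale_mem)
      then show ?thesis unfolding J_def hnorm_sq_add_scaled[OF g f]
        by (simp add: add sc g f scale_mem algebra_simps)
    qed
    then have "(cmod (ip f g - \<phi> f))\<^sup>2 \<le> 0 * (hnorm ip f)\<^sup>2"
      by (rule semi_cauchy_schwarz) simp
    then show ?thesis by simp
  qed
  then show ?thesis using g by blast
qed

lemma adjoint_exists:
  assumes "bounded_operator H ip T" "g \<in> H"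
  shows "\<exists>h\<in>H. \<forall>f\<in>H. ip (T f) g = ip f h"
proof -
  obtain C where C: "\<And>f. f \<in> H \<Longrightarrow> hnorm ip (T f) \<le> C * hnorm ip f"
    using assms(1) unfolding bounded_operator_def by blast
  have T: "T f \<in> H" if "f \<in> H" for f using assms(1) that by (auto simp: bounded_operator_def)
  have "bounded_functional (\<lambda>f. ip (T f) g)"
    unfolding bounded_functional_def
  proof (intro conjI ballI allI exI)
    fix f assume f: "f \<in> H"
    have "cmod (ip (T f) g) \<le> hnorm ip (T f) * hnorm ip g"
      by (rule cauchy_schwarz[OF T[OF f] assms(2)])
    also have "\<dots> \<le> (C * hnorm ip f) * hnorm ip g"
      using C[OF f] assms(2) by (simp add: mult_right_mono)
    finally show "cmod (ip (T f) g) \<le> (C * hnorm ip g) * hnorm ip f" by (simp add: algebra_simps)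
  qed (use assms T in \<open>auto simp: bounded_operator_def ip_add ip_scale\<close>)
  then show ?thesis by (rule riesz)
qed

lemma hilbert_adjoint_eqI:
  assumes "g \<in> H" "h \<in> H" "\<And>f. f \<in> H \<Longrightarrow> ip (T f) g = ip f h"
  shows "hilbert_adjoint H ip T g = h"
  unfolding hilbert_adjoint_def
  by (rule the_equality) (use assms eq_if_ip_eq in \<open>auto\<close>)

lemma hilbert_adjoint_eq_0_iff:
  assumes "bounded_operator H ip T" "g \<in> H"
  shows "hilbert_adjoint H ip T g = 0 \<longleftrightarrow> (\<forall>f\<in>H. ip (T f) g = 0)"
proof -
  obtain h where h: "h \<in> H" "\<And>f. f \<in> H \<Longrightarrow> ip (T f) g = ip f h"
    using adjoint_exists[OF assms] by blast
  have "hilbert_adjoint H ip T g = h"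
    using assms h by (intro hilbert_adjoint_eqI)
  moreover have "h = 0 \<longleftrightarrow> (\<forall>f\<in>H. ip f h = 0)"
    using h(1) eq_if_ip_eq[OF h(1) zero_mem] by auto
  ultimately show ?thesis using h by auto
qed

lemma adjoint_operator:
  assumes T: "bounded_operator H ip T"
  obtains A C where "\<And>g. g \<in> H \<Longrightarrow> A g \<in> H"
    and "\<And>f g. f \<in> H \<Longrightarrow> g \<in> H \<Longrightarrow> ip (T f) g = ip f (A g)"
    and "\<And>g h. g \<in> H \<Longrightarrow> h \<in> H \<Longrightarrow> A (g + h) = A g + A h"
    and "\<And>g c. g \<in> H \<Longrightarrow> A (fscale c g) = fscale c (A g)"
    and "C \<ge> 0" and "\<And>g. g \<in> H \<Longrightarrow> hnorm ip (A g) \<le> C * hnorm ip g"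
proof -
  have "\<forall>g\<in>H. \<exists>h\<in>H. \<forall>f\<in>H. ip (T f) g = ip f h" using adjoint_exists[OF T] by blast
  then obtain A where A: "\<And>g. g \<in> H \<Longrightarrow> A g \<in> H"
    "\<And>f g. f \<in> H \<Longrightarrow> g \<in> H \<Longrightarrow> ip (T f) g = ip f (A g)" by metis
  have TH: "T f \<in> H" if "f \<in> H" for f using T that by (simp add: bounded_operator_def)
  obtain C0 where C0: "\<And>f. f \<in> H \<Longrightarrow> hnorm ip (T f) \<le> C0 * hnorm ip f"
    using T unfolding bounded_operator_def by blast
  define C where "C = max C0 0"
  have C: "hnorm ip (T f) \<le> C * hnorm ip f" if "f \<in> H" for f
  proof -
    have "C0 * hnorm ip f \<le> C * hnorm ip f"
      using that by (intro mult_right_mono) (auto simp: C_def)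
    then show ?thesis using C0[OF that] by linarith
  qed
  have add: "A (g + h) = A g + A h" if gh: "g \<in> H" "h \<in> H" for g h
  proof (rule eq_if_ip_eq)
    fix f assume f: "f \<in> H"
    have "ip f (A (g + h)) = ip (T f) (g + h)" using A(2)[OF f add_mem[OF gh]] by simp
    also have "\<dots> = ip (T f) g + ip (T f) h" by (rule ip_add_right[OF gh TH[OF f]])
    also have "\<dots> = ip f (A g) + ip f (A h)" using A(2)[OF f] gh by simp
    also have "\<dots> = ip f (A g + A h)" using ip_add_right[OF A(1) A(1) f] gh by simp
    finally show "ip f (A (g + h)) = ip f (A g + A h)" .
  qed (intro add_mem A(1) gh)+
  have scale: "A (fscale c g) = fscale c (A g)" if g: "g \<in> H" for g c
  proof (rule eq_if_ip_eq)
    fix f assume f: "f \<in> H"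
    show "ip f (A (fscale c g)) = ip f (fscale c (A g))"
      using A(2)[OF f scale_mem[OF g], of c] A(2)[OF f g] ip_scale_right[OF TH[OF f] g]
        ip_scale_right[OF f A(1)[OF g]] by simp
  qed (intro scale_mem A(1) g)+
  have norm: "hnorm ip (A g) \<le> C * hnorm ip g" if g: "g \<in> H" for g
  proof (cases "hnorm ip (A g) = 0")
    case True
    then show ?thesis using g by (simp add: C_def)
  next
    case False
    then have pos: "hnorm ip (A g) > 0" using hnorm_nonneg[OF A(1)[OF g]] by simp
    have "(hnorm ip (A g))\<^sup>2 = cmod (ip (T (A g)) g)"
      using A(2)[OF A(1)[OF g] g] ip_self[OF A(1)[OF g]] by (simp add: norm_power)
    also have "\<dots> \<le> hnorm ip (T (A g)) * hnorm ip g"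
      by (intro cauchy_schwarz TH A(1) g)
    also have "\<dots> \<le> (C * hnorm ip (A g)) * hnorm ip g"
      by (intro mult_right_mono C A(1) g hnorm_nonneg)
    finally have "hnorm ip (A g) * hnorm ip (A g) \<le> hnorm ip (A g) * (C * hnorm ip g)"
      by (simp add: power2_eq_square mult.commute mult.left_commute)
    then show ?thesis using pos by (rule mult_left_le_imp_le)
  qed
  show ?thesis by (rule that[OF A add scale _ norm]) (simp_all add: C_def)
qed

lemma bounded_operator_shift:
  assumes T: "bounded_operator H ip T"
  shows "bounded_operator H ip (\<lambda>f. T f - fscale c f)"
proof -
  obtain C where C: "\<And>f. f \<in> H \<Longrightarrow> hnorm ip (T f) \<le> C * hnorm ip f"
    using T unfolding bounded_operator_def by blast
  have TH: "T f \<in> H" if "f \<in> H" for f using T that by (simp add: bounded_operator_def)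
  show ?thesis
    unfolding bounded_operator_def
  proof (intro conjI ballI allI exI)
    fix f assume f: "f \<in> H"
    show "T f - fscale c f \<in> H" by (intro diff_mem TH scale_mem f)
    have "hnorm ip (T f - fscale c f) = hnorm ip (T f + fscale (- c) f)"
      by (rule arg_cong[where f = "hnorm ip"]) (simp add: fun_eq_iff)
    also have "\<dots> \<le> hnorm ip (T f) + hnorm ip (fscale (- c) f)"
      by (intro hnorm_triangle TH scale_mem f)
    also have "\<dots> \<le> C * hnorm ip f + cmod c * hnorm ip f"
      using C[OF f] hnorm_scale[OF f, of "- c"] by simp
    finally show "hnorm ip (T f - fscale c f) \<le> (C + cmod c) * hnorm ip f"
      by (simp add: distrib_right)
  next
    fix f g assume "f \<in> H" "g \<in> H"
    then have "T (f + g) = T f + T g" using T by (simp add: bounded_operator_def)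
    then show "T (f + g) - fscale c (f + g) = T f - fscale c f + (T g - fscale c g)"
      by (simp add: fscale_add_right)
  next
    fix f d assume "f \<in> H"
    then have "T (fscale d f) = fscale d (T f)" using T by (simp add: bounded_operator_def)
    then show "T (fscale d f) - fscale c (fscale d f) = fscale d (T f - fscale c f)"
      by (simp add: fscale_diff_right mult.commute)
  qed
qed

text \<open>
  Gliding hump: if \<open>\<parallel>g n\<parallel> \<ge> 4\<^sup>n\<close>, then steps of length \<open>3\<^sup>-\<^sup>n\<close> in the direction \<open>\<plusminus>g n\<close>, with signs
  chosen so that the pairing with \<open>g n\<close> does not cancel, lead to a vector with unbounded pairings.
\<close>

lemma uniform_boundedness:
  assumes G: "G \<subseteq> H" and pt: "\<And>f. f \<in> H \<Longrightarrow> \<exists>C. \<forall>g\<in>G. cmod (ip f g) \<le> C"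
  shows "\<exists>C. \<forall>g\<in>G. hnorm ip g \<le> C"
proof (rule ccontr)
  assume "\<not> ?thesis"
  then have "\<exists>g\<in>G. hnorm ip g > 4 ^ n" for n :: nat by (meson not_le)
  then obtain g where gG: "\<And>n::nat. g n \<in> G" and big: "\<And>n. hnorm ip (g n) > 4 ^ n" by metis
  have gH: "g n \<in> H" for n using gG G by auto
  define st where "st n x = fscale (of_real ((1/3) ^ n / hnorm ip (g n))) (g n)" for n and x :: "'x \<Rightarrow> 'i \<Rightarrow> complex"
  define x where "x = rec_nat 0 (\<lambda>n y. if 0 \<le> Re (ip y (g n)) then y + st n y else y - st n y)"
  have x0: "x 0 = 0" by (simp add: x_def)
  have xS: "x (Suc n) = (if 0 \<le> Re (ip (x n) (g n)) then x n + st n (x n) else x n - st n (x n))" for n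
    by (simp add: x_def)
  have stH: "st n y \<in> H" for n y by (simp add: st_def scale_mem gH)
  have xH: "x n \<in> H" for n
  proof (induction n)
    case 0
    show ?case unfolding x0 by (rule zero_mem)
  next
    case (Suc n)
    then show ?case unfolding xS using add_mem diff_mem stH by auto
  qed
  have ng: "hnorm ip (g n) > 0" for n using big[of n] by (smt (verit) zero_less_power)
  have nst: "hnorm ip (st n y) = (1/3) ^ n" for n y
    unfolding st_def using ng[of n] by (subst hnorm_scale[OF gH]) (simp add: norm_divide norm_power)
  have ipst: "ip (st n y) (g n) = of_real ((1/3) ^ n * hnorm ip (g n))" for n y
  proof -
    have "ip (st n y) (g n) = of_real ((1/3) ^ n / hnorm ip (g n) * (hnorm ip (g n))\<^sup>2)"
      unfolding st_def by (simp add: ip_scale gH ip_self)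
    then show ?thesis using ng[of n] by (simp add: power2_eq_square)
  qed
  have hump: "(1/3) ^ n * hnorm ip (g n) \<le> cmod (ip (x (Suc n)) (g n))" for n
  proof -
    have p: "0 \<le> (1/3) ^ n * hnorm ip (g n)" using ng[of n] by simp
    have "(1/3) ^ n * hnorm ip (g n) \<le> \<bar>Re (ip (x (Suc n)) (g n))\<bar>"
      using p by (auto simp: xS ip_add ip_diff xH stH gH ipst simp del: of_real_mult)
    then show ?thesis using abs_Re_le_cmod order_trans by blast
  qed
  have step: "hnorm ip (x (Suc n) - x n) = (1/3) ^ n" for n
  proof (cases "0 \<le> Re (ip (x n) (g n))")
    case True
    then show ?thesis by (simp add: xS nst)
  next
    case False
    have "x n - st n (x n) - x n = fscale (-1) (st n (x n))"
      by (simp add: fun_eq_iff)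
    then show ?thesis using False by (simp add: xS hnorm_scale stH nst)
  qed
  have tail: "hnorm ip (x (n + k) - x n) \<le> (3/2) * (1/3) ^ n" for n k
  proof -
    have "hnorm ip (x (n + k) - x n) \<le> (3/2) * (1/3) ^ n * (1 - (1/3) ^ k)"
    proof (induction k)
      case 0
      have "x (n + 0) - x n = 0" by (simp only: add_0_right diff_self)
      moreover have "hnorm ip 0 = 0" using hnorm_eq_0[OF zero_mem] by blast
      ultimately show ?case by (simp only:) simp
    next
      case (Suc k)
      have "x (n + Suc k) - x n = (x (n + k) - x n) + (x (Suc (n + k)) - x (n + k))"
        by (simp add: fun_eq_iff)
      then have "hnorm ip (x (n + Suc k) - x n)
        \<le> hnorm ip (x (n + k) - x n) + hnorm ip (x (Suc (n + k)) - x (n + k))"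
        using hnorm_triangle[of "x (n + k) - x n" "x (Suc (n + k)) - x (n + k)"]
        by (simp only: diff_mem xH)
      also have "\<dots> \<le> (3/2) * (1/3) ^ n * (1 - (1/3) ^ k) + (1/3) ^ (n + k)"
        using Suc step[of "n + k"] by linarith
      also have "\<dots> = (3/2) * (1/3) ^ n * (1 - (1/3) ^ Suc k)"
        by (simp add: power_add field_simps)
      finally show ?case .
    qed
    also have "\<dots> \<le> (3/2) * (1/3) ^ n * 1"
      by (intro mult_left_mono) auto
    finally show ?thesis by simp
  qed
  have "\<exists>N. \<forall>m\<ge>N. \<forall>n\<ge>N. hnorm ip (x m - x n) < e" if e: "e > 0" for e
  proof -
    obtain N where N: "(1/3::real) ^ N < e / 3"
      using real_arch_pow_inv[of "e/3" "1/3"] e by auto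
    have "hnorm ip (x m - x n) < e" if mn: "m \<ge> N" "n \<ge> N" for m n
    proof -
      have a: "hnorm ip (x m - x N) \<le> (3/2) * (1/3) ^ N" if "m \<ge> N" for m
        using tail[of N "m - N"] that by simp
      have "x m - x n = (x m - x N) + (x N - x n)" by (simp add: fun_eq_iff)
      then have "hnorm ip (x m - x n) \<le> hnorm ip (x m - x N) + hnorm ip (x N - x n)"
        using hnorm_triangle[of "x m - x N" "x N - x n"] by (simp only: diff_mem xH)
      also have "\<dots> \<le> 3 * (1/3) ^ N"
        using a[OF mn(1)] a[OF mn(2)] hnorm_minus_commute[OF xH xH, of N n] by linarith
      finally show ?thesis using N by simp
    qed
    then show ?thesis by blast
  qed
  then obtain y where y: "y \<in> H" and lim: "(\<lambda>n. hnorm ip (x n - y)) \<longlonglongrightarrow> 0"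
    using complete[of x] xH by blast
  have ytail: "hnorm ip (x n - y) \<le> (3/2) * (1/3) ^ n" for n
  proof (rule LIMSEQ_le_const)
    show "(\<lambda>k. (3/2) * (1/3) ^ n + hnorm ip (x (n + k) - y)) \<longlonglongrightarrow> (3/2) * (1/3) ^ n"
      using LIMSEQ_ignore_initial_segment[OF lim, of n]
      by (auto intro!: tendsto_eq_intros simp: add.commute)
    show "\<exists>N. \<forall>k\<ge>N. hnorm ip (x n - y) \<le> (3/2) * (1/3) ^ n + hnorm ip (x (n + k) - y)"
    proof (intro exI allI impI)
      fix k
      have "x n - y = (x n - x (n + k)) + (x (n + k) - y)" by (simp add: fun_eq_iff)
      then have "hnorm ip (x n - y) \<le> hnorm ip (x n - x (n + k)) + hnorm ip (x (n + k) - y)"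
        using hnorm_triangle[of "x n - x (n + k)" "x (n + k) - y"] by (simp only: diff_mem xH y)
      then show "hnorm ip (x n - y) \<le> (3/2) * (1/3) ^ n + hnorm ip (x (n + k) - y)"
        using tail[of n k] hnorm_minus_commute[OF xH xH, of n "n + k"] by linarith
    qed
  qed
  have large: "(1/2) * (4/3) ^ n \<le> cmod (ip y (g n))" for n
  proof -
    have "ip (x (Suc n)) (g n) = ip y (g n) + ip (x (Suc n) - y) (g n)"
      by (simp add: ip_diff xH y gH)
    then have "cmod (ip (x (Suc n)) (g n)) \<le> cmod (ip y (g n)) + cmod (ip (x (Suc n) - y) (g n))"
      by (simp add: norm_triangle_ineq)
    also have "cmod (ip (x (Suc n) - y) (g n)) \<le> hnorm ip (x (Suc n) - y) * hnorm ip (g n)"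
      by (intro cauchy_schwarz diff_mem xH y gH)
    also have "\<dots> \<le> (1/2) * (1/3) ^ n * hnorm ip (g n)"
      using ytail[of "Suc n"] ng[of n] by (intro mult_right_mono) auto
    finally have "(1/2) * ((1/3) ^ n * hnorm ip (g n)) \<le> cmod (ip y (g n))"
      using hump[of n] by linarith
    moreover have "(1/3) ^ n * 4 ^ n \<le> (1/3) ^ n * hnorm ip (g n)"
      using big[of n] by (intro mult_left_mono) auto
    moreover have "(1/3::real) ^ n * 4 ^ n = (4/3) ^ n" by (simp add: power_mult_distrib[symmetric])
    ultimately show ?thesis by linarith
  qed
  obtain C where C: "\<And>n. cmod (ip y (g n)) \<le> C" using pt[OF y] gG by blast
  obtain n where "2 * C < (4/3) ^ n" using real_arch_pow[of "4/3" "2 * C"] by auto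
  then show False using large[of n] C[of n] by linarith
qed

text \<open>
  Banach-Steinhaus: a weakly convergent sequence is bounded, hence so is its limit functional, and Riesz
  applies. Derivatives at a point will be obtained in this way from difference quotients.
\<close>

lemma weak_limit:
  assumes gH: "\<And>n::nat. g n \<in> H" and lim: "\<And>f. f \<in> H \<Longrightarrow> (\<lambda>n. ip f (g n)) \<longlonglongrightarrow> \<phi> f"
  shows "\<exists>h\<in>H. \<forall>f\<in>H. \<phi> f = ip f h"
proof -
  have "\<exists>C. \<forall>h\<in>range g. hnorm ip h \<le> C"
  proof (rule uniform_boundedness)
    fix f assume f: "f \<in> H"
    have "Bseq (\<lambda>n. ip f (g n))" using lim[OF f] convergentI convergent_imp_Bseq by blast
    then show "\<exists>C. \<forall>h\<in>range g. cmod (ip f h) \<le> C" by (auto simp: Bseq_def)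
  qed (use gH in auto)
  then obtain C where C: "\<And>n. hnorm ip (g n) \<le> C" by auto
  have "bounded_functional \<phi>"
    unfolding bounded_functional_def
  proof (intro conjI ballI allI exI)
    fix f h assume fh: "f \<in> H" "h \<in> H"
    have "(\<lambda>n. ip (f + h) (g n)) \<longlonglongrightarrow> \<phi> f + \<phi> h"
      using tendsto_add[OF lim[OF fh(1)] lim[OF fh(2)]] by (simp add: ip_add fh gH)
    then show "\<phi> (f + h) = \<phi> f + \<phi> h"
      using lim[OF add_mem[OF fh]] LIMSEQ_unique by blast
  next
    fix f c assume f: "f \<in> H"
    have "(\<lambda>n. ip (fscale c f) (g n)) \<longlonglongrightarrow> c * \<phi> f"
      using tendsto_mult_left[OF lim[OF f], of c] by (simp add: ip_scale f gH)
    then show "\<phi> (fscale c f) = c * \<phi> f"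
      using lim[OF scale_mem[OF f]] LIMSEQ_unique by blast
  next
    fix f assume f: "f \<in> H"
    show "cmod (\<phi> f) \<le> C * hnorm ip f"
    proof (rule LIMSEQ_le_const2)
      show "(\<lambda>n. cmod (ip f (g n))) \<longlonglongrightarrow> cmod (\<phi> f)" using lim[OF f] by (rule tendsto_norm)
      have "cmod (ip f (g n)) \<le> C * hnorm ip f" for n
      proof -
        have "cmod (ip f (g n)) \<le> hnorm ip f * hnorm ip (g n)" by (rule cauchy_schwarz[OF f gH])
        also have "\<dots> \<le> hnorm ip f * C" using C f by (intro mult_left_mono) auto
        finally show ?thesis by (simp add: mult.commute)
      qed
      then show "\<exists>N. \<forall>n\<ge>N. cmod (ip f (g n)) \<le> C * hnorm ip f" by blast
    qed
  qed
  then show ?thesis by (rule riesz)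
qed

end

section \<open>Elementary tensors\<close>

definition bilinear_pairing ::
  "('x \<Rightarrow> 'i \<Rightarrow> complex) set \<Rightarrow> ('y \<Rightarrow> 'j \<Rightarrow> complex) set \<Rightarrow>
   (('x \<Rightarrow> 'i \<Rightarrow> complex) \<Rightarrow> ('y \<Rightarrow> 'j \<Rightarrow> complex) \<Rightarrow> complex) \<Rightarrow> bool" where
  "bilinear_pairing H1 H2 B \<longleftrightarrow>
     (\<forall>u\<in>H1. \<forall>u'\<in>H1. \<forall>x\<in>H2. B (u + u') x = B u x + B u' x) \<and>
     (\<forall>u\<in>H1. \<forall>x\<in>H2. \<forall>x'\<in>H2. B u (x + x') = B u x + B u x') \<and>
     (\<forall>u\<in>H1. \<forall>x\<in>H2. \<forall>c. B (fscale c u) x = c * B u x \<and> B u (fscale c x) = c * B u x)"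

text \<open>
  A list of pairs \<open>(u, x)\<close> stands for the element \<open>\<Sum> u \<otimes> x\<close> of the algebraic tensor product of two
  Hilbert spaces, and \<open>tensor_eval B\<close> is the linear form induced by the bilinear form \<open>B\<close>. Two lists
  represent the same tensor if all bilinear forms agree on them.
\<close>

definition tensor_eval :: "('u \<Rightarrow> 'v \<Rightarrow> complex) \<Rightarrow> ('u \<times> 'v) list \<Rightarrow> complex" where
  "tensor_eval B t = (\<Sum>(u, x)\<leftarrow>t. B u x)"

lemma tensor_eval_simps [simp]:
  "tensor_eval B [] = 0"
  "tensor_eval B (p # t) = B (fst p) (snd p) + tensor_eval B t"
  "tensor_eval B (s @ t) = tensor_eval B s + tensor_eval B t"
  by (auto simp: tensor_eval_def case_prod_beta)

lemma sum_list_swap: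
  "(\<Sum>x\<leftarrow>xs. \<Sum>y\<leftarrow>ys. f x y) = (\<Sum>y\<leftarrow>ys. \<Sum>x\<leftarrow>xs. f x y :: 'a::comm_monoid_add)"
  by (induction xs) (simp_all add: sum_list_addf)

lemma sum_list_pair_add:
  "(\<Sum>(u, x)\<leftarrow>s. F u x + G u x :: complex) = (\<Sum>(u, x)\<leftarrow>s. F u x) + (\<Sum>(u, x)\<leftarrow>s. G u x)"
  by (induction s) auto

locale hilbert_tensor =
  one: hilbert_function_space H1 ip1 + two: hilbert_function_space H2 ip2
  for H1 :: "('x \<Rightarrow> 'i \<Rightarrow> complex) set" and ip1
    and H2 :: "('y \<Rightarrow> 'j \<Rightarrow> complex) set" and ip2
begin

text \<open>The inner product of the Hilbert space tensor product.\<close>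

definition tensor_ip where
  "tensor_ip s t = (\<Sum>(u, x)\<leftarrow>s. \<Sum>(v, y)\<leftarrow>t. ip1 u v * ip2 x y)"

lemma bilinear_ip:
  assumes "f \<in> H1" "g \<in> H2"
  shows "bilinear_pairing H1 H2 (\<lambda>u x. ip1 u f * ip2 x g)"
  using assms
  by (auto simp: bilinear_pairing_def one.ip_add two.ip_add one.ip_scale two.ip_scale algebra_simps)

lemma bilinear_tensor_ip:
  "set t \<subseteq> H1 \<times> H2 \<Longrightarrow> bilinear_pairing H1 H2 (\<lambda>u x. \<Sum>(v, y)\<leftarrow>t. ip1 u v * ip2 x y)"
proof (induction t)
  case (Cons p t)
  have "bilinear_pairing H1 H2 (\<lambda>u x. ip1 u (fst p) * ip2 x (snd p))"
    using Cons.prems by (intro bilinear_ip) auto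
  then show ?case using Cons
    by (auto simp: bilinear_pairing_def algebra_simps)
qed (auto simp: bilinear_pairing_def)

lemma tensor_ip_eval: "tensor_ip s t = tensor_eval (\<lambda>u x. \<Sum>(v, y)\<leftarrow>t. ip1 u v * ip2 x y) s"
  by (simp add: tensor_ip_def tensor_eval_def)

lemma tensor_ip_cnj:
  assumes "set s \<subseteq> H1 \<times> H2" "set t \<subseteq> H1 \<times> H2"
  shows "tensor_ip t s = cnj (tensor_ip s t)"
proof -
  have "cnj (\<Sum>(v, y)\<leftarrow>t. ip1 u v * ip2 x y) = (\<Sum>(v, y)\<leftarrow>t. ip1 v u * ip2 y x)"
    if "u \<in> H1" "x \<in> H2" for u x
    using assms(2) by (induction t) (auto simp: that one.ip_cnj[of u] two.ip_cnj[of x])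
  then have "cnj (tensor_ip s t) = (\<Sum>(u, x)\<leftarrow>s. \<Sum>(v, y)\<leftarrow>t. ip1 v u * ip2 y x)"
    using assms(1) unfolding tensor_ip_def by (induction s) auto
  also have "\<dots> = tensor_ip t s"
    unfolding tensor_ip_def split_def by (rule sum_list_swap)
  finally show ?thesis by simp
qed

definition same_tensor where
  "same_tensor s t \<longleftrightarrow> set s \<subseteq> H1 \<times> H2 \<and> set t \<subseteq> H1 \<times> H2 \<and>
     (\<forall>B. bilinear_pairing H1 H2 B \<longrightarrow> tensor_eval B s = tensor_eval B t)"

text \<open>
  The form depends only on the tensor because it is bilinear in its first list and conjugate symmetric.
\<close>

lemma tensor_ip_same:
  assumes "same_tensor s t"
  shows "tensor_ip s s = tensor_ip t t"
proof -
  have st: "set s \<subseteq> H1 \<times> H2" "set t \<subseteq> H1 \<times> H2"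
    and eq: "\<And>B. bilinear_pairing H1 H2 B \<Longrightarrow> tensor_eval B s = tensor_eval B t"
    using assms by (auto simp: same_tensor_def)
  have "tensor_ip s s = tensor_ip t s"
    unfolding tensor_ip_eval by (intro eq bilinear_tensor_ip st)
  also have "\<dots> = cnj (tensor_ip s t)" by (rule tensor_ip_cnj[OF st])
  also have "tensor_ip s t = tensor_ip t t"
    unfolding tensor_ip_eval by (intro eq bilinear_tensor_ip st)
  also have "cnj (tensor_ip t t) = tensor_ip t t"
    using tensor_ip_cnj[OF st(2) st(2)] by simp
  finally show ?thesis .
qed

fun orthonormal :: "('y \<Rightarrow> 'j \<Rightarrow> complex) list \<Rightarrow> bool" where
  "orthonormal [] \<longleftrightarrow> True"
| "orthonormal (e # es) \<longleftrightarrow> ip2 e e = 1 \<and> (\<forall>e'\<in>set es. ip2 e e' = 0) \<and> orthonormal es"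

lemma bilinear_zero:
  assumes "bilinear_pairing H1 H2 B" "u \<in> H1" "x \<in> H2"
  shows "B 0 x = 0" "B u 0 = 0"
proof -
  have "B (fscale 0 u) x = 0 * B u x" "B u (fscale 0 x) = 0 * B u x"
    using assms unfolding bilinear_pairing_def by blast+
  then show "B 0 x = 0" "B u 0 = 0" by simp_all
qed

text \<open>
  Gram-Schmidt in the second factor: the first vector is normalised, and its components are moved from
  all later tensors into the first factor. What remains is orthogonal to it and shorter; that the new
  vectors lie in the span of the old ones is recorded through the orthogonal complements.
\<close>

lemma orthonormal_form:
  "set t \<subseteq> H1 \<times> H2 \<Longrightarrow> \<exists>s. same_tensor t s \<and> orthonormal (map snd s) \<and>
    (\<forall>y\<in>H2. (\<forall>q\<in>set t. ip2 (snd q) y = 0) \<longrightarrow> (\<forall>q\<in>set s. ip2 (snd q) y = 0))"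
proof (induction t rule: length_induct)
  case (1 t)
  show ?case
  proof (cases t)
    case Nil
    then show ?thesis by (intro exI[of _ "[]"]) (simp add: same_tensor_def)
  next
    case (Cons p t0)
    obtain u x where p: "p = (u, x)" and u: "u \<in> H1" and x: "x \<in> H2" and t0: "set t0 \<subseteq> H1 \<times> H2"
      using "1.prems" Cons by auto
    show ?thesis
    proof (cases "x = 0")
      case True
      obtain s where s: "same_tensor t0 s" "orthonormal (map snd s)"
        "\<forall>y\<in>H2. (\<forall>q\<in>set t0. ip2 (snd q) y = 0) \<longrightarrow> (\<forall>q\<in>set s. ip2 (snd q) y = 0)"
        using "1.IH" t0 Cons by auto
      have "same_tensor t s"
        using s(1) "1.prems" bilinear_zero(2)[OF _ u x] by (simp add: same_tensor_def Cons p True)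
      then show ?thesis using s(2,3) Cons by (intro exI[of _ s]) auto
    next
      case False
      define n where "n = hnorm ip2 x"
      have n: "n > 0" using False two.hnorm_eq_0[OF x] two.hnorm_nonneg[OF x] by (simp add: n_def)
      define e where "e = fscale (of_real (1 / n)) x"
      have eH: "e \<in> H2" by (simp add: e_def two.scale_mem x)
      have xe: "x = fscale (of_real n) e" using n by (simp add: e_def)
      have "hnorm ip2 e = 1"
        unfolding e_def using n by (subst two.hnorm_scale[OF x]) (simp add: n_def norm_divide)
      then have ee: "ip2 e e = 1" using two.ip_self[OF eH] by simp
      define rem where "rem = map (\<lambda>q. (fst q :: 'x \<Rightarrow> 'i \<Rightarrow> complex, snd q - fscale (ip2 (snd q) e) e))"
      have remH: "set (rem r) \<subseteq> H1 \<times> H2" if "set r \<subseteq> H1 \<times> H2" for r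
        using that eH by (auto simp: rem_def two.diff_mem two.scale_mem)
      have "\<exists>U\<in>H1. \<forall>B. bilinear_pairing H1 H2 B \<longrightarrow> tensor_eval B r = B U e + tensor_eval B (rem r)"
        if "set r \<subseteq> H1 \<times> H2" for r
        using that
      proof (induction r)
        case Nil
        have "tensor_eval B [] = B 0 e + tensor_eval B (rem [])" if "bilinear_pairing H1 H2 B" for B
          using bilinear_zero(1)[OF that u eH] by (simp only: rem_def list.map tensor_eval_simps add_0_right)
        then show ?case using one.zero_mem by blast
      next
        case (Cons q r)
        obtain v y where q: "q = (v, y)" "v \<in> H1" "y \<in> H2" using Cons.prems by auto
        obtain U where U: "U \<in> H1" "\<And>B. bilinear_pairing H1 H2 B \<Longrightarrow> tensor_eval B r = B U e + tensor_eval B (rem r)"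
          using Cons by auto
        define U' where "U' = fscale (ip2 y e) v + U"
        have "tensor_eval B (q # r) = B U' e + tensor_eval B (rem (q # r))" if B: "bilinear_pairing H1 H2 B" for B
        proof -
          have yH: "y - fscale (ip2 y e) e \<in> H2" by (intro two.diff_mem two.scale_mem q eH)
          have "B v (y - fscale (ip2 y e) e + fscale (ip2 y e) e)
              = B v (y - fscale (ip2 y e) e) + ip2 y e * B v e"
            using B q(2) yH eH two.scale_mem[OF eH] by (simp only: bilinear_pairing_def)
          moreover have "B U' e = ip2 y e * B v e + B U e"
            using B q(2) U(1) eH one.scale_mem[OF q(2)] by (simp only: U'_def bilinear_pairing_def)
          ultimately show ?thesis using U(2)[OF B] by (simp add: q(1) rem_def)
        qed
        moreover have "U' \<in> H1" by (simp add: U'_def one.add_mem one.scale_mem U q)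
        ultimately show ?case by blast
      qed
      from this[OF t0] obtain U where U: "U \<in> H1"
        "\<And>B. bilinear_pairing H1 H2 B \<Longrightarrow> tensor_eval B t0 = B U e + tensor_eval B (rem t0)" by blast
      have "length (rem t0) < length t" by (simp add: rem_def Cons)
      then obtain s where s: "same_tensor (rem t0) s" "orthonormal (map snd s)"
        "\<And>y. y \<in> H2 \<Longrightarrow> \<forall>q\<in>set (rem t0). ip2 (snd q) y = 0 \<Longrightarrow> \<forall>q\<in>set s. ip2 (snd q) y = 0"
        using "1.IH" remH[OF t0] by blast
      have sH: "set s \<subseteq> H1 \<times> H2" using s(1) by (simp add: same_tensor_def)
      define V where "V = fscale (of_real n) u + U"
      have VH: "V \<in> H1" by (simp add: V_def one.add_mem one.scale_mem u U)
      have "same_tensor t ((V, e) # s)"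
        unfolding same_tensor_def
      proof (intro conjI allI impI)
        fix B assume B: "bilinear_pairing H1 H2 B"
        have "B V e = of_real n * B u e + B U e"
          using B u U(1) eH one.scale_mem[OF u] by (simp only: V_def bilinear_pairing_def)
        moreover have "B u x = of_real n * B u e"
          using B u eH by (subst xe) (simp only: bilinear_pairing_def)
        moreover have "tensor_eval B (rem t0) = tensor_eval B s" using s(1) B by (simp add: same_tensor_def)
        ultimately show "tensor_eval B t = tensor_eval B ((V, e) # s)" using U(2)[OF B] by (simp add: Cons p)
      qed (use "1.prems" sH VH eH in auto)
      moreover have "orthonormal (map snd ((V, e) # s))"
      proof -
        have "\<forall>q\<in>set (rem t0). ip2 (snd q) e = 0"
          using t0 eH ee by (auto simp: rem_def two.ip_diff two.ip_scale two.scale_mem)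
        note perp = s(3)[OF eH this]
        have "ip2 e e' = 0" if "e' \<in> set (map snd s)" for e'
        proof -
          from that obtain q where q: "q \<in> set s" "e' = snd q" by auto
          then have "e' \<in> H2" "ip2 e' e = 0" using sH perp by auto
          then show ?thesis using two.ip_cnj[of e' e] eH by simp
        qed
        then show ?thesis using s(2) ee by simp
      qed
      moreover have "\<forall>q\<in>set ((V, e) # s). ip2 (snd q) y = 0"
        if y: "y \<in> H2" "\<forall>q\<in>set t. ip2 (snd q) y = 0" for y
      proof -
        have ey: "ip2 e y = 0" using y Cons p by (simp add: e_def two.ip_scale x)
        have "ip2 (snd q - fscale (ip2 (snd q) e) e) y = 0" if q: "q \<in> set t0" for q
        proof -
          have "snd q \<in> H2" using t0 q by auto
          moreover have "ip2 (snd q) y = 0" using y(2) q Cons by simp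
          ultimately show ?thesis using eH y(1) ey by (simp add: two.ip_diff two.ip_scale two.scale_mem)
        qed
        then have "\<forall>q\<in>set (rem t0). ip2 (snd q) y = 0" by (simp add: rem_def)
        from s(3)[OF y(1) this] ey show ?thesis by simp
      qed
      ultimately show ?thesis by blast
    qed
  qed
qed

lemma tensor_ip_append:
  "tensor_ip (s @ t) (s @ t) = tensor_ip s s + tensor_ip s t + tensor_ip t s + tensor_ip t t"
  by (simp add: tensor_ip_def sum_list_pair_add)

lemma tensor_ip_orthonormal:
  assumes "set s \<subseteq> H1 \<times> H2" "orthonormal (map snd s)"
  shows "tensor_ip s s = of_real (\<Sum>(u, x)\<leftarrow>s. (hnorm ip1 u)\<^sup>2)"
  using assms
proof (induction s)
  case (Cons p s)
  obtain u e where p: "p = (u, e)" "u \<in> H1" "e \<in> H2" using Cons.prems by auto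
  have e: "ip2 e e = 1" "\<forall>e'\<in>set (map snd s). ip2 e e' = 0" using Cons.prems p by auto
  have cross: "(\<Sum>(v, y)\<leftarrow>s. ip1 u v * ip2 e y) = 0"
    using e(2) by (induction s) auto
  have pH: "set [p] \<subseteq> H1 \<times> H2" and sH: "set s \<subseteq> H1 \<times> H2" using Cons.prems by auto
  have "tensor_ip [p] s = (\<Sum>(v, y)\<leftarrow>s. ip1 u v * ip2 e y)"
    by (simp add: tensor_ip_def p)
  then have "tensor_ip [p] s = 0" using cross by simp
  moreover have "tensor_ip s [p] = 0"
    using tensor_ip_cnj[OF pH sH] calculation by simp
  moreover have "tensor_ip [p] [p] = of_real ((hnorm ip1 u)\<^sup>2)"
    using p e by (simp add: tensor_ip_def one.ip_self)
  moreover have "tensor_ip (p # s) (p # s)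
      = tensor_ip [p] [p] + tensor_ip [p] s + tensor_ip s [p] + tensor_ip s s"
    using tensor_ip_append[of "[p]" s] by simp
  ultimately show ?case using Cons p by simp
qed (simp add: tensor_ip_def)

lemma tensor_ip_nonneg:
  assumes "set t \<subseteq> H1 \<times> H2"
  shows "0 \<le> Re (tensor_ip t t)"
proof -
  obtain s where s: "same_tensor t s" "orthonormal (map snd s)"
    using orthonormal_form[OF assms] by blast
  then have "tensor_ip t t = of_real (\<Sum>(u, x)\<leftarrow>s. (hnorm ip1 u)\<^sup>2)"
    using tensor_ip_same[OF s(1)] tensor_ip_orthonormal[of s] by (simp add: same_tensor_def)
  moreover have "0 \<le> (\<Sum>(u, x)\<leftarrow>s. (hnorm ip1 u)\<^sup>2)" by (induction s) auto
  ultimately show ?thesis by simp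
qed

text \<open>
  The quadratic form is definite on tensors: in orthonormal form it is a sum of squares of the first
  factors, and if these vanish, so does the tensor.
\<close>

lemma tensor_eval_eq_0:
  assumes "set t \<subseteq> H1 \<times> H2" "Re (tensor_ip t t) = 0" "bilinear_pairing H1 H2 B"
  shows "tensor_eval B t = 0"
proof -
  obtain s where s: "same_tensor t s" "orthonormal (map snd s)"
    using orthonormal_form[OF assms(1)] by blast
  have sH: "set s \<subseteq> H1 \<times> H2" using s by (simp add: same_tensor_def)
  have "(\<Sum>(u, x)\<leftarrow>s. (hnorm ip1 u)\<^sup>2) = 0"
    using tensor_ip_same[OF s(1)] tensor_ip_orthonormal[OF sH s(2)] assms(2) by simp
  then have "tensor_eval B s = 0"
    using sH
  proof (induction s)
    case (Cons p s)
    obtain u e where p: "p = (u, e)" "u \<in> H1" "e \<in> H2" using Cons.prems by auto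
    have "0 \<le> (\<Sum>(u, x)\<leftarrow>s. (hnorm ip1 u)\<^sup>2)" by (induction s) auto
    then have z: "(hnorm ip1 u)\<^sup>2 = 0" "(\<Sum>(u, x)\<leftarrow>s. (hnorm ip1 u)\<^sup>2) = 0"
      using Cons.prems p zero_le_power2[of "hnorm ip1 u"] by (auto simp: add_nonneg_eq_0_iff)
    then have "u = 0" using one.hnorm_eq_0[OF p(2)] by simp
    moreover have "B 0 e = 0" by (rule bilinear_zero(1)[OF assms(3) p(2,3)])
    ultimately show ?case using Cons p z by simp
  qed simp
  then show ?thesis using s(1) assms(3) by (simp add: same_tensor_def)
qed

text \<open>In orthonormal form an operator on the first factor acts on each component separately.\<close>

lemma tensor_ip_operator_bound:
  assumes t: "set t \<subseteq> H1 \<times> H2"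
    and A: "\<And>u. u \<in> H1 \<Longrightarrow> A u \<in> H1" "\<And>u v. u \<in> H1 \<Longrightarrow> v \<in> H1 \<Longrightarrow> A (u + v) = A u + A v"
      "\<And>u c. u \<in> H1 \<Longrightarrow> A (fscale c u) = fscale c (A u)"
    and C: "\<And>u. u \<in> H1 \<Longrightarrow> hnorm ip1 (A u) \<le> C * hnorm ip1 u"
  shows "Re (tensor_ip (map (\<lambda>(u, x). (A u, x)) t) (map (\<lambda>(u, x). (A u, x)) t))
    \<le> C\<^sup>2 * Re (tensor_ip t t)"
proof -
  let ?A = "map (\<lambda>(u, x). (A u, x))"
  obtain s where s: "same_tensor t s" "orthonormal (map snd s)"
    using orthonormal_form[OF t] by blast
  have sH: "set s \<subseteq> H1 \<times> H2" using s by (simp add: same_tensor_def)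
  have AH: "set (?A r) \<subseteq> H1 \<times> H2" if "set r \<subseteq> H1 \<times> H2" for r using that A(1) by auto
  have "same_tensor (?A t) (?A s)"
    unfolding same_tensor_def
  proof (intro conjI allI impI AH t sH)
    fix B :: "('x \<Rightarrow> 'i \<Rightarrow> complex) \<Rightarrow> ('y \<Rightarrow> 'j \<Rightarrow> complex) \<Rightarrow> complex"
    assume B: "bilinear_pairing H1 H2 B"
    have e: "tensor_eval B (?A r) = tensor_eval (\<lambda>u x. B (A u) x) r" for r
      by (induction r) auto
    have "bilinear_pairing H1 H2 (\<lambda>u x. B (A u) x)"
      using B A by (simp add: bilinear_pairing_def)
    then show "tensor_eval B (?A t) = tensor_eval B (?A s)"
      using s(1) unfolding e same_tensor_def by blast
  qed
  then have "Re (tensor_ip (?A t) (?A t)) = Re (tensor_ip (?A s) (?A s))"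
    by (simp add: tensor_ip_same)
  also have "map snd (?A s) = map snd s" by (simp add: case_prod_beta)
  then have "Re (tensor_ip (?A s) (?A s)) = (\<Sum>(u, x)\<leftarrow>?A s. (hnorm ip1 u)\<^sup>2)"
    using tensor_ip_orthonormal[OF AH[OF sH]] s(2) by (metis Re_complex_of_real)
  also have "\<dots> \<le> C\<^sup>2 * (\<Sum>(u, x)\<leftarrow>s. (hnorm ip1 u)\<^sup>2)"
    using sH
  proof (induction s)
    case (Cons p s)
    have "(hnorm ip1 (A (fst p)))\<^sup>2 \<le> (C * hnorm ip1 (fst p))\<^sup>2"
      using Cons.prems by (intro power_mono C one.hnorm_nonneg A(1)) auto
    then show ?case using Cons by (auto simp: algebra_simps case_prod_beta power_mult_distrib)
  qed simp
  also have "(\<Sum>(u, x)\<leftarrow>s. (hnorm ip1 u)\<^sup>2) = Re (tensor_ip t t)"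
    using tensor_ip_orthonormal[OF sH s(2)] tensor_ip_same[OF s(1)] by simp
  finally show ?thesis .
qed

text \<open>
  The functional is the inner product with the elementary tensor \<open>f \<otimes> g\<close>, so this is Cauchy-Schwarz in
  the tensor product.
\<close>

lemma tensor_functional_bound:
  assumes t: "set t \<subseteq> H1 \<times> H2" and f: "f \<in> H1" and g: "g \<in> H2"
  shows "cmod (tensor_eval (\<lambda>u x. ip1 u f * ip2 x g) t)
    \<le> hnorm ip1 f * hnorm ip2 g * sqrt (Re (tensor_ip t t))"
proof -
  let ?b = "tensor_eval (\<lambda>u x. ip1 u f * ip2 x g) t"
  define r where "r c = (fscale c f, g)" for c
  have rH: "set [r c] \<subseteq> H1 \<times> H2" for c using f g by (auto simp: r_def one.scale_mem)
  have cross: "tensor_ip t [r c] = cnj c * ?b" for c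
    using t unfolding tensor_ip_def
    by (induction t) (auto simp: r_def one.ip_scale_right f algebra_simps)
  have "(cmod ?b)\<^sup>2 \<le> Re (tensor_ip t t) * (hnorm ip1 f * hnorm ip2 g)\<^sup>2"
  proof (rule semi_cauchy_schwarz)
    fix c
    have "tensor_ip (t @ [r (cnj c)]) (t @ [r (cnj c)])
        = tensor_ip t t + tensor_ip t [r (cnj c)] + tensor_ip [r (cnj c)] t + tensor_ip [r (cnj c)] [r (cnj c)]"
      by (rule tensor_ip_append)
    moreover have "tensor_ip [r (cnj c)] t = cnj (tensor_ip t [r (cnj c)])"
      by (rule tensor_ip_cnj[OF t rH])
    moreover have "tensor_ip [r (cnj c)] [r (cnj c)]
      = of_real ((cmod c)\<^sup>2 * (hnorm ip1 f * hnorm ip2 g)\<^sup>2)"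
      using f g by (simp add: tensor_ip_def r_def one.ip_self two.ip_self one.scale_mem one.hnorm_scale power_mult_distrib)
    ultimately have "Re (tensor_ip (t @ [r (cnj c)]) (t @ [r (cnj c)]))
      = Re (tensor_ip t t) + 2 * Re (c * ?b) + (cmod c)\<^sup>2 * (hnorm ip1 f * hnorm ip2 g)\<^sup>2"
      by (simp add: cross)
    moreover have "set (t @ [r (cnj c)]) \<subseteq> H1 \<times> H2" using t rH[of "cnj c"] by auto
    ultimately show "0 \<le> Re (tensor_ip t t) + 2 * Re (c * ?b) + (cmod c)\<^sup>2 * (hnorm ip1 f * hnorm ip2 g)\<^sup>2"
      using tensor_ip_nonneg by metis
  qed simp
  then have "(cmod ?b)\<^sup>2 \<le> (hnorm ip1 f * hnorm ip2 g * sqrt (Re (tensor_ip t t)))\<^sup>2"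
    using tensor_ip_nonneg[OF t] by (simp add: power_mult_distrib mult.commute)
  then show ?thesis
    by (rule power2_le_imp_le) (intro mult_nonneg_nonneg one.hnorm_nonneg two.hnorm_nonneg f g
        real_sqrt_ge_zero tensor_ip_nonneg t)
qed

end

section \<open>Holomorphic functions of several variables\<close>

definition complex_deriv_at ::
  "(complex ^ 'm \<Rightarrow> complex) \<Rightarrow> complex ^ 'm \<Rightarrow> (complex ^ 'm \<Rightarrow> complex) \<Rightarrow> bool" where
  "complex_deriv_at f z L \<longleftrightarrow> (f has_derivative L) (at z) \<and> (\<forall>c v. L (c *s v) = c * L v)"

lemma holomorphic_several_iff:
  "holomorphic_several f \<Omega> \<longleftrightarrow> (\<forall>z\<in>\<Omega>. \<exists>L. complex_deriv_at f z L)"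
  by (simp add: holomorphic_several_def complex_deriv_at_def)

lemma norm_smult: "norm (c *s v) = cmod c * norm (v :: complex ^ 'm)"
  by (simp add: norm_vec_def L2_set_right_distrib norm_mult)

lemma scaleR_eq_smult: "r *\<^sub>R v = complex_of_real r *s (v :: complex ^ 'm)"
  unfolding vec_eq_iff vector_scaleR_component vector_smult_component
  by (simp add: scaleR_conv_of_real)

lemma norm_axis_complex: "norm (axis l c) = cmod c"
proof -
  have "(norm (axis l c $ i))\<^sup>2 = (if i = l then (cmod c)\<^sup>2 else 0)" for i
    by (simp add: axis_def)
  then show ?thesis by (simp add: norm_vec_def L2_set_def)
qed

lemma bounded_linear_smult: "bounded_linear (\<lambda>t. t *s (v :: complex ^ 'm))"
  by (rule bounded_linear_intro[where K = "norm v"])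
    (auto simp: vec_eq_iff algebra_simps norm_smult)

lemma complex_deriv_at_bounded_linear: "complex_deriv_at f z L \<Longrightarrow> bounded_linear L"
  by (auto simp: complex_deriv_at_def intro: has_derivative_bounded_linear)

lemma complex_deriv_at_line:
  assumes "complex_deriv_at f (z + t *s v) L"
  shows "((\<lambda>t. f (z + t *s v)) has_field_derivative L v) (at t)"
proof -
  have "((\<lambda>t. z + t *s v) has_derivative (\<lambda>t. t *s v)) (at t)"
    using bounded_linear_imp_has_derivative[OF bounded_linear_smult[of v]]
    by (auto intro!: derivative_eq_intros)
  from has_derivative_compose[OF this, of f L] assms
  have "((\<lambda>t. f (z + t *s v)) has_derivative (\<lambda>t. L (t *s v))) (at t)"
    by (simp add: complex_deriv_at_def)
  moreover have "(\<lambda>t. L (t *s v)) = (*) (L v)"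
    using assms by (auto simp: complex_deriv_at_def fun_eq_iff)
  ultimately show ?thesis by (simp add: has_field_derivative_def)
qed

lemma complex_deriv_at_const: "complex_deriv_at (\<lambda>z. c) z (\<lambda>v. 0)"
  by (simp add: complex_deriv_at_def)

lemma complex_deriv_at_add:
  "complex_deriv_at f z L \<Longrightarrow> complex_deriv_at g z L' \<Longrightarrow>
    complex_deriv_at (\<lambda>z. f z + g z) z (\<lambda>v. L v + L' v)"
  by (auto simp: complex_deriv_at_def algebra_simps intro: has_derivative_add)

lemma complex_deriv_at_diff:
  "complex_deriv_at f z L \<Longrightarrow> complex_deriv_at g z L' \<Longrightarrow>
    complex_deriv_at (\<lambda>z. f z - g z) z (\<lambda>v. L v - L' v)"
  by (auto simp: complex_deriv_at_def algebra_simps intro: has_derivative_diff)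

lemma complex_deriv_at_mult:
  "complex_deriv_at f z L \<Longrightarrow> complex_deriv_at g z L' \<Longrightarrow>
    complex_deriv_at (\<lambda>z. f z * g z) z (\<lambda>v. f z * L' v + L v * g z)"
  unfolding complex_deriv_at_def by (intro conjI has_derivative_mult) (auto simp: algebra_simps)

lemma complex_deriv_at_coord: "complex_deriv_at (\<lambda>z. z $ b) z (\<lambda>v. v $ b)"
  using bounded_linear_imp_has_derivative[OF bounded_linear_vec_nth[of b]]
  by (auto simp: complex_deriv_at_def)

lemma complex_deriv_at_shift:
  "complex_deriv_at f (z + c) L \<Longrightarrow> complex_deriv_at (\<lambda>z. f (z + c)) z L"
proof -
  assume f: "complex_deriv_at f (z + c) L"
  have "((\<lambda>z. z + c) has_derivative (\<lambda>v. v)) (at z)" by (auto intro!: derivative_eq_intros)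
  from has_derivative_compose[OF this, of f L] f show ?thesis by (simp add: complex_deriv_at_def)
qed

lemma complex_deriv_at_cong:
  assumes "open \<Omega>" "z \<in> \<Omega>" "\<And>x. x \<in> \<Omega> \<Longrightarrow> f x = g x" "complex_deriv_at f z L"
  shows "complex_deriv_at g z L"
  using assms has_derivative_transform_within_open[of f L z UNIV \<Omega> g]
  by (auto simp: complex_deriv_at_def)

lemma holomorphic_several_cong:
  assumes "open \<Omega>" "\<And>x. x \<in> \<Omega> \<Longrightarrow> f x = g x" "holomorphic_several f \<Omega>"
  shows "holomorphic_several g \<Omega>"
  using assms complex_deriv_at_cong unfolding holomorphic_several_iff by metis

lemma holomorphic_several_const: "holomorphic_several (\<lambda>z. c) \<Omega>"
  unfolding holomorphic_several_iff using complex_deriv_at_const by blast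

lemma holomorphic_several_add:
  "holomorphic_several f \<Omega> \<Longrightarrow> holomorphic_several g \<Omega> \<Longrightarrow> holomorphic_several (\<lambda>z. f z + g z) \<Omega>"
  unfolding holomorphic_several_iff using complex_deriv_at_add by metis

lemma holomorphic_several_diff:
  "holomorphic_several f \<Omega> \<Longrightarrow> holomorphic_several g \<Omega> \<Longrightarrow> holomorphic_several (\<lambda>z. f z - g z) \<Omega>"
  unfolding holomorphic_several_iff using complex_deriv_at_diff by metis

lemma holomorphic_several_mult:
  "holomorphic_several f \<Omega> \<Longrightarrow> holomorphic_several g \<Omega> \<Longrightarrow> holomorphic_several (\<lambda>z. f z * g z) \<Omega>"
  unfolding holomorphic_several_iff using complex_deriv_at_mult by metis

lemma holomorphic_several_coord: "holomorphic_several (\<lambda>z. z $ b) \<Omega>"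
  unfolding holomorphic_several_iff using complex_deriv_at_coord by blast

lemma holomorphic_several_sum:
  "(\<And>x. x \<in> A \<Longrightarrow> holomorphic_several (f x) \<Omega>) \<Longrightarrow> holomorphic_several (\<lambda>z. \<Sum>x\<in>A. f x z) \<Omega>"
  by (induction A rule: infinite_finite_induct)
    (auto intro: holomorphic_several_const holomorphic_several_add)

lemma holomorphic_several_subset:
  "holomorphic_several f \<Omega> \<Longrightarrow> \<Omega>' \<subseteq> \<Omega> \<Longrightarrow> holomorphic_several f \<Omega>'"
  unfolding holomorphic_several_def by blast

lemma holomorphic_several_continuous:
  "holomorphic_several f \<Omega> \<Longrightarrow> z \<in> \<Omega> \<Longrightarrow> isCont f z"
  unfolding holomorphic_several_def using has_derivative_continuous by blast

lemma holomorphic_several_locally_bounded: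
  assumes "open \<Omega>" "holomorphic_several f \<Omega>" "a \<in> \<Omega>"
  obtains R M where "R > 0" "ball a R \<subseteq> \<Omega>" "\<And>x. x \<in> ball a R \<Longrightarrow> cmod (f x) \<le> M"
proof -
  obtain r where r: "r > 0" "ball a r \<subseteq> \<Omega>" using assms(1,3) open_contains_ball by blast
  obtain s where s: "s > 0" "\<And>x. dist x a < s \<Longrightarrow> dist (f x) (f a) < 1"
    using holomorphic_several_continuous[OF assms(2,3)] unfolding continuous_at_eps_delta
    by (metis zero_less_one)
  show ?thesis
  proof (rule that[of "min r s" "cmod (f a) + 1"])
    show "min r s > 0" "ball a (min r s) \<subseteq> \<Omega>" using r s by auto
    show "cmod (f x) \<le> cmod (f a) + 1" if "x \<in> ball a (min r s)" for x
      using s(2)[of x] that norm_triangle_sub[of "f x" "f a"] by (simp add: dist_norm norm_minus_commute)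
  qed
qed

text \<open>
  Applying one-variable estimates on the complex lines through \<open>z\<close> gives bounds that do not depend on the
  direction, and therefore control the Frechet differential and its remainder uniformly.
\<close>

lemma cauchy_estimates_one_variable:
  assumes hol: "g holomorphic_on ball 0 r" and r: "0 < r"
    and M: "\<And>t. t \<in> ball 0 r \<Longrightarrow> cmod (g t) \<le> M"
  shows "cmod (deriv g 0) \<le> 2 * M / r"
    and "cmod t \<le> r / 2 \<Longrightarrow> cmod (g t - g 0 - deriv g 0 * t) \<le> 32 * M / r\<^sup>2 * (cmod t)\<^sup>2"
proof -
  have C: "cmod ((deriv ^^ n) g x) \<le> fact n * M / s ^ n"
    if "cball x s \<subseteq> ball 0 r" "s > 0" for n x s
  proof (rule Cauchy_inequality)
    show "g holomorphic_on ball x s"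
      using that hol by (meson ball_subset_cball holomorphic_on_subset subset_trans)
    show "continuous_on (cball x s) g"
      using that hol holomorphic_on_imp_continuous_on holomorphic_on_subset by blast
    show "cmod (g y) \<le> M" if "cmod (x - y) = s" for y
      using that \<open>cball x s \<subseteq> ball 0 r\<close> by (intro M) (auto simp: dist_norm subset_iff)
  qed (use that in auto)
  have "cball 0 (r/2) \<subseteq> ball 0 r" using r by auto
  from C[OF this, of 1] r show "cmod (deriv g 0) \<le> 2 * M / r" by (simp add: mult.commute)
  assume t: "cmod t \<le> r / 2"
  have "cmod ((deriv ^^ 0) g t - (\<Sum>i\<le>1. (deriv ^^ i) g 0 * (t - 0) ^ i / fact i))
      \<le> (32 * M / r\<^sup>2) * cmod (t - 0) ^ Suc 1 / fact 1"
  proof (rule complex_Taylor[where S = "cball 0 (r/2)"])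
    fix i and x :: complex assume x: "x \<in> cball 0 (r/2)"
    have "(deriv ^^ i) g holomorphic_on ball 0 r"
      by (intro holomorphic_higher_deriv hol) auto
    then have "((deriv ^^ i) g has_field_derivative deriv ((deriv ^^ i) g) x) (at x)"
      using x r by (intro holomorphic_derivI[of _ "ball 0 r"]) auto
    then show "((deriv ^^ i) g has_field_derivative (deriv ^^ Suc i) g x) (at x within cball 0 (r/2))"
      by (simp add: has_field_derivative_at_within)
  next
    fix x :: complex assume x: "x \<in> cball 0 (r/2)"
    have "cball x (r/4) \<subseteq> ball 0 r"
    proof
      fix y assume "y \<in> cball x (r/4)"
      then have "cmod y \<le> cmod x + r/4"
        using norm_triangle_sub[of y x] by (simp add: dist_norm norm_minus_commute)
      then show "y \<in> ball 0 r" using x r by simp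
    qed
    from C[OF this, of 2] r have "cmod ((deriv ^^ 2) g x) \<le> 2 * M / (r/4)\<^sup>2" by simp
    also have "2 * M / (r/4)\<^sup>2 = 32 * M / r\<^sup>2" by (simp add: power_divide)
    finally show "cmod ((deriv ^^ Suc 1) g x) \<le> 32 * M / r\<^sup>2" by (simp add: numeral_2_eq_2)
  qed (use t r in auto)
  then show "cmod (g t - g 0 - deriv g 0 * t) \<le> 32 * M / r\<^sup>2 * (cmod t)\<^sup>2"
    by (simp add: diff_diff_eq power2_eq_square)
qed

lemma cauchy_estimates:
  assumes hol: "holomorphic_several f (ball a R)" and R: "0 < R"
    and M: "\<And>x. x \<in> ball a R \<Longrightarrow> cmod (f x) \<le> M"
    and z: "z \<in> ball a (R/2)" and L: "complex_deriv_at f z L"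
  shows "cmod (L v) \<le> 4 * M / R * norm v"
    and "norm v \<le> R / 4 \<Longrightarrow> cmod (f (z + v) - f z - L v) \<le> 128 * M / R\<^sup>2 * (norm v)\<^sup>2"
proof -
  have *: "cmod (L v) \<le> 4 * M / R * norm v \<and>
     (norm v \<le> R / 4 \<longrightarrow> cmod (f (z + v) - f z - L v) \<le> 128 * M / R\<^sup>2 * (norm v)\<^sup>2)"
  proof (cases "v = 0")
    case True
    have "L 0 = 0" using complex_deriv_at_bounded_linear[OF L] by (rule linear_simps)
    then show ?thesis using True by simp
  next
    case False
    define u where "u = of_real (inverse (norm v)) *s v"
    define g where "g t = f (z + t *s u)" for t
    have nu: "norm u = 1" using False by (simp add: u_def norm_smult norm_inverse)
    have v: "v = of_real (norm v) *s u"
      using False by (simp add: u_def vector_smult_assoc of_real_mult[symmetric] del: of_real_mult)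
    have inb: "z + t *s u \<in> ball a R" if "t \<in> ball 0 (R/2)" for t
    proof -
      have "dist a (z + t *s u) \<le> dist a z + norm (t *s u)"
        by (metis dist_norm dist_triangle add_diff_cancel_left' norm_minus_commute)
      then show ?thesis using that z by (simp add: norm_smult nu)
    qed
    have "g holomorphic_on ball 0 (R/2)"
      unfolding holomorphic_on_def
    proof
      fix t :: complex assume "t \<in> ball 0 (R/2)"
      then obtain L' where "complex_deriv_at f (z + t *s u) L'"
        using hol inb unfolding holomorphic_several_iff by blast
      then have "(g has_field_derivative L' u) (at t)"
        unfolding g_def by (rule complex_deriv_at_line)
      then show "g field_differentiable at t within ball 0 (R/2)"
        using field_differentiable_at_within field_differentiable_def by blast
    qed
    moreover have "cmod (g t) \<le> M" if "t \<in> ball 0 (R/2)" for t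
      unfolding g_def by (rule M[OF inb[OF that]])
    ultimately have est: "cmod (deriv g 0) \<le> 2 * M / (R/2)"
      "cmod t \<le> (R/2) / 2 \<Longrightarrow> cmod (g t - g 0 - deriv g 0 * t) \<le> 32 * M / (R/2)\<^sup>2 * (cmod t)\<^sup>2" for t
      using cauchy_estimates_one_variable[of g "R/2" M] R by auto
    have "(g has_field_derivative L u) (at 0)"
      unfolding g_def using L by (intro complex_deriv_at_line) simp
    then have d: "deriv g 0 = L u" by (rule DERIV_imp_deriv)
    have Lv: "L v = of_real (norm v) * L u"
      using L v unfolding complex_deriv_at_def by metis
    have "cmod (L v) \<le> 4 * M / R * norm v"
    proof -
      have "cmod (L v) = norm v * cmod (L u)" by (simp add: Lv norm_mult)
      also have "\<dots> \<le> norm v * (2 * M / (R/2))" using est(1) d by (intro mult_left_mono) auto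
      finally show ?thesis by (simp add: mult.commute)
    qed
    moreover have "cmod (f (z + v) - f z - L v) \<le> 128 * M / R\<^sup>2 * (norm v)\<^sup>2" if "norm v \<le> R / 4"
    proof -
      have "cmod (g (of_real (norm v)) - g 0 - deriv g 0 * of_real (norm v))
          \<le> 32 * M / (R/2)\<^sup>2 * (norm v)\<^sup>2"
        using est(2)[of "of_real (norm v)"] that by simp
      moreover have "g (of_real (norm v)) = f (z + v)" "g 0 = f z"
        unfolding g_def v[symmetric] by simp_all
      moreover have "32 * M / (R/2)\<^sup>2 = 128 * M / R\<^sup>2" by (simp add: power_divide)
      ultimately show ?thesis using d by (simp only: Lv mult.commute[of _ "L u"])
    qed
    ultimately show ?thesis by blast
  qed
  then show "cmod (L v) \<le> 4 * M / R * norm v"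
    and "norm v \<le> R / 4 \<Longrightarrow> cmod (f (z + v) - f z - L v) \<le> 128 * M / R\<^sup>2 * (norm v)\<^sup>2"
    by blast+
qed

lemma has_derivative_quadratic_error:
  fixes f :: "'a::real_normed_vector \<Rightarrow> 'b::real_normed_vector"
  assumes L: "bounded_linear L" and d: "d > 0"
    and err: "\<And>v. norm v < d \<Longrightarrow> norm (f (z + v) - f z - L v) \<le> C * (norm v)\<^sup>2"
  shows "(f has_derivative L) (at z)"
  unfolding has_derivative_at_alt
proof (intro conjI L allI impI)
  fix e :: real assume e: "0 < e"
  define d' where "d' = min d (e / (\<bar>C\<bar> + 1))"
  show "\<exists>d>0. \<forall>y. norm (y - z) < d \<longrightarrow> norm (f y - f z - L (y - z)) \<le> e * norm (y - z)"
  proof (intro exI[of _ d'] conjI allI impI)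
    show "0 < d'" using d e by (simp add: d'_def)
    fix y assume y: "norm (y - z) < d'"
    have "norm (f (z + (y - z)) - f z - L (y - z)) \<le> C * (norm (y - z))\<^sup>2"
      using y by (intro err) (simp add: d'_def)
    also have "\<dots> \<le> (\<bar>C\<bar> + 1) * norm (y - z) * norm (y - z)"
      unfolding power2_eq_square mult.assoc by (intro mult_right_mono) auto
    also have "\<dots> \<le> e * norm (y - z)"
    proof (intro mult_right_mono)
      have "norm (y - z) \<le> e / (\<bar>C\<bar> + 1)" using y by (simp add: d'_def)
      then show "(\<bar>C\<bar> + 1) * norm (y - z) \<le> e" by (simp add: field_simps)
    qed simp
    finally show "norm (f y - f z - L (y - z)) \<le> e * norm (y - z)" by simp
  qed
qed

text \<open>
  The theorem of Weierstrass. The Cauchy estimates make the differentials at a point converge and bound all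
  remainders by the same quadratic term, which survives in the limit.
\<close>

lemma holomorphic_several_uniform_limit:
  assumes hol: "\<And>n. holomorphic_several (F n) \<Omega>"
    and lim: "\<And>z. z \<in> \<Omega> \<Longrightarrow> \<exists>r>0. ball z r \<subseteq> \<Omega> \<and> uniform_limit (ball z r) F f sequentially"
  shows "holomorphic_several f \<Omega>"
  unfolding holomorphic_several_iff
proof
  fix z assume z: "z \<in> \<Omega>"
  obtain r where r: "r > 0" "ball z r \<subseteq> \<Omega>" and ul: "uniform_limit (ball z r) F f sequentially"
    using lim[OF z] by blast
  have close: "\<exists>N. \<forall>n\<ge>N. \<forall>x\<in>ball z r. cmod (F n x - f x) < e" if "e > 0" for e
    using ul that by (simp add: uniform_limit_iff eventually_sequentially dist_norm)
  obtain N where N: "\<And>n x. n \<ge> N \<Longrightarrow> x \<in> ball z r \<Longrightarrow> cmod (F n x - f x) < 1"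
    using close[OF zero_less_one] by blast
  have "holomorphic_several (F N) (ball z r)" using hol[of N] r holomorphic_several_subset by blast
  then obtain R M' where R: "R > 0" "ball z R \<subseteq> ball z r"
    and M': "\<And>x. x \<in> ball z R \<Longrightarrow> cmod (F N x) \<le> M'"
    using holomorphic_several_locally_bounded[of "ball z r" "F N" z] r by auto
  define M where "M = M' + 2"
  have FM: "cmod (F n x) \<le> M" if "n \<ge> N" "x \<in> ball z R" for n x
  proof -
    have "x \<in> ball z r" using that R by blast
    then have "cmod (F n x - f x) < 1" "cmod (F N x - f x) < 1" using N that by auto
    moreover have "F n x = (F n x - f x) - (F N x - f x) + F N x" by simp
    ultimately show ?thesis using M'[OF that(2)] unfolding M_def
      by (smt (verit, best) norm_triangle_ineq norm_triangle_ineq4)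
  qed
  have holR: "holomorphic_several (F n) (ball z R)" for n
    using hol[of n] R r holomorphic_several_subset by blast
  have "\<forall>n. \<exists>L. complex_deriv_at (F n) z L" using hol z by (auto simp: holomorphic_several_iff)
  then obtain L where L: "\<And>n. complex_deriv_at (F n) z (L n)" by metis
  have zR: "z \<in> ball z (R/2)" using R by simp
  have "Cauchy (\<lambda>n. L n v)" for v
    unfolding Cauchy_iff
  proof (intro allI impI)
    fix e :: real assume e: "0 < e"
    define e' where "e' = e * R / (8 * (norm v + 1))"
    have e': "e' > 0" unfolding e'_def using e R by (intro divide_pos_pos mult_pos_pos add_nonneg_pos) auto
    obtain N' where N': "\<And>n x. n \<ge> N' \<Longrightarrow> x \<in> ball z r \<Longrightarrow> cmod (F n x - f x) < e' / 2"
      using close[of "e'/2"] e' by (meson half_gt_zero)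
    have "cmod (L m v - L n v) < e" if mn: "m \<ge> N'" "n \<ge> N'" for m n
    proof -
      have "cmod (L m v - L n v) \<le> 4 * e' / R * norm v"
      proof (rule cauchy_estimates(1)[OF holomorphic_several_diff[OF holR holR] R(1) _ zR])
        show "complex_deriv_at (\<lambda>x. F m x - F n x) z (\<lambda>v. L m v - L n v)"
          by (intro complex_deriv_at_diff L)
        fix x assume "x \<in> ball z R"
        then have "x \<in> ball z r" using R by blast
        then have "cmod (F m x - f x) < e' / 2" "cmod (F n x - f x) < e' / 2" using N' mn by auto
        moreover have "F m x - F n x = (F m x - f x) - (F n x - f x)" by simp
        ultimately show "cmod (F m x - F n x) \<le> e'"
          by (smt (verit, best) norm_triangle_ineq4 field_sum_of_halves)
      qed
      also have "\<dots> = e / 2 * (norm v / (norm v + 1))" 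
      proof -
        have "norm v + 1 > 0" by (simp add: add_nonneg_pos)
        then have "norm v + 1 \<noteq> 0" by linarith
        then show ?thesis using R by (simp add: e'_def divide_simps)
      qed
      also have "\<dots> \<le> e / 2 * 1" 
      proof (rule mult_left_mono)
        have "0 < norm v + 1" by (simp add: add_nonneg_pos)
        then show "norm v / (norm v + 1) \<le> 1" by (simp add: pos_divide_le_eq)
      qed (use e in simp)
      also have "\<dots> < e" using e by simp
      finally show ?thesis .
    qed
    then show "\<exists>N'. \<forall>m\<ge>N'. \<forall>n\<ge>N'. norm (L m v - L n v) < e" by blast
  qed
  then have conv: "(\<lambda>n. L n v) \<longlonglongrightarrow> lim (\<lambda>n. L n v)" for v
    by (intro convergent_LIMSEQ_iff[THEN iffD1] Cauchy_convergent)
  define L' where "L' = (\<lambda>v. lim (\<lambda>n. L n v))"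
  have L': "(\<lambda>n. L n v) \<longlonglongrightarrow> L' v" for v unfolding L'_def by (rule conv)
  have smult: "L' (c *s v) = c * L' v" for c v
  proof (rule LIMSEQ_unique[OF L'])
    show "(\<lambda>n. L n (c *s v)) \<longlonglongrightarrow> c * L' v"
      using tendsto_mult_left[OF L', of c] L by (simp add: complex_deriv_at_def)
  qed
  have "linear L'"
  proof (rule linearI)
    fix u v
    show "L' (u + v) = L' u + L' v"
    proof (rule LIMSEQ_unique[OF L'])
      have "L n (u + v) = L n u + L n v" for n
        using complex_deriv_at_bounded_linear[OF L] by (rule linear_simps)
      then show "(\<lambda>n. L n (u + v)) \<longlonglongrightarrow> L' u + L' v"
        using tendsto_add[OF L' L'] by simp
    qed
    show "L' (c *\<^sub>R v) = c *\<^sub>R L' v" for c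
      unfolding scaleR_eq_smult smult by (simp add: scaleR_conv_of_real)
  qed
  then have bl: "bounded_linear L'" by (simp add: linear_conv_bounded_linear)
  have ptlim: "(\<lambda>n. F n x) \<longlonglongrightarrow> f x" if "x \<in> ball z r" for x
    using tendsto_uniform_limitI[OF ul that] .
  have "(f has_derivative L') (at z)"
  proof (rule has_derivative_quadratic_error[OF bl])
    show "0 < R / 4" using R by simp
    fix v :: "complex ^ 'a" assume v: "norm v < R / 4"
    have "z + v \<in> ball z R" using v R by (simp add: dist_norm)
    then have "z + v \<in> ball z r" "z \<in> ball z r" using R r by auto
    then have "(\<lambda>n. cmod (F n (z + v) - F n z - L n v)) \<longlonglongrightarrow> cmod (f (z + v) - f z - L' v)"
      by (intro tendsto_norm tendsto_diff ptlim L')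
    moreover have "cmod (F n (z + v) - F n z - L n v) \<le> 128 * M / R\<^sup>2 * (norm v)\<^sup>2" if "n \<ge> N" for n
      using v by (intro cauchy_estimates(2)[OF holR R(1) FM[OF that] zR L]) auto
    ultimately show "cmod (f (z + v) - f z - L' v) \<le> 128 * M / R\<^sup>2 * (norm v)\<^sup>2"
      by (intro LIMSEQ_le_const2) auto
  qed
  then show "\<exists>L. complex_deriv_at f z L" using smult by (auto simp: complex_deriv_at_def)
qed

subsection \<open>Wirtinger derivatives\<close>

lemma axis_eq_smult: "axis l c = c *s axis l (1 :: complex)"
  by (auto simp: vec_eq_iff axis_def)

lemma complex_deriv_at_partial_x:
  assumes "complex_deriv_at f z L"
  shows "((\<lambda>t::real. f (z + axis l (of_real t))) has_vector_derivative L (axis l 1)) (at 0)"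
proof -
  have "((\<lambda>t. f (z + t *s axis l 1)) has_field_derivative L (axis l 1)) (at (of_real 0))"
    using assms by (intro complex_deriv_at_line) simp
  then have "((\<lambda>t::real. f (z + of_real t *s axis l 1)) has_vector_derivative L (axis l 1)) (at 0)"
    by (rule has_vector_derivative_real_field)
  then show ?thesis by (simp only: axis_eq_smult[of l "of_real _"])
qed

lemma complex_deriv_at_partial_y:
  assumes "complex_deriv_at f z L"
  shows "((\<lambda>t::real. f (z + axis l (\<i> * of_real t))) has_vector_derivative \<i> * L (axis l 1)) (at 0)"
proof -
  have "((\<lambda>t. f (z + t *s (\<i> *s axis l 1))) has_field_derivative L (\<i> *s axis l 1)) (at (of_real 0))"
    using assms by (intro complex_deriv_at_line) simp
  then have "((\<lambda>t::real. f (z + of_real t *s (\<i> *s axis l 1))) has_vector_derivative L (\<i> *s axis l 1)) (at 0)"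
    by (rule has_vector_derivative_real_field)
  moreover have "of_real t *s (\<i> *s axis l 1) = axis l (\<i> * of_real t)" for t
    by (auto simp: vec_eq_iff axis_def)
  ultimately show ?thesis using assms by (simp add: complex_deriv_at_def)
qed

lemma dz_eq:
  assumes "complex_deriv_at f z L"
  shows "dz l f z = L (axis l 1)"
  unfolding dz_def partial_x_def partial_y_def
    vector_derivative_at[OF complex_deriv_at_partial_x[OF assms]]
    vector_derivative_at[OF complex_deriv_at_partial_y[OF assms]]
  by (simp add: mult.assoc[symmetric])

text \<open>
  Antiholomorphic functions are handled as conjugates of holomorphic ones.
\<close>

lemma dzbar_eq:
  assumes "complex_deriv_at (\<lambda>z. cnj (f z)) z L"
  shows "dzbar l f z = cnj (L (axis l 1))"
proof -
  have x: "((\<lambda>t::real. f (z + axis l (of_real t))) has_vector_derivative cnj (L (axis l 1))) (at 0)"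
    using has_vector_derivative_cnj[OF complex_deriv_at_partial_x[OF assms]] by simp
  have y: "((\<lambda>t::real. f (z + axis l (\<i> * of_real t))) has_vector_derivative cnj (\<i> * L (axis l 1))) (at 0)"
    using has_vector_derivative_cnj[OF complex_deriv_at_partial_y[OF assms]] by simp
  show ?thesis
    unfolding dzbar_def partial_x_def partial_y_def vector_derivative_at[OF x] vector_derivative_at[OF y]
    by (simp add: mult.assoc[symmetric])
qed

text \<open>
  The partial derivatives are total functions with arbitrary values where the derivative fails to exist, so
  that functions agreeing on a domain need to be compared by their germs.
\<close>

lemma partial_cong:
  assumes \<Omega>: "open \<Omega>" and z: "z \<in> \<Omega>" and eq: "\<And>x. x \<in> \<Omega> \<Longrightarrow> f x = g x"
  shows "partial_x l f z = partial_x l g z" "partial_y l f z = partial_y l g z"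
proof -
  have ev: "\<forall>\<^sub>F t::real in nhds 0. z + of_real t *s v \<in> \<Omega>" for v
  proof -
    have "continuous_on UNIV (\<lambda>t::real. z + of_real t *s v)"
      by (intro continuous_intros bounded_linear.continuous_on[OF bounded_linear_smult])
    then have "open ((\<lambda>t::real. z + of_real t *s v) -` \<Omega>)"
      by (intro open_vimage \<Omega>) (auto simp: continuous_on_eq_continuous_at)
    then show ?thesis using z by (intro eventually_nhds_in_open[of "_ -` \<Omega>", simplified]) auto
  qed
  have "\<forall>\<^sub>F t::real in nhds 0. t \<in> UNIV \<longrightarrow> f (z + axis l (of_real t)) = g (z + axis l (of_real t))"
    using ev[of "axis l 1"] by eventually_elim (simp add: eq axis_eq_smult[of l "of_real _"])
  then show "partial_x l f z = partial_x l g z"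
    unfolding partial_x_def by (intro vector_derivative_cong_eq) auto
  have "\<forall>\<^sub>F t::real in nhds 0. t \<in> UNIV \<longrightarrow> f (z + axis l (\<i> * of_real t)) = g (z + axis l (\<i> * of_real t))"
    using ev[of "\<i> *s axis l 1"]
    by eventually_elim (simp add: eq axis_eq_smult[of l "\<i> * of_real _"] mult.commute)
  then show "partial_y l f z = partial_y l g z"
    unfolding partial_y_def by (intro vector_derivative_cong_eq) auto
qed

lemma dz_cong:
  assumes "open \<Omega>" "z \<in> \<Omega>" "\<And>x. x \<in> \<Omega> \<Longrightarrow> f x = g x"
  shows "dz l f z = dz l g z"
  unfolding dz_def by (simp only: partial_cong[OF assms])

lemma dzbar_cong:
  assumes "open \<Omega>" "z \<in> \<Omega>" "\<And>x. x \<in> \<Omega> \<Longrightarrow> f x = g x"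
  shows "dzbar l f z = dzbar l g z"
  unfolding dzbar_def by (simp only: partial_cong[OF assms])

text \<open>The difference quotients converge locally uniformly, by the second Cauchy estimate.\<close>

lemma holomorphic_several_dz:
  assumes "open \<Omega>" and hol: "holomorphic_several f \<Omega>"
  shows "holomorphic_several (dz l f) \<Omega>"
  unfolding holomorphic_several_iff
proof
  fix a assume a: "a \<in> \<Omega>"
  obtain R M where R: "R > 0" "ball a R \<subseteq> \<Omega>" and M: "\<And>x. x \<in> ball a R \<Longrightarrow> cmod (f x) \<le> M"
    using holomorphic_several_locally_bounded[OF assms(1) hol a] by blast
  define h where "h n = R / (4 * (real n + 1))" for n :: nat
  have h: "h n > 0" "h n \<le> R / 4" for n
    using R by (auto simp: h_def field_simps)
  define F where "F n z = (f (z + axis l (of_real (h n))) - f z) * inverse (of_real (h n))" for n z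
  have holR: "holomorphic_several f (ball a R)" using hol R holomorphic_several_subset by blast
  have "holomorphic_several (dz l f) (ball a (R/2))"
  proof (rule holomorphic_several_uniform_limit[of F])
    fix n
    show "holomorphic_several (F n) (ball a (R/2))"
      unfolding F_def
    proof (intro holomorphic_several_mult holomorphic_several_diff holomorphic_several_const)
      show "holomorphic_several f (ball a (R/2))"
        using R by (intro holomorphic_several_subset[OF holR] subset_ball) simp
      show "holomorphic_several (\<lambda>z. f (z + axis l (of_real (h n)))) (ball a (R/2))"
        unfolding holomorphic_several_iff
      proof
        fix z assume z: "z \<in> ball a (R/2)"
        have "norm (axis l (of_real (h n)) :: complex ^ 'a) = h n"
          using h(1)[of n] by (simp add: norm_axis_complex)
        moreover have "dist a (z + axis l (of_real (h n))) \<le> dist a z + norm (axis l (of_real (h n)) :: complex ^ 'a)"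
          by (metis dist_norm dist_triangle add_diff_cancel_left' norm_minus_commute)
        ultimately have "z + axis l (of_real (h n)) \<in> ball a R"
          using z h(2)[of n] R by simp
        then show "\<exists>L. complex_deriv_at (\<lambda>z. f (z + axis l (of_real (h n)))) z L"
          using holR complex_deriv_at_shift unfolding holomorphic_several_iff by blast
      qed
    qed
  next
    fix z assume z: "z \<in> ball a (R/2)"
    have est: "cmod (F n x - dz l f x) \<le> 128 * M / R\<^sup>2 * h n" if "x \<in> ball a (R/2)" for n x
    proof -
      define v :: "complex ^ 'a" where "v = axis l (of_real (h n))"
      have "x \<in> ball a R" using that R by auto
      then obtain L where L: "complex_deriv_at f x L"
        using holR unfolding holomorphic_several_iff by blast
      have nv: "norm v = h n" using h(1)[of n] by (simp add: v_def norm_axis_complex)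
      have Lv: "L v = of_real (h n) * dz l f x"
        using L unfolding v_def dz_eq[OF L] axis_eq_smult[of l "of_real (h n)"]
        by (simp add: complex_deriv_at_def)
      have "cmod (f (x + v) - f x - L v) \<le> 128 * M / R\<^sup>2 * (norm v)\<^sup>2"
        using h by (intro cauchy_estimates(2)[OF holR R(1) M that L]) (simp_all add: nv)
      moreover have "f (x + v) - f x - L v = of_real (h n) * (F n x - dz l f x)"
        using h(1)[of n] by (simp add: F_def v_def[symmetric] Lv field_simps)
      ultimately have "h n * cmod (F n x - dz l f x) \<le> h n * (128 * M / R\<^sup>2 * h n)"
        using h(1)[of n] by (simp add: norm_mult nv power2_eq_square mult.commute mult.left_commute)
      then show ?thesis by (rule mult_left_le_imp_le) (rule h(1))
    qed
    have h0: "(\<lambda>n. 128 * M / R\<^sup>2 * h n) \<longlonglongrightarrow> 0"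
    proof -
      have "(\<lambda>n. 128 * M / R\<^sup>2 * (R / 4 * inverse (real (Suc n)))) \<longlonglongrightarrow> 128 * M / R\<^sup>2 * (R / 4 * 0)"
        by (intro tendsto_mult tendsto_const LIMSEQ_inverse_real_of_nat)
      then show ?thesis by (simp add: h_def field_simps)
    qed
    have "uniform_limit (ball a (R/2)) F (dz l f) sequentially"
      unfolding uniform_limit_iff
    proof (intro allI impI)
      fix e :: real assume "e > 0"
      then have "\<forall>\<^sub>F n in sequentially. 128 * M / R\<^sup>2 * h n < e"
        using order_tendstoD(2)[OF h0] by blast
      then show "\<forall>\<^sub>F n in sequentially. \<forall>x\<in>ball a (R/2). dist (F n x) (dz l f x) < e"
      proof eventually_elim
        case (elim n)
        show ?case
        proof
          fix x assume "x \<in> ball a (R/2)"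
          from est[OF this, of n] elim show "dist (F n x) (dz l f x) < e"
            by (simp only: dist_norm)
        qed
      qed
    qed
    moreover obtain q where "q > 0" "ball z q \<subseteq> ball a (R/2)"
      using z open_contains_ball[of "ball a (R/2)"] open_ball by meson
    ultimately show "\<exists>r>0. ball z r \<subseteq> ball a (R/2) \<and> uniform_limit (ball z r) F (dz l f) sequentially"
      using uniform_limit_on_subset by blast
  qed
  then show "\<exists>L. complex_deriv_at (dz l f) a L"
    using R unfolding holomorphic_several_iff by simp
qed

lemma dz_add:
  assumes "holomorphic_several f \<Omega>" "holomorphic_several g \<Omega>" "z \<in> \<Omega>"
  shows "dz l (\<lambda>z. f z + g z) z = dz l f z + dz l g z"
proof -
  obtain L L' where L: "complex_deriv_at f z L" "complex_deriv_at g z L'"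
    using assms unfolding holomorphic_several_iff by blast
  show ?thesis using dz_eq[OF complex_deriv_at_add[OF L]] by (simp add: dz_eq[OF L(1)] dz_eq[OF L(2)])
qed

lemma dz_mult:
  assumes "holomorphic_several f \<Omega>" "holomorphic_several g \<Omega>" "z \<in> \<Omega>"
  shows "dz l (\<lambda>z. f z * g z) z = f z * dz l g z + dz l f z * g z"
proof -
  obtain L L' where L: "complex_deriv_at f z L" "complex_deriv_at g z L'"
    using assms unfolding holomorphic_several_iff by blast
  show ?thesis using dz_eq[OF complex_deriv_at_mult[OF L]] by (simp add: dz_eq[OF L(1)] dz_eq[OF L(2)])
qed

lemma dz_const: "dz l (\<lambda>z. c) z = 0"
  using dz_eq[OF complex_deriv_at_const] .

lemma holomorphic_several_foldr_dz:
  "open \<Omega> \<Longrightarrow> holomorphic_several f \<Omega> \<Longrightarrow> holomorphic_several (foldr dz ls f) \<Omega>"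
  by (induction ls) (auto intro: holomorphic_several_dz)

lemma foldr_dz_cong:
  assumes "open \<Omega>" "\<And>x. x \<in> \<Omega> \<Longrightarrow> f x = g x" "z \<in> \<Omega>"
  shows "foldr dz ls f z = foldr dz ls g z"
  using assms(3)
proof (induction ls arbitrary: z)
  case (Cons l ls)
  then show ?case using dz_cong[OF assms(1) Cons.prems, of "foldr dz ls f" "foldr dz ls g"] by simp
qed (simp add: assms(2))

lemma foldr_dz_add:
  assumes "open \<Omega>" "holomorphic_several f \<Omega>" "holomorphic_several g \<Omega>" "z \<in> \<Omega>"
  shows "foldr dz ls (\<lambda>z. f z + g z) z = foldr dz ls f z + foldr dz ls g z"
  using assms(4)
proof (induction ls arbitrary: z)
  case (Cons l ls)
  have "dz l (foldr dz ls (\<lambda>z. f z + g z)) z = dz l (\<lambda>z. foldr dz ls f z + foldr dz ls g z) z"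
    by (rule dz_cong[OF assms(1) Cons.prems Cons.IH])
  also have "\<dots> = dz l (foldr dz ls f) z + dz l (foldr dz ls g) z"
    by (intro dz_add[of _ \<Omega>] holomorphic_several_foldr_dz assms Cons.prems)
  finally show ?case by simp
qed simp

lemma foldr_dz_cmult:
  assumes "open \<Omega>" "holomorphic_several f \<Omega>" "z \<in> \<Omega>"
  shows "foldr dz ls (\<lambda>z. c * f z) z = c * foldr dz ls f z"
  using assms(3)
proof (induction ls arbitrary: z)
  case (Cons l ls)
  have "dz l (foldr dz ls (\<lambda>z. c * f z)) z = dz l (\<lambda>z. c * foldr dz ls f z) z"
    by (rule dz_cong[OF assms(1) Cons.prems Cons.IH])
  also have "\<dots> = c * dz l (foldr dz ls f) z"
    using dz_mult[OF holomorphic_several_const[of c] holomorphic_several_foldr_dz[OF assms(1,2)] Cons.prems,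
        of l ls] by (simp add: dz_const)
  finally show ?case by simp
qed simp

lemma foldr_dzbar:
  assumes "open \<Omega>" "holomorphic_several (\<lambda>z. cnj (f z)) \<Omega>" "z \<in> \<Omega>"
  shows "foldr dzbar ls f z = cnj (foldr dz ls (\<lambda>z. cnj (f z)) z)"
  using assms(3)
proof (induction ls arbitrary: z)
  case (Cons l ls)
  let ?g = "foldr dz ls (\<lambda>z. cnj (f z))"
  obtain L where "complex_deriv_at ?g z L"
    using holomorphic_several_foldr_dz[OF assms(1,2)] Cons.prems unfolding holomorphic_several_iff by blast
  then have L: "complex_deriv_at (\<lambda>z. cnj (cnj (?g z))) z L" and d: "dz l ?g z = L (axis l 1)"
    by (simp_all add: dz_eq)
  have "dzbar l (foldr dzbar ls f) z = dzbar l (\<lambda>z. cnj (?g z)) z"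
    by (rule dzbar_cong[OF assms(1) Cons.prems Cons.IH])
  also have "\<dots> = cnj (dz l ?g z)" using dzbar_eq[OF L] d by simp
  finally show ?case by simp
qed simp

lemma antiholomorphic_several_iff:
  "antiholomorphic_several f \<Omega> \<longleftrightarrow> holomorphic_several (\<lambda>z. cnj (f z)) \<Omega>"
proof -
  have d: "((\<lambda>z. cnj (g z)) has_derivative (\<lambda>v. cnj (L v))) (at z)" if "(g has_derivative L) (at z)" for g L z
    using bounded_linear.has_derivative[OF bounded_linear_cnj that] .
  have "(\<exists>L. (f has_derivative L) (at z) \<and> (\<forall>c v. L (c *s v) = cnj c * L v))
    \<longleftrightarrow> (\<exists>L. ((\<lambda>z. cnj (f z)) has_derivative L) (at z) \<and> (\<forall>c v. L (c *s v) = c * L v))" (is "?a \<longleftrightarrow> ?h") for z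
  proof
    assume ?a
    then obtain L where "(f has_derivative L) (at z)" "\<And>c v. L (c *s v) = cnj c * L v" by blast
    then show ?h using d by (intro exI[of _ "\<lambda>v. cnj (L v)"]) simp
  next
    assume ?h
    then obtain L where L: "((\<lambda>z. cnj (f z)) has_derivative L) (at z)" "\<And>c v. L (c *s v) = c * L v" by blast
    then show ?a using d[OF L(1)] by (intro exI[of _ "\<lambda>v. cnj (L v)"]) simp
  qed
  then show ?thesis unfolding antiholomorphic_several_def holomorphic_several_def by simp
qed

subsection \<open>Multi-indices and shifted monomials\<close>

text \<open>
  Unfolding the powers in \<^const>\<open>multi_deriv\<close> turns it into a fold over a list of coordinates. Iterated
  derivatives can then be treated by induction over lists, and multi-indices correspond to multisets.
\<close>

definition index_list :: "('m::finite \<Rightarrow> nat) \<Rightarrow> 'm list" where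
  "index_list i = concat (map (\<lambda>l. replicate (i l) l) coord_enum)"

lemma multi_deriv_eq_foldr: "multi_deriv D i f = foldr D (index_list i) f"
proof -
  have rep: "foldr D (replicate n l) g = (D l ^^ n) g" for n l g
    by (induction n) auto
  have "foldr (\<lambda>l. D l ^^ i l) ls f = foldr D (concat (map (\<lambda>l. replicate (i l) l) ls)) f" for ls
    by (induction ls) (auto simp: rep)
  then show ?thesis by (simp add: multi_deriv_def index_list_def)
qed

lemma coord_enum: "distinct (coord_enum :: 'm::finite list)" "set (coord_enum :: 'm list) = UNIV"
proof -
  have "\<exists>ls :: 'm list. distinct ls \<and> set ls = UNIV"
    using finite_distinct_list[OF finite] by blast
  from someI_ex[OF this] show "distinct (coord_enum :: 'm list)" "set (coord_enum :: 'm list) = UNIV"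
    by (auto simp: coord_enum_def)
qed

lemma count_index_list: "count (mset (index_list i)) b = i b"
proof -
  have "count (mset (concat (map (\<lambda>l. replicate (i l) l) ls))) b = (if b \<in> set ls then i b else 0)"
    if "distinct ls" for ls
    using that by (induction ls) (auto)
  from this[OF coord_enum(1)] show ?thesis by (simp add: index_list_def coord_enum(2))
qed

lemma length_index_list: "length (index_list i) = (\<Sum>l\<in>UNIV. i l)"
proof -
  have "length (index_list i) = (\<Sum>l\<leftarrow>coord_enum. i l)"
    by (simp add: index_list_def length_concat comp_def)
  also have "\<dots> = (\<Sum>l\<in>UNIV. i l)"
    using coord_enum by (metis sum_list_distinct_conv_sum_set)
  finally show ?thesis .
qed

lemma mset_index_list_eq_iff: "mset (index_list i) = mset (index_list j) \<longleftrightarrow> i = j"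
  by (metis count_index_list ext)

lemma mset_index_list_count: "mset (index_list (count B)) = B"
  by (simp add: multiset_eq_iff count_index_list)

lemma multi_indices_alt: "multi_indices k = {i. length (index_list i) \<le> k}"
  by (simp add: multi_indices_def length_index_list)

lemma finite_multi_indices: "finite (multi_indices k :: ('m::finite \<Rightarrow> nat) set)"
proof (rule finite_subset)
  show "(multi_indices k :: ('m \<Rightarrow> nat) set) \<subseteq> PiE UNIV (\<lambda>_. {..k})"
  proof
    fix i :: "'m \<Rightarrow> nat" assume "i \<in> multi_indices k"
    then have "(\<Sum>l\<in>UNIV. i l) \<le> k" by (simp add: multi_indices_def)
    moreover have "i l \<le> (\<Sum>l\<in>UNIV. i l)" for l by (rule member_le_sum) auto
    ultimately show "i \<in> PiE UNIV (\<lambda>_. {..k})" using order_trans by (fastforce simp: PiE_def)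
  qed
qed (intro finite_PiE, auto)

definition shifted_monomial :: "complex ^ 'm \<Rightarrow> 'm multiset \<Rightarrow> complex ^ 'm \<Rightarrow> complex" where
  "shifted_monomial w B z = (\<Prod>b\<in>#B. z $ b - w $ b)"

lemma shifted_monomial_simps [simp]:
  "shifted_monomial w {#} z = 1"
  "shifted_monomial w (add_mset b B) z = (z $ b - w $ b) * shifted_monomial w B z"
  by (simp_all add: shifted_monomial_def)

lemma shifted_monomial_center: "B \<noteq> {#} \<Longrightarrow> shifted_monomial w B w = 0"
  by (cases B) auto

lemma holomorphic_several_shifted_monomial: "holomorphic_several (shifted_monomial w B) \<Omega>"
proof -
  have "holomorphic_several (\<lambda>z. shifted_monomial w B z) \<Omega>"
    by (induction B) (auto intro!: holomorphic_several_const holomorphic_several_mult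
        holomorphic_several_diff holomorphic_several_coord)
  then show ?thesis by simp
qed

lemma dz_coord_shift: "dz l (\<lambda>z. z $ b - c) z = (if b = l then 1 else 0)"
  using dz_eq[OF complex_deriv_at_diff[OF complex_deriv_at_coord complex_deriv_at_const], of l b c z]
  by (simp add: axis_def)

lemma dz_shifted_monomial:
  "dz l (shifted_monomial w B) z = of_nat (count B l) * shifted_monomial w (B - {#l#}) z"
proof (induction B)
  case empty
  show ?case using dz_const[of l 1 z] by (simp add: shifted_monomial_def[abs_def])
next
  case (add b B)
  have "shifted_monomial w (add_mset b B) = (\<lambda>z. (z $ b - w $ b) * shifted_monomial w B z)"
    by (rule ext) simp
  then have "dz l (shifted_monomial w (add_mset b B)) z = dz l (\<lambda>z. (z $ b - w $ b) * shifted_monomial w B z) z"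
    by (rule arg_cong)
  also have "\<dots> = (z $ b - w $ b) * dz l (shifted_monomial w B) z
      + dz l (\<lambda>z. z $ b - w $ b) z * shifted_monomial w B z"
    by (intro dz_mult[of _ UNIV] holomorphic_several_diff holomorphic_several_coord
        holomorphic_several_const holomorphic_several_shifted_monomial) auto
  finally have *: "dz l (shifted_monomial w (add_mset b B)) z
      = (z $ b - w $ b) * (of_nat (count B l) * shifted_monomial w (B - {#l#}) z)
        + (if b = l then 1 else 0) * shifted_monomial w B z"
    unfolding add.IH dz_coord_shift .
  show ?case
  proof (cases "b = l")
    case True
    have "(z $ l - w $ l) * (of_nat (count B l) * shifted_monomial w (B - {#l#}) z)
        = of_nat (count B l) * shifted_monomial w B z"
    proof (cases "l \<in># B")
      case True
      then obtain B' where "B = add_mset l B'" by (meson multi_member_split)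
      then show ?thesis by simp
    next
      case False
      then show ?thesis by (simp add: not_in_iff)
    qed
    then show ?thesis unfolding * using True by (simp add: algebra_simps)
  next
    case False
    then have "add_mset b B - {#l#} = add_mset b (B - {#l#})" by simp
    then show ?thesis unfolding * using False by simp
  qed
qed

text \<open>
  By Leibniz' rule a term survives at the centre only if every factor of the monomial has been
  differentiated. If the order of the derivative does not exceed the degree, this leaves no derivative for
  \<open>h\<close>. The constant counts the ways to match the derivatives with factors in the same coordinate.
\<close>

lemma foldr_dz_shifted_monomial:
  assumes \<Omega>: "open \<Omega>" "w \<in> \<Omega>" and "length ls \<le> size B"
  shows "\<exists>c::nat. (\<forall>h. holomorphic_several h \<Omega> \<longrightarrow>
        foldr dz ls (\<lambda>z. shifted_monomial w B z * h z) w = of_nat c * h w) \<and>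
      (c \<noteq> 0 \<longleftrightarrow> mset ls = B)"
  using assms(3)
proof (induction ls arbitrary: B rule: rev_induct)
  case Nil
  show ?case
  proof (cases "B = {#}")
    case True
    then show ?thesis by (intro exI[of _ 1]) simp
  next
    case False
    then show ?thesis by (intro exI[of _ 0]) (simp add: shifted_monomial_center)
  qed
next
  case (snoc l ls)
  let ?P = "shifted_monomial w"
  obtain c2 :: nat where c2: "\<And>h. holomorphic_several h \<Omega> \<Longrightarrow> foldr dz ls (\<lambda>z. ?P B z * h z) w = of_nat c2 * h w"
    and c2': "c2 \<noteq> 0 \<longleftrightarrow> mset ls = B"
    using snoc.IH[of B] snoc.prems by auto
  have "size (mset ls) \<noteq> size B" using snoc.prems by simp
  then have c20: "c2 = 0" using c2' by auto
  have deriv: "foldr dz (ls @ [l]) (\<lambda>z. ?P B z * h z) w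
      = of_nat (count B l) * foldr dz ls (\<lambda>z. ?P (B - {#l#}) z * h z) w"
    if h: "holomorphic_several h \<Omega>" for h
  proof -
    have "foldr dz ls (dz l (\<lambda>z. ?P B z * h z)) w
        = foldr dz ls (\<lambda>z. ?P B z * dz l h z + of_nat (count B l) * (?P (B - {#l#}) z * h z)) w"
      using dz_mult[OF holomorphic_several_shifted_monomial h, of _ l w B]
      by (intro foldr_dz_cong[OF \<Omega>(1) _ \<Omega>(2)]) (simp add: dz_shifted_monomial mult.assoc)
    also have "\<dots> = foldr dz ls (\<lambda>z. ?P B z * dz l h z) w
        + foldr dz ls (\<lambda>z. of_nat (count B l) * (?P (B - {#l#}) z * h z)) w"
      by (intro foldr_dz_add[OF \<Omega>(1) _ _ \<Omega>(2)] holomorphic_several_mult holomorphic_several_const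
          holomorphic_several_shifted_monomial holomorphic_several_dz \<Omega> h)
    also have "foldr dz ls (\<lambda>z. ?P B z * dz l h z) w = 0"
      using c2[OF holomorphic_several_dz[OF \<Omega>(1) h]] c20 by simp
    also have "foldr dz ls (\<lambda>z. of_nat (count B l) * (?P (B - {#l#}) z * h z)) w
        = of_nat (count B l) * foldr dz ls (\<lambda>z. ?P (B - {#l#}) z * h z) w"
      by (intro foldr_dz_cmult[OF \<Omega>(1) _ \<Omega>(2)] holomorphic_several_mult
          holomorphic_several_shifted_monomial h)
    finally show ?thesis by simp
  qed
  show ?case
  proof (cases "l \<in># B")
    case True
    then obtain B' where B': "B = add_mset l B'" by (meson multi_member_split)
    then have "length ls \<le> size B'" using snoc.prems by simp
    from snoc.IH[OF this] obtain c :: nat where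
      c: "\<And>h. holomorphic_several h \<Omega> \<Longrightarrow> foldr dz ls (\<lambda>z. ?P B' z * h z) w = of_nat c * h w"
      and c': "c \<noteq> 0 \<longleftrightarrow> mset ls = B'" by blast
    show ?thesis
    proof (intro exI[of _ "count B l * c"] conjI allI impI)
      fix h assume h: "holomorphic_several h \<Omega>"
      show "foldr dz (ls @ [l]) (\<lambda>z. ?P B z * h z) w = of_nat (count B l * c) * h w"
        unfolding deriv[OF h] using c[OF h] by (simp add: B' distrib_right)
    next
      have "count B l * c \<noteq> 0 \<longleftrightarrow> c \<noteq> 0" by (auto simp: B')
      moreover have "mset (ls @ [l]) = B \<longleftrightarrow> mset ls = B'" by (simp add: B')
      ultimately show "count B l * c \<noteq> 0 \<longleftrightarrow> mset (ls @ [l]) = B" using c' by simp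
    qed
  next
    case False
    then have "count B l = 0" by (simp add: not_in_iff)
    moreover have "mset (ls @ [l]) \<noteq> B" using False by auto
    ultimately show ?thesis using deriv by (intro exI[of _ 0]) simp
  qed
qed

section \<open>The Hilbert space of a non-negative kernel\<close>

lemma cvec_inner_add_left: "cvec_inner I (a + b) c = cvec_inner I a c + cvec_inner I b c"
  by (simp add: cvec_inner_def algebra_simps sum.distrib)

lemma cvec_inner_cmult_left: "cvec_inner I (\<lambda>i. c * a i) b = c * cvec_inner I a b"
  by (simp add: cvec_inner_def sum_distrib_left mult.assoc)

lemma cvec_inner_cmult_right: "cvec_inner I a (\<lambda>i. c * b i) = cnj c * cvec_inner I a b"
  by (simp add: cvec_inner_def sum_distrib_left algebra_simps)

lemma mat_app_cmult: "mat_app I A (\<lambda>i. c * \<eta> i) = (\<lambda>i. c * mat_app I A \<eta> i)"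
  by (auto simp: mat_app_def sum_distrib_left algebra_simps fun_eq_iff)

lemma cvec_cmult: "\<eta> \<in> cvec I \<Longrightarrow> (\<lambda>i. c * \<eta> i) \<in> cvec I"
  by (simp add: cvec_def)

definition unit_vec :: "'i \<Rightarrow> 'i \<Rightarrow> complex" where
  "unit_vec i = (\<lambda>j. if j = i then 1 else 0)"

lemma unit_vec_cvec: "i \<in> I \<Longrightarrow> unit_vec i \<in> cvec I"
  by (auto simp: unit_vec_def cvec_def)

lemma cvec_inner_unit_vec: "finite I \<Longrightarrow> i \<in> I \<Longrightarrow> cvec_inner I a (unit_vec i) = a i"
  by (simp add: cvec_inner_def unit_vec_def if_distrib cong: if_cong)

locale nonneg_kernel =
  fixes \<Omega> :: "(complex ^ 'm::finite) set" and I :: "'i set" and K :: "('m, 'i) kernel"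
  assumes finite_index: "finite I"
    and hermitian: "z \<in> \<Omega> \<Longrightarrow> w \<in> \<Omega> \<Longrightarrow> i \<in> I \<Longrightarrow> j \<in> I \<Longrightarrow> K w z j i = cnj (K z w i j)"
    and nonneg: "set cs \<subseteq> \<Omega> \<times> cvec I \<Longrightarrow>
      0 \<le> Re (\<Sum>(w, \<eta>)\<leftarrow>cs. \<Sum>(z, \<zeta>)\<leftarrow>cs. cvec_inner I (mat_app I (K z w) \<eta>) \<zeta>)"
begin

text \<open>
  A list of pairs \<open>(w, \<eta>)\<close> stands for the formal combination \<open>\<Sum> K(\<cdot>,w)\<eta>\<close>, realised as a function by
  \<open>comb\<close>; \<open>pairing f\<close> is the functional that the inner product with such combinations has to be, by
  the reproducing property.
\<close>

definition pairing :: "('m, 'i) vfun \<Rightarrow> ((complex ^ 'm) \<times> ('i \<Rightarrow> complex)) list \<Rightarrow> complex" where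
  "pairing f cs = (\<Sum>(w, \<eta>)\<leftarrow>cs. cvec_inner I (f w) \<eta>)"

primrec comb :: "((complex ^ 'm) \<times> ('i \<Rightarrow> complex)) list \<Rightarrow> ('m, 'i) vfun" where
  "comb [] = 0"
| "comb (c # cs) = kernel_section \<Omega> I K (fst c) (snd c) + comb cs"

definition scale_list :: "complex \<Rightarrow> ((complex ^ 'm) \<times> ('i \<Rightarrow> complex)) list \<Rightarrow> _ list" where
  "scale_list c cs = map (\<lambda>(w, \<eta>). (w, \<lambda>i. c * \<eta> i)) cs"

abbreviation valid :: "((complex ^ 'm) \<times> ('i \<Rightarrow> complex)) list \<Rightarrow> bool" where
  "valid cs \<equiv> set cs \<subseteq> \<Omega> \<times> cvec I"

lemma pairing_simps [simp]:
  "pairing f [] = 0"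
  "pairing f (c # cs) = cvec_inner I (f (fst c)) (snd c) + pairing f cs"
  "pairing f (cs @ ds) = pairing f cs + pairing f ds"
  by (auto simp: pairing_def case_prod_beta)

lemma pairing_add: "pairing (f + g) cs = pairing f cs + pairing g cs"
  by (simp add: pairing_def split_def cvec_inner_add_left sum_list_addf)

lemma pairing_fscale: "pairing (fscale c f) cs = c * pairing f cs"
  by (simp add: pairing_def split_def fscale_def cvec_inner_cmult_left sum_list_const_mult)

lemma pairing_diff: "pairing (f - g) cs = pairing f cs - pairing g cs"
  unfolding diff_eq_add_fscale by (simp add: pairing_add pairing_fscale)

lemma pairing_zero: "pairing 0 cs = 0"
  using pairing_fscale[of 0 0 cs] by simp

lemma pairing_scale_list: "pairing f (scale_list c cs) = cnj c * pairing f cs"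
  by (induction cs) (auto simp: scale_list_def cvec_inner_cmult_right algebra_simps)

lemma valid_scale_list: "valid cs \<Longrightarrow> valid (scale_list c cs)"
  by (auto simp: scale_list_def cvec_cmult)

lemma comb_append: "comb (cs @ ds) = comb cs + comb ds"
proof (induction cs)
  case (Cons c cs)
  then show ?case by (simp only: append_Cons comb.simps add.assoc)
qed (simp only: append_Nil comb.simps add_0_left)

lemma comb_scale_list: "comb (scale_list c cs) = fscale c (comb cs)"
proof (induction cs)
  case (Cons p cs)
  have "kernel_section \<Omega> I K w (\<lambda>i. c * \<eta> i) = fscale c (kernel_section \<Omega> I K w \<eta>)" for w \<eta>
    by (simp add: kernel_section_def mat_app_cmult fscale_def fun_eq_iff)
  then show ?case using Cons
    by (simp only: scale_list_def list.map case_prod_beta comb.simps fst_conv snd_conv fscale_add_right)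
qed (simp only: scale_list_def list.map comb.simps fscale_zero_right)

lemma comb_outside: "z \<notin> \<Omega> \<Longrightarrow> comb cs z = 0"
  by (induction cs) (auto simp: kernel_section_def)

lemma comb_cvec: "comb cs z \<in> cvec I"
  by (induction cs) (auto simp: kernel_section_def cvec_def mat_app_def)

lemma pairing_comb:
  assumes "valid ds"
  shows "pairing (comb cs) ds = (\<Sum>(w, \<eta>)\<leftarrow>cs. \<Sum>(z, \<zeta>)\<leftarrow>ds. cvec_inner I (mat_app I (K z w) \<eta>) \<zeta>)"
proof (induction cs)
  case (Cons c cs)
  have "pairing (kernel_section \<Omega> I K w \<eta>) ds = (\<Sum>(z, \<zeta>)\<leftarrow>ds. cvec_inner I (mat_app I (K z w) \<eta>) \<zeta>)" for w \<eta>
    using assms by (induction ds) (auto simp: kernel_section_def)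
  then show ?case using Cons
    by (simp only: pairing_add split_def comb.simps list.map sum_list.Cons)
qed (simp only: comb.simps list.map sum_list.Nil pairing_zero)

lemma pairing_comb_cnj:
  assumes "valid cs" "valid ds"
  shows "pairing (comb ds) cs = cnj (pairing (comb cs) ds)"
proof -
  have one: "cvec_inner I (mat_app I (K w z) \<zeta>) \<eta> = cnj (cvec_inner I (mat_app I (K z w) \<eta>) \<zeta>)"
    if "z \<in> \<Omega>" "w \<in> \<Omega>" for z w \<eta> \<zeta>
  proof -
    have "cvec_inner I (mat_app I (K w z) \<zeta>) \<eta> = (\<Sum>i\<in>I. \<Sum>j\<in>I. K w z i j * \<zeta> j * cnj (\<eta> i))"
      by (simp add: cvec_inner_def mat_app_def sum_distrib_right)
    also have "\<dots> = (\<Sum>j\<in>I. \<Sum>i\<in>I. K w z i j * \<zeta> j * cnj (\<eta> i))" by (rule sum.swap)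
    also have "\<dots> = cnj (\<Sum>j\<in>I. \<Sum>i\<in>I. K z w j i * \<eta> i * cnj (\<zeta> j))"
      unfolding cnj_sum using that by (intro sum.cong refl) (simp add: hermitian[of z w] mult.assoc mult.commute)
    also have "(\<Sum>j\<in>I. \<Sum>i\<in>I. K z w j i * \<eta> i * cnj (\<zeta> j)) = cvec_inner I (mat_app I (K z w) \<eta>) \<zeta>"
      by (simp add: cvec_inner_def mat_app_def sum_distrib_right)
    finally show ?thesis .
  qed
  show ?thesis
    using assms
  proof (induction ds)
    case (Cons d ds)
    have "pairing (kernel_section \<Omega> I K (fst d) (snd d)) cs
        = cnj (cvec_inner I (comb cs (fst d)) (snd d))"
      using Cons.prems(1)
    proof (induction cs)
      case (Cons c cs)
      have "fst d \<in> \<Omega>" using \<open>valid (d # ds)\<close> by auto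
      moreover have "cvec_inner I (comb (c # cs) v) \<eta>
          = cvec_inner I (kernel_section \<Omega> I K (fst c) (snd c) v) \<eta> + cvec_inner I (comb cs v) \<eta>" for v \<eta>
        by (simp add: cvec_inner_add_left)
      moreover have "fst c \<in> \<Omega>" "valid cs" using Cons.prems by auto
      ultimately show ?case
        using Cons.IH one[of "fst d" "fst c" "snd d" "snd c"]
        by (simp only: pairing_simps complex_cnj_add) (simp add: kernel_section_def)
    qed (simp add: cvec_inner_def)
    moreover have "pairing (comb ds) cs = cnj (pairing (comb cs) ds)" using Cons by simp
    ultimately show ?case by (simp only: comb.simps pairing_add pairing_simps complex_cnj_add)
  qed (simp only: comb.simps pairing_zero pairing_simps complex_cnj_zero)
qed

definition comb_norm :: "((complex ^ 'm) \<times> ('i \<Rightarrow> complex)) list \<Rightarrow> real" where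
  "comb_norm cs = sqrt (Re (pairing (comb cs) cs))"

lemma pairing_comb_nonneg: "valid cs \<Longrightarrow> 0 \<le> Re (pairing (comb cs) cs)"
  using nonneg pairing_comb by simp

lemma comb_norm_nonneg: "valid cs \<Longrightarrow> 0 \<le> comb_norm cs"
  by (simp add: comb_norm_def pairing_comb_nonneg)

lemma pairing_comb_self: "valid cs \<Longrightarrow> pairing (comb cs) cs = of_real ((comb_norm cs)\<^sup>2)"
  using pairing_comb_cnj[of cs cs] pairing_comb_nonneg[of cs]
  by (simp add: comb_norm_def complex_eq_iff)

lemma comb_norm_sq_add:
  assumes "valid cs" "valid ds"
  shows "(comb_norm (cs @ scale_list c ds))\<^sup>2
    = (comb_norm cs)\<^sup>2 + 2 * Re (cnj c * pairing (comb cs) ds) + (cmod c)\<^sup>2 * (comb_norm ds)\<^sup>2"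
proof -
  have v: "valid (cs @ scale_list c ds)" using assms valid_scale_list[OF assms(2)] by simp
  have "complex_of_real ((comb_norm (cs @ scale_list c ds))\<^sup>2)
      = pairing (comb cs) cs + (cnj c * pairing (comb cs) ds + cnj (cnj c * pairing (comb cs) ds))
        + c * cnj c * pairing (comb ds) ds"
    unfolding pairing_comb_self[OF v, symmetric] comb_append comb_scale_list
    using pairing_comb_cnj[OF assms]
    by (simp add: pairing_add pairing_fscale pairing_scale_list algebra_simps)
  also have "\<dots> = of_real ((comb_norm cs)\<^sup>2 + 2 * Re (cnj c * pairing (comb cs) ds)
      + (cmod c)\<^sup>2 * (comb_norm ds)\<^sup>2)"
    using assms by (simp add: pairing_comb_self complex_add_cnj complex_norm_square[symmetric] del: complex_cnj_mult)
  finally show ?thesis by (simp only: of_real_eq_iff)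
qed

lemma pairing_comb_le:
  assumes "valid cs" "valid ds"
  shows "cmod (pairing (comb cs) ds) \<le> comb_norm cs * comb_norm ds"
proof -
  have "(cmod (pairing (comb cs) ds))\<^sup>2 \<le> (comb_norm cs)\<^sup>2 * (comb_norm ds)\<^sup>2"
  proof (rule semi_cauchy_schwarz)
    fix c
    show "0 \<le> (comb_norm cs)\<^sup>2 + 2 * Re (c * pairing (comb cs) ds) + (cmod c)\<^sup>2 * (comb_norm ds)\<^sup>2"
      using comb_norm_sq_add[OF assms, of "cnj c"] zero_le_power2[of "comb_norm (cs @ scale_list (cnj c) ds)"]
      by simp
  qed simp
  then have "(cmod (pairing (comb cs) ds))\<^sup>2 \<le> (comb_norm cs * comb_norm ds)\<^sup>2"
    by (simp add: power_mult_distrib)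
  then show ?thesis
    by (rule power2_le_imp_le) (intro mult_nonneg_nonneg comb_norm_nonneg assms)
qed

text \<open>
  The space consists of the functions whose functional is bounded; it is the anti-dual of the
  space of formal combinations.
\<close>

definition bound :: "('m, 'i) vfun \<Rightarrow> real \<Rightarrow> bool" where
  "bound f C \<longleftrightarrow> 0 \<le> C \<and> (\<forall>cs. valid cs \<longrightarrow> cmod (pairing f cs) \<le> C * comb_norm cs)"

definition space :: "('m, 'i) vfun set" where
  "space = {f. (\<forall>z. z \<notin> \<Omega> \<longrightarrow> f z = 0) \<and> (\<forall>z. f z \<in> cvec I) \<and> (\<exists>C. bound f C)}"

definition dual_norm :: "('m, 'i) vfun \<Rightarrow> real" where
  "dual_norm f = Inf {C. bound f C}"

lemma dual_norm_le: "bound f C \<Longrightarrow> dual_norm f \<le> C"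
  unfolding dual_norm_def by (rule cInf_lower) (auto simp: bound_def intro!: bdd_belowI[of _ 0])

lemma bound_dual_norm:
  assumes "f \<in> space"
  shows "bound f (dual_norm f)"
proof -
  obtain C0 where C0: "bound f C0" using assms by (auto simp: space_def)
  show ?thesis
    unfolding bound_def
  proof (intro conjI allI impI)
    show "0 \<le> dual_norm f"
      unfolding dual_norm_def using C0 by (intro cInf_greatest) (auto simp: bound_def)
    fix cs assume v: "valid cs"
    show "cmod (pairing f cs) \<le> dual_norm f * comb_norm cs"
    proof (cases "comb_norm cs = 0")
      case True
      then show ?thesis using C0 v by (auto simp: bound_def)
    next
      case False
      then have pos: "comb_norm cs > 0" using comb_norm_nonneg[OF v] by simp
      have "cmod (pairing f cs) / comb_norm cs \<le> dual_norm f"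
        unfolding dual_norm_def
      proof (rule cInf_greatest)
        show "{C. bound f C} \<noteq> {}" using C0 by auto
        fix C assume "C \<in> {C. bound f C}"
        then show "cmod (pairing f cs) / comb_norm cs \<le> C"
          using v pos by (simp add: bound_def divide_le_eq)
      qed
      then show ?thesis using pos by (simp add: divide_le_eq)
    qed
  qed
qed

lemma dual_norm_nonneg: "f \<in> space \<Longrightarrow> 0 \<le> dual_norm f"
  using bound_dual_norm by (simp add: bound_def)

lemma pairing_le: "f \<in> space \<Longrightarrow> valid cs \<Longrightarrow> cmod (pairing f cs) \<le> dual_norm f * comb_norm cs"
  using bound_dual_norm by (simp add: bound_def)

lemma bound_add:
  assumes "bound f C" "bound g D"
  shows "bound (f + g) (C + D)"
  unfolding bound_def
proof (intro conjI allI impI)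
  show "0 \<le> C + D" using assms by (simp add: bound_def)
  fix cs assume v: "valid cs"
  have "cmod (pairing (f + g) cs) \<le> cmod (pairing f cs) + cmod (pairing g cs)"
    unfolding pairing_add by (rule norm_triangle_ineq)
  also have "\<dots> \<le> C * comb_norm cs + D * comb_norm cs"
    using assms v by (intro add_mono) (auto simp: bound_def)
  finally show "cmod (pairing (f + g) cs) \<le> (C + D) * comb_norm cs" by (simp add: distrib_right)
qed

lemma bound_fscale:
  assumes "bound f C"
  shows "bound (fscale c f) (cmod c * C)"
  unfolding bound_def
proof (intro conjI allI impI)
  show "0 \<le> cmod c * C" using assms by (simp add: bound_def)
  fix cs assume v: "valid cs"
  have "cmod c * cmod (pairing f cs) \<le> cmod c * (C * comb_norm cs)"
    using assms v by (intro mult_left_mono) (auto simp: bound_def)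
  then show "cmod (pairing (fscale c f) cs) \<le> cmod c * C * comb_norm cs"
    by (simp add: pairing_fscale norm_mult mult.assoc)
qed

lemma space_add: "f \<in> space \<Longrightarrow> g \<in> space \<Longrightarrow> f + g \<in> space"
  using bound_add[of f _ g] by (auto simp: space_def cvec_def)

lemma space_fscale: "f \<in> space \<Longrightarrow> fscale c f \<in> space"
  using bound_fscale[of f _ c] by (auto simp: space_def cvec_def fscale_def fun_eq_iff)

lemma space_diff: "f \<in> space \<Longrightarrow> g \<in> space \<Longrightarrow> f - g \<in> space"
  unfolding diff_eq_add_fscale by (intro space_add space_fscale)

lemma space_zero: "0 \<in> space"
  by (auto simp: space_def cvec_def bound_def pairing_zero comb_norm_nonneg intro!: exI[of _ 0])

lemma dual_norm_add: "f \<in> space \<Longrightarrow> g \<in> space \<Longrightarrow> dual_norm (f + g) \<le> dual_norm f + dual_norm g"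
  by (intro dual_norm_le bound_add bound_dual_norm)

lemma dual_norm_fscale: "f \<in> space \<Longrightarrow> dual_norm (fscale c f) \<le> cmod c * dual_norm f"
  by (intro dual_norm_le bound_fscale bound_dual_norm)

lemma dual_norm_diff: "f \<in> space \<Longrightarrow> g \<in> space \<Longrightarrow> dual_norm (f - g) \<le> dual_norm f + dual_norm g"
  unfolding diff_eq_add_fscale
  using dual_norm_add[of f "fscale (-1) g"] dual_norm_fscale[of g "-1"] space_fscale[of g "-1"] by simp

lemma dual_norm_zero: "dual_norm 0 = 0"
proof (rule antisym)
  show "dual_norm 0 \<le> 0"
    by (rule dual_norm_le) (simp add: bound_def pairing_zero)
  show "0 \<le> dual_norm 0" by (rule dual_norm_nonneg[OF space_zero])
qed

lemma bound_comb: "valid cs \<Longrightarrow> bound (comb cs) (comb_norm cs)"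
  unfolding bound_def using pairing_comb_le comb_norm_nonneg by blast

lemma comb_space: "valid cs \<Longrightarrow> comb cs \<in> space"
  unfolding space_def using bound_comb comb_outside comb_cvec by blast

lemma dual_norm_comb:
  assumes "valid cs"
  shows "dual_norm (comb cs) = comb_norm cs"
proof (rule antisym)
  show "dual_norm (comb cs) \<le> comb_norm cs" by (intro dual_norm_le bound_comb assms)
  have "comb_norm cs * comb_norm cs \<le> dual_norm (comb cs) * comb_norm cs"
    using pairing_le[OF comb_space[OF assms] assms]
    unfolding pairing_comb_self[OF assms] norm_of_real by (simp add: power2_eq_square)
  then show "comb_norm cs \<le> dual_norm (comb cs)"
    using comb_norm_nonneg[OF assms] dual_norm_nonneg[OF comb_space[OF assms]]
    by (cases "comb_norm cs = 0") auto
qed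

text \<open>
  Completing the square in \<open>2 Re \<langle>f, e\<rangle> - \<parallel>e\<parallel>\<^sup>2 \<le> \<parallel>f\<parallel>\<^sup>2\<close> at \<open>e = c + d\<close> shows that the dual norm obeys
  the expected formula for \<open>\<parallel>f - c\<parallel>\<close>.
\<close>

lemma bound_diff_comb:
  assumes f: "f \<in> space" and c: "valid c"
  shows "bound (f - comb c) (sqrt ((dual_norm f)\<^sup>2 - 2 * Re (pairing f c) + (comb_norm c)\<^sup>2))"
proof -
  define E where "E = (dual_norm f)\<^sup>2 - 2 * Re (pairing f c) + (comb_norm c)\<^sup>2"
  (* the case of a sum e = c + d, with d rescaled, is a quadratic inequality in the scale *)
  have young: "2 * Re (pairing f e) \<le> (dual_norm f)\<^sup>2 + (comb_norm e)\<^sup>2" if "valid e" for e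
  proof -
    have "Re (pairing f e) \<le> dual_norm f * comb_norm e"
      using pairing_le[OF f that] complex_Re_le_cmod order_trans by blast
    moreover have "0 \<le> (dual_norm f - comb_norm e)\<^sup>2" by simp
    ultimately show ?thesis by (simp add: power2_diff)
  qed
  have E: "0 \<le> E" using young[OF c] by (simp add: E_def)
  have sq: "(cmod (pairing (f - comb c) d))\<^sup>2 \<le> E * (comb_norm d)\<^sup>2" if d: "valid d" for d
  proof (rule semi_cauchy_schwarz)
    fix s
    let ?s = "- cnj s"
    have v: "valid (c @ scale_list ?s d)" using c valid_scale_list[OF d] by simp
    have "2 * Re (pairing f c) + 2 * Re (cnj ?s * pairing f d)
        \<le> (dual_norm f)\<^sup>2 + ((comb_norm c)\<^sup>2 + 2 * Re (cnj ?s * pairing (comb c) d) + (cmod ?s)\<^sup>2 * (comb_norm d)\<^sup>2)"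
      using young[OF v] unfolding comb_norm_sq_add[OF c d] by (simp add: pairing_scale_list)
    then show "0 \<le> E + 2 * Re (s * pairing (f - comb c) d) + (cmod s)\<^sup>2 * (comb_norm d)\<^sup>2"
      unfolding E_def pairing_diff by (simp add: algebra_simps)
  qed simp
  show ?thesis
    unfolding bound_def E_def[symmetric]
  proof (intro conjI allI impI)
    show "0 \<le> sqrt E" using E by simp
    fix d assume d: "valid d"
    have "(cmod (pairing (f - comb c) d))\<^sup>2 \<le> (sqrt E * comb_norm d)\<^sup>2"
      using sq[OF d] E by (simp add: power_mult_distrib)
    then show "cmod (pairing (f - comb c) d) \<le> sqrt E * comb_norm d"
      by (rule power2_le_imp_le) (use E comb_norm_nonneg[OF d] in simp)
  qed
qed

lemma comb_dense:
  assumes f: "f \<in> space" and e: "e > 0"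
  shows "\<exists>cs. valid cs \<and> dual_norm (f - comb cs) < e"
proof (cases "dual_norm f = 0")
  case True
  have "f - comb [] = f" by (simp add: fun_eq_iff)
  then show ?thesis using True e by (intro exI[of _ "[]"]) simp
next
  case False
  define N where "N = dual_norm f"
  have N: "N > 0" using False dual_norm_nonneg[OF f] by (simp add: N_def)
  define \<delta> where "\<delta> = min N (e\<^sup>2 / (4 * N))"
  have \<delta>: "\<delta> > 0" "\<delta> \<le> N" "\<delta> \<le> e\<^sup>2 / (4 * N)" using N e by (auto simp: \<delta>_def)
  have "\<not> bound f (N - \<delta>)" using dual_norm_le[of f "N - \<delta>"] \<delta> by (auto simp: N_def)
  then obtain d where d: "valid d" and big: "cmod (pairing f d) > (N - \<delta>) * comb_norm d"
    using \<delta> by (auto simp: bound_def not_le)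
  define b where "b = pairing f d"
  have b0: "b \<noteq> 0"
    using big \<delta>(2) mult_nonneg_nonneg[OF _ comb_norm_nonneg[OF d], of "N - \<delta>"] by (auto simp: b_def)
  have n: "comb_norm d > 0"
    using pairing_le[OF f d] b0 comb_norm_nonneg[OF d] by (cases "comb_norm d = 0") (auto simp: b_def)
  (* the multiple of d of norm N for which the pairing with f is positive *)
  define s where "s = of_real (N / (comb_norm d * cmod b)) * b"
  have ms: "cmod s = N / comb_norm d"
    using b0 n N by (simp add: s_def norm_mult norm_divide)
  have v: "valid (scale_list s d)" by (rule valid_scale_list[OF d])
  have "pairing f (scale_list s d) = of_real (N / (comb_norm d * cmod b)) * (b * cnj b)"
    by (simp add: pairing_scale_list s_def b_def mult.commute mult.left_commute)
  also have "\<dots> = of_real (N / (comb_norm d * cmod b) * (cmod b)\<^sup>2)"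
    by (simp only: complex_norm_square of_real_mult)
  also have "N / (comb_norm d * cmod b) * (cmod b)\<^sup>2 = N * cmod b / comb_norm d"
    using b0 by (simp add: power2_eq_square)
  finally have p: "Re (pairing f (scale_list s d)) = N * cmod b / comb_norm d"
    by (simp only: Re_complex_of_real)
  have "(N - \<delta>) \<le> cmod b / comb_norm d" using big n by (simp add: le_divide_eq b_def)
  then have "N * (N - \<delta>) \<le> N * (cmod b / comb_norm d)" using N by (intro mult_left_mono) auto
  then have p': "N * (N - \<delta>) \<le> Re (pairing f (scale_list s d))" by (simp add: p)
  have "comb_norm (scale_list s d) = N"
  proof -
    have "(comb_norm (scale_list s d))\<^sup>2 = (cmod s)\<^sup>2 * (comb_norm d)\<^sup>2"
      using comb_norm_sq_add[of "[]" d s] d by (simp add: comb_norm_def pairing_zero)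
    also have "\<dots> = N\<^sup>2" using n by (simp add: ms power_divide)
    finally show ?thesis using comb_norm_nonneg[OF v] N by simp
  qed
  then have le: "dual_norm (f - comb (scale_list s d)) \<le> sqrt (N\<^sup>2 - 2 * Re (pairing f (scale_list s d)) + N\<^sup>2)"
    using dual_norm_le[OF bound_diff_comb[OF f v]] by (simp add: N_def)
  have "N\<^sup>2 - 2 * Re (pairing f (scale_list s d)) + N\<^sup>2 \<le> 2 * (N * \<delta>)"
    using p' by (simp add: algebra_simps power2_eq_square)
  also have "N * \<delta> \<le> e\<^sup>2 / 4" using \<delta>(3) N by (simp add: field_simps)
  also have "2 * (e\<^sup>2 / 4) < e\<^sup>2" using e by simp
  finally have "sqrt (N\<^sup>2 - 2 * Re (pairing f (scale_list s d)) + N\<^sup>2) < e"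
    using e by (intro real_less_lsqrt) auto
  then show ?thesis using le v by (intro exI[of _ "scale_list s d"]) simp
qed

text \<open>
  The inner product is defined as a limit of pairings along approximations of the second argument. This
  makes linearity in the first argument immediate, and symmetry follows by approximating both arguments.
\<close>

definition approx :: "('m, 'i) vfun \<Rightarrow> nat \<Rightarrow> ((complex ^ 'm) \<times> ('i \<Rightarrow> complex)) list" where
  "approx f = (SOME c. \<forall>n. valid (c n) \<and> dual_norm (f - comb (c n)) < inverse (real (Suc n)))"

lemma approx:
  assumes "f \<in> space"
  shows "valid (approx f n)" and "(\<lambda>n. dual_norm (f - comb (approx f n))) \<longlonglongrightarrow> 0"
proof -
  have "\<forall>n. \<exists>c. valid c \<and> dual_norm (f - comb c) < inverse (real (Suc n))"
    by (intro allI comb_dense[OF assms]) simp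
  then have "\<exists>c. \<forall>n. valid (c n) \<and> dual_norm (f - comb (c n)) < inverse (real (Suc n))"
    by (rule choice)
  from someI_ex[OF this]
  have a: "\<forall>n. valid (approx f n) \<and> dual_norm (f - comb (approx f n)) < inverse (real (Suc n))"
    unfolding approx_def .
  then show "valid (approx f n)" by blast
  show "(\<lambda>n. dual_norm (f - comb (approx f n))) \<longlonglongrightarrow> 0"
  proof (rule tendsto_sandwich[OF _ _ tendsto_const LIMSEQ_inverse_real_of_nat])
    show "\<forall>\<^sub>F n in sequentially. 0 \<le> dual_norm (f - comb (approx f n))"
      using a assms by (intro always_eventually allI dual_norm_nonneg space_diff comb_space) auto
    show "\<forall>\<^sub>F n in sequentially. dual_norm (f - comb (approx f n)) \<le> inverse (real (Suc n))"
      using a by (intro always_eventually allI less_imp_le) blast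
  qed
qed

definition space_ip :: "('m, 'i) vfun \<Rightarrow> ('m, 'i) vfun \<Rightarrow> complex" where
  "space_ip f g = lim (\<lambda>n. pairing f (approx g n))"

lemma pairing_diff_le:
  assumes "f \<in> space" "valid c" "valid d"
  shows "cmod (pairing f c - pairing f d) \<le> dual_norm f * dual_norm (comb c - comb d)"
proof -
  let ?e = "c @ scale_list (-1) d"
  have v: "valid ?e" using assms valid_scale_list[OF assms(3)] by simp
  have "pairing f ?e = pairing f c - pairing f d" by (simp add: pairing_scale_list)
  moreover have "comb ?e = comb c - comb d"
    by (simp add: comb_append comb_scale_list diff_eq_add_fscale)
  ultimately show ?thesis
    using pairing_le[OF assms(1) v] dual_norm_comb[OF v] by simp
qed

lemma dual_norm_diff_triangle:
  assumes "f \<in> space" "g \<in> space" "h \<in> space"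
  shows "dual_norm (f - g) \<le> dual_norm (h - f) + dual_norm (h - g)"
proof -
  have "f - g = (h - g) - (h - f)" by (simp add: fun_eq_iff)
  then show ?thesis
    using dual_norm_diff[of "h - g" "h - f"] assms space_diff by (metis add.commute)
qed

lemma space_ip_tendsto:
  assumes f: "f \<in> space" and g: "g \<in> space" and d: "\<And>n. valid (d n)"
    and lim: "(\<lambda>n. dual_norm (g - comb (d n))) \<longlonglongrightarrow> 0"
  shows "(\<lambda>n. pairing f (d n)) \<longlonglongrightarrow> space_ip f g"
proof -
  note ds = comb_space[OF d]
  have close: "cmod (pairing f a - pairing f b)
      \<le> dual_norm f * (dual_norm (g - comb a) + dual_norm (g - comb b))" if "valid a" "valid b" for a b
    using pairing_diff_le[OF f that] dual_norm_diff_triangle[OF comb_space[OF that(1)] comb_space[OF that(2)] g]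
      mult_left_mono[OF _ dual_norm_nonneg[OF f]] order_trans by blast
  note ap = approx[OF g]
  have "Cauchy (\<lambda>n. pairing f (approx g n))"
    unfolding Cauchy_iff
  proof (intro allI impI)
    fix e :: real assume e: "0 < e"
    define e' where "e' = e / (dual_norm f + 1) / 2"
    have nf: "dual_norm f + 1 > 0" using dual_norm_nonneg[OF f] by simp
    have e': "e' > 0" using e nf by (simp add: e'_def)
    obtain M where M: "\<And>n. n \<ge> M \<Longrightarrow> dual_norm (g - comb (approx g n)) < e'"
      using order_tendstoD(2)[OF ap(2) e'] by (auto simp: eventually_sequentially)
    have "cmod (pairing f (approx g m) - pairing f (approx g n)) < e" if "m \<ge> M" "n \<ge> M" for m n
    proof -
      have "cmod (pairing f (approx g m) - pairing f (approx g n)) \<le> dual_norm f * (e' + e')"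
        using close[OF ap(1) ap(1), of m n] M[OF that(1)] M[OF that(2)] dual_norm_nonneg[OF f]
        by (smt (verit) mult_left_mono)
      also have "\<dots> < (dual_norm f + 1) * (e' + e')" using e' by (intro mult_strict_right_mono) auto
      also have "\<dots> = e"
      proof -
        have "e' + e' = e / (dual_norm f + 1)" unfolding e'_def by (rule field_sum_of_halves)
        then show ?thesis using nf by simp
      qed
      finally show ?thesis .
    qed
    then show "\<exists>M. \<forall>m\<ge>M. \<forall>n\<ge>M. norm (pairing f (approx g m) - pairing f (approx g n)) < e" by blast
  qed
  then have L: "(\<lambda>n. pairing f (approx g n)) \<longlonglongrightarrow> space_ip f g"
    unfolding space_ip_def by (intro convergent_LIMSEQ_iff[THEN iffD1] Cauchy_convergent)
  have "(\<lambda>n. pairing f (d n) - pairing f (approx g n)) \<longlonglongrightarrow> 0"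
  proof (rule Lim_null_comparison)
    show "\<forall>\<^sub>F n in sequentially. norm (pairing f (d n) - pairing f (approx g n))
        \<le> dual_norm f * (dual_norm (g - comb (d n)) + dual_norm (g - comb (approx g n)))"
      by (intro always_eventually allI close d ap(1))
    show "(\<lambda>n. dual_norm f * (dual_norm (g - comb (d n)) + dual_norm (g - comb (approx g n)))) \<longlonglongrightarrow> 0"
      using tendsto_mult_left[OF tendsto_add[OF lim ap(2)], of "dual_norm f"] by simp
  qed
  from tendsto_add[OF this L] show ?thesis by simp
qed

lemma space_ip_comb: "f \<in> space \<Longrightarrow> valid d \<Longrightarrow> space_ip f (comb d) = pairing f d"
  using space_ip_tendsto[of f "comb d" "\<lambda>_. d"] comb_space[of d] LIMSEQ_unique[OF _ tendsto_const]
  by (fastforce simp: dual_norm_zero)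

lemma dual_norm_comb_tendsto:
  assumes f: "f \<in> space" and c: "\<And>n. valid (c n)" and lim: "(\<lambda>n. dual_norm (f - comb (c n))) \<longlonglongrightarrow> 0"
  shows "(\<lambda>n. dual_norm (comb (c n))) \<longlonglongrightarrow> dual_norm f"
proof -
  have "(\<lambda>n. dual_norm (comb (c n)) - dual_norm f) \<longlonglongrightarrow> 0"
  proof (rule Lim_null_comparison[OF _ lim])
    have "norm (dual_norm (comb (c n)) - dual_norm f) \<le> dual_norm (f - comb (c n))" for n
    proof -
      note m = f comb_space[OF c, of n] space_diff[OF f comb_space[OF c, of n]]
      have "comb (c n) = f - (f - comb (c n))" "f = comb (c n) + (f - comb (c n))"
        by (simp_all add: fun_eq_iff)
      then have "dual_norm (comb (c n)) \<le> dual_norm f + dual_norm (f - comb (c n))"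
        "dual_norm f \<le> dual_norm (comb (c n)) + dual_norm (f - comb (c n))"
        using dual_norm_diff[OF m(1,3)] dual_norm_add[OF m(2,3)] by simp_all
      then show ?thesis by simp
    qed
    then show "\<forall>\<^sub>F n in sequentially. norm (dual_norm (comb (c n)) - dual_norm f) \<le> dual_norm (f - comb (c n))"
      by simp
  qed
  then show ?thesis by (simp add: LIM_zero_iff)
qed

lemma space_ip_tendsto_both:
  assumes f: "f \<in> space" and g: "g \<in> space"
    and c: "\<And>n. valid (c n)" "(\<lambda>n. dual_norm (f - comb (c n))) \<longlonglongrightarrow> 0"
    and d: "\<And>n. valid (d n)" "(\<lambda>n. dual_norm (g - comb (d n))) \<longlonglongrightarrow> 0"
  shows "(\<lambda>n. pairing (comb (c n)) (d n)) \<longlonglongrightarrow> space_ip f g"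
proof -
  have "(\<lambda>n. pairing f (d n) - pairing (comb (c n)) (d n)) \<longlonglongrightarrow> 0"
  proof (rule Lim_null_comparison)
    show "\<forall>\<^sub>F n in sequentially. norm (pairing f (d n) - pairing (comb (c n)) (d n))
        \<le> dual_norm (f - comb (c n)) * dual_norm (comb (d n))"
      using pairing_le[OF space_diff[OF f comb_space[OF c(1)]] d(1)] dual_norm_comb[OF d(1)]
      by (simp add: pairing_diff)
    show "(\<lambda>n. dual_norm (f - comb (c n)) * dual_norm (comb (d n))) \<longlonglongrightarrow> 0"
      using tendsto_mult[OF c(2) dual_norm_comb_tendsto[OF g d]] by simp
  qed
  from tendsto_diff[OF space_ip_tendsto[OF f g d] this] show ?thesis by simp
qed

lemma space_ip_self:
  assumes f: "f \<in> space"
  shows "space_ip f f = of_real ((dual_norm f)\<^sup>2)"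
proof (rule LIMSEQ_unique[OF space_ip_tendsto_both[OF f f approx[OF f] approx[OF f]]])
  have "(\<lambda>n. complex_of_real ((dual_norm (comb (approx f n)))\<^sup>2)) \<longlonglongrightarrow> of_real ((dual_norm f)\<^sup>2)"
    by (intro tendsto_of_real tendsto_power dual_norm_comb_tendsto f approx[OF f])
  then show "(\<lambda>n. pairing (comb (approx f n)) (approx f n)) \<longlonglongrightarrow> of_real ((dual_norm f)\<^sup>2)"
    by (simp only: pairing_comb_self[OF approx(1)[OF f]] dual_norm_comb[OF approx(1)[OF f]])
qed

lemma hnorm_space_ip: "f \<in> space \<Longrightarrow> hnorm space_ip f = dual_norm f"
  by (simp add: hnorm_def space_ip_self dual_norm_nonneg)

lemma pairing_comb_unit_vec:
  assumes "z \<in> \<Omega>" "i \<in> I"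
  shows "pairing (comb [(z, unit_vec i)]) [(z, unit_vec i)] = K z z i i"
  using finite_index assms
  by (simp add: cvec_inner_unit_vec kernel_section_def mat_app_def)
    (simp add: unit_vec_def if_distrib cong: if_cong)

lemma eval_le:
  assumes "f \<in> space" "z \<in> \<Omega>" "i \<in> I"
  shows "cmod (f z i) \<le> dual_norm f * sqrt (Re (K z z i i))"
proof -
  have v: "valid [(z, unit_vec i)]" using assms unit_vec_cvec[of i I] by simp
  have "pairing f [(z, unit_vec i)] = f z i"
    using finite_index assms(3) by (simp add: cvec_inner_unit_vec)
  then show ?thesis
    using pairing_le[OF assms(1) v] by (simp only: comb_norm_def pairing_comb_unit_vec[OF assms(2,3)])
qed

lemma space_outside: "f \<in> space \<Longrightarrow> z \<notin> \<Omega> \<Longrightarrow> f z = 0"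
  by (simp add: space_def)

lemma space_cvec: "f \<in> space \<Longrightarrow> f z \<in> cvec I"
  by (simp add: space_def)

lemma space_complete:
  assumes u: "\<And>n::nat. u n \<in> space"
    and cau: "\<And>e. e > 0 \<Longrightarrow> \<exists>N. \<forall>m\<ge>N. \<forall>n\<ge>N. dual_norm (u m - u n) < e"
  shows "\<exists>f\<in>space. (\<lambda>n. dual_norm (u n - f)) \<longlonglongrightarrow> 0"
proof -
  have pt: "convergent (\<lambda>n. u n z i)" for z i
  proof (cases "z \<in> \<Omega> \<and> i \<in> I")
    case False
    then have "u n z i = 0" for n
      using space_outside[OF u, of z n] space_cvec[OF u, of n z] by (auto simp: cvec_def)
    then show ?thesis by (simp add: convergent_const)
  next
    case True
    define C where "C = sqrt (Re (K z z i i)) + 1"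
    have "0 \<le> Re (K z z i i)"
    proof -
      have v: "valid [(z, unit_vec i)]" using True unit_vec_cvec[of i I] by simp
      then show ?thesis using pairing_comb_nonneg[OF v] True by (simp only: pairing_comb_unit_vec)
    qed
    then have C: "C > 0" by (simp add: C_def add_nonneg_pos)
    have "Cauchy (\<lambda>n. u n z i)"
      unfolding Cauchy_iff
    proof (intro allI impI)
      fix e :: real assume "0 < e"
      then obtain N where N: "\<And>m n. m \<ge> N \<Longrightarrow> n \<ge> N \<Longrightarrow> dual_norm (u m - u n) < e / C"
        using cau[of "e / C"] C by (meson divide_pos_pos)
      have "cmod (u m z i - u n z i) < e" if mn: "m \<ge> N" "n \<ge> N" for m n
      proof -
        have d: "u m - u n \<in> space" by (rule space_diff[OF u u])
        have "cmod (u m z i - u n z i) \<le> dual_norm (u m - u n) * sqrt (Re (K z z i i))"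
          using eval_le[OF d, of z i] True by simp
        also have "\<dots> \<le> dual_norm (u m - u n) * C"
          using dual_norm_nonneg[OF d] by (intro mult_left_mono) (auto simp: C_def)
        also have "\<dots> < e" using N[OF mn] C by (simp add: less_divide_eq)
        finally show ?thesis .
      qed
      then show "\<exists>N. \<forall>m\<ge>N. \<forall>n\<ge>N. norm (u m z i - u n z i) < e" by blast
    qed
    then show ?thesis by (rule Cauchy_convergent)
  qed
  define f where "f = (\<lambda>z i. lim (\<lambda>n. u n z i))"
  have f: "(\<lambda>n. u n z i) \<longlonglongrightarrow> f z i" for z i
    using pt[of z i] by (simp add: f_def convergent_LIMSEQ_iff)
  have pf: "(\<lambda>n. pairing (u n) cs) \<longlonglongrightarrow> pairing f cs" for cs
  proof (induction cs)
    case (Cons c cs)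
    have "(\<lambda>n. cvec_inner I (u n (fst c)) (snd c)) \<longlonglongrightarrow> cvec_inner I (f (fst c)) (snd c)"
      unfolding cvec_inner_def by (intro tendsto_sum tendsto_mult f tendsto_const)
    from tendsto_add[OF this Cons] show ?case by simp
  qed simp
  have bd: "bound (u n - f) e" if e: "e > 0" and N: "\<And>m. m \<ge> N \<Longrightarrow> dual_norm (u n - u m) < e" for n N e
    unfolding bound_def
  proof (intro conjI allI impI)
    show "0 \<le> e" using e by simp
    fix cs assume v: "valid cs"
    have "(\<lambda>m. cmod (pairing (u n - u m) cs)) \<longlonglongrightarrow> cmod (pairing (u n - f) cs)"
      unfolding pairing_diff by (intro tendsto_norm tendsto_diff tendsto_const pf)
    moreover have "cmod (pairing (u n - u m) cs) \<le> e * comb_norm cs" if "m \<ge> N" for m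
    proof -
      have "cmod (pairing (u n - u m) cs) \<le> dual_norm (u n - u m) * comb_norm cs"
        by (rule pairing_le[OF space_diff[OF u u] v])
      also have "\<dots> \<le> e * comb_norm cs"
        using N[OF that] comb_norm_nonneg[OF v] by (intro mult_right_mono) auto
      finally show ?thesis .
    qed
    ultimately show "cmod (pairing (u n - f) cs) \<le> e * comb_norm cs"
      by (intro LIMSEQ_le_const2) auto
  qed
  have conv: "\<exists>N. \<forall>n\<ge>N. bound (u n - f) e" if e: "e > 0" for e
  proof -
    obtain N where "\<And>m n. m \<ge> N \<Longrightarrow> n \<ge> N \<Longrightarrow> dual_norm (u m - u n) < e" using cau[OF e] by blast
    then show ?thesis using bd[OF e, of N] by (intro exI[of _ N]) auto
  qed
  have fs: "f \<in> space"
  proof -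
    obtain N where "bound (u N - f) 1" using conv[of 1] by auto
    then have "bound (u N + fscale (-1) (u N - f)) (dual_norm (u N) + cmod (-1) * 1)"
      by (intro bound_add bound_fscale bound_dual_norm u)
    moreover have "u N + fscale (-1) (u N - f) = f" by (simp add: fun_eq_iff)
    ultimately have "\<exists>C. bound f C" by metis
    moreover have "f z = 0" if "z \<notin> \<Omega>" for z
      using space_outside[OF u that] by (simp add: f_def fun_eq_iff)
    moreover have "f z \<in> cvec I" for z
    proof -
      have "u n z i = 0" if "i \<notin> I" for n i
        using space_cvec[OF u, of n z] that by (simp add: cvec_def)
      then show ?thesis by (simp add: f_def cvec_def)
    qed
    ultimately show ?thesis by (simp add: space_def)
  qed
  moreover have "(\<lambda>n. dual_norm (u n - f)) \<longlonglongrightarrow> 0"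
  proof (rule LIMSEQ_I)
    fix e :: real assume e: "0 < e"
    then obtain N where N: "\<And>n. n \<ge> N \<Longrightarrow> bound (u n - f) (e / 2)" using conv[of "e/2"] by auto
    have "norm (dual_norm (u n - f) - 0) < e" if "n \<ge> N" for n
      using dual_norm_le[OF N[OF that]] dual_norm_nonneg[OF space_diff[OF u fs], of n] e by simp
    then show "\<exists>N. \<forall>n\<ge>N. norm (dual_norm (u n - f) - 0) < e" by blast
  qed
  ultimately show ?thesis by blast
qed

lemma hilbert_function_space_space: "hilbert_function_space space space_ip"
proof
  fix f g h c
  show "0 \<in> space" by (rule space_zero)
  show "f + g \<in> space" if "f \<in> space" "g \<in> space" using that by (rule space_add)
  show "fscale c f \<in> space" if "f \<in> space" using that by (rule space_fscale)
  show "space_ip (f + g) h = space_ip f h + space_ip g h"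
    if "f \<in> space" "g \<in> space" "h \<in> space"
  proof (rule LIMSEQ_unique[OF space_ip_tendsto[OF space_add[OF that(1,2)] that(3) approx[OF that(3)]]])
    show "(\<lambda>n. pairing (f + g) (approx h n)) \<longlonglongrightarrow> space_ip f h + space_ip g h"
      unfolding pairing_add by (intro tendsto_add space_ip_tendsto approx that)
  qed
  show "space_ip (fscale c f) g = c * space_ip f g" if "f \<in> space" "g \<in> space"
  proof (rule LIMSEQ_unique[OF space_ip_tendsto[OF space_fscale[OF that(1)] that(2) approx[OF that(2)]]])
    show "(\<lambda>n. pairing (fscale c f) (approx g n)) \<longlonglongrightarrow> c * space_ip f g"
      unfolding pairing_fscale by (intro tendsto_mult_left space_ip_tendsto approx that)
  qed
  show "space_ip g f = cnj (space_ip f g)" if "f \<in> space" "g \<in> space"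
  proof (rule LIMSEQ_unique[OF space_ip_tendsto_both[OF that(2,1) approx[OF that(2)] approx[OF that(1)]]])
    have "(\<lambda>n. cnj (pairing (comb (approx f n)) (approx g n))) \<longlonglongrightarrow> cnj (space_ip f g)"
      by (intro tendsto_cnj space_ip_tendsto_both approx that)
    then show "(\<lambda>n. pairing (comb (approx g n)) (approx f n)) \<longlonglongrightarrow> cnj (space_ip f g)"
      by (simp only: pairing_comb_cnj[OF approx(1)[OF that(1)] approx(1)[OF that(2)]])
  qed
  show "0 < Re (space_ip f f)" if "f \<in> space" and f0: "f \<noteq> 0"
  proof -
    obtain z i where zi: "f z i \<noteq> 0" using f0 by (auto simp: fun_eq_iff)
    then have "z \<in> \<Omega>" "i \<in> I"
      using space_outside[OF that(1), of z] space_cvec[OF that(1), of z] by (auto simp: cvec_def)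
    then have "dual_norm f \<noteq> 0" using eval_le[OF that(1)] zi by fastforce
    then show ?thesis by (simp add: space_ip_self[OF that(1)])
  qed
next
  fix u :: "nat \<Rightarrow> ('m, 'i) vfun"
  assume u: "\<And>n. u n \<in> space"
    and cau: "\<And>e. e > 0 \<Longrightarrow> \<exists>N. \<forall>m\<ge>N. \<forall>n\<ge>N. hnorm space_ip (u m - u n) < e"
  have "\<exists>f\<in>space. (\<lambda>n. dual_norm (u n - f)) \<longlonglongrightarrow> 0"
    using cau by (intro space_complete u) (simp add: hnorm_space_ip space_diff u)
  then show "\<exists>f\<in>space. (\<lambda>n. hnorm space_ip (u n - f)) \<longlonglongrightarrow> 0"
    using u by (auto simp: hnorm_space_ip space_diff)
qed

text \<open>
  The theorem of Moore and Aronszajn. Convergence in norm is uniform where the diagonal of the kernel is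
  bounded, so that holomorphy passes from combinations of kernel sections to all functions of the space.
\<close>

lemma rkhs_space:
  assumes \<Omega>: "open \<Omega>"
    and hol: "\<And>w i j. w \<in> \<Omega> \<Longrightarrow> i \<in> I \<Longrightarrow> j \<in> I \<Longrightarrow> holomorphic_several (\<lambda>z. K z w i j) \<Omega>"
    and loc: "\<And>z i. z \<in> \<Omega> \<Longrightarrow> i \<in> I \<Longrightarrow> \<exists>r>0. ball z r \<subseteq> \<Omega> \<and> (\<exists>C. \<forall>x\<in>ball z r. Re (K x x i i) \<le> C)"
  shows "rkhs space space_ip \<Omega> I K"
proof -
  interpret H: hilbert_function_space "space" space_ip by (rule hilbert_function_space_space)
  have hs: "holomorphic_several (\<lambda>z. kernel_section \<Omega> I K w \<eta> z i) \<Omega>" if "w \<in> \<Omega>" "i \<in> I" for w \<eta> i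
  proof (rule holomorphic_several_cong[OF \<Omega>])
    show "holomorphic_several (\<lambda>z. \<Sum>j\<in>I. K z w i j * \<eta> j) \<Omega>"
      by (intro holomorphic_several_sum holomorphic_several_mult hol holomorphic_several_const that)
  qed (simp add: kernel_section_def mat_app_def that)
  have hc: "holomorphic_several (\<lambda>z. comb cs z i) \<Omega>" if "valid cs" and i: "i \<in> I" for cs i
    using that(1)
  proof (induction cs)
    case (Cons c cs)
    then show ?case using hs[of "fst c" i "snd c"] i by (auto intro: holomorphic_several_add)
  qed (simp add: holomorphic_several_const)
  show ?thesis
  proof
    fix f z i w and \<eta> :: "'i \<Rightarrow> complex"
    show "f z = 0" if "f \<in> space" "z \<notin> \<Omega>" using that by (rule space_outside)
    show "f z \<in> cvec I" if "f \<in> space" using that by (rule space_cvec)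
    have comb1: "comb [(w, \<eta>)] = kernel_section \<Omega> I K w \<eta>" by (simp add: fun_eq_iff)
    show "kernel_section \<Omega> I K w \<eta> \<in> space" if "w \<in> \<Omega>" "\<eta> \<in> cvec I"
      using comb_space[of "[(w, \<eta>)]"] that unfolding comb1 by simp
    show "space_ip f (kernel_section \<Omega> I K w \<eta>) = cvec_inner I (f w) \<eta>"
      if "f \<in> space" "w \<in> \<Omega>" "\<eta> \<in> cvec I"
      using space_ip_comb[OF that(1), of "[(w, \<eta>)]"] that unfolding comb1 by simp
    show "holomorphic_several (\<lambda>z. f z i) \<Omega>" if f: "f \<in> space" and i: "i \<in> I"
    proof (rule holomorphic_several_uniform_limit[of "\<lambda>n z. comb (approx f n) z i"])
      show "holomorphic_several (\<lambda>z. comb (approx f n) z i) \<Omega>" for n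
        by (rule hc[OF approx(1)[OF f] i])
      fix z assume "z \<in> \<Omega>"
      then obtain r C where r: "r > 0" "ball z r \<subseteq> \<Omega>" and C: "\<And>x. x \<in> ball z r \<Longrightarrow> Re (K x x i i) \<le> C"
        using loc[of z i] i by blast
      have "uniform_limit (ball z r) (\<lambda>n z. comb (approx f n) z i) (\<lambda>z. f z i) sequentially"
        unfolding uniform_limit_iff
      proof (intro allI impI)
        fix e :: real assume e: "0 < e"
        have lim: "(\<lambda>n. dual_norm (f - comb (approx f n)) * sqrt C) \<longlonglongrightarrow> 0"
          using tendsto_mult_right[OF approx(2)[OF f], of "sqrt C"] by simp
        show "\<forall>\<^sub>F n in sequentially. \<forall>x\<in>ball z r. dist (comb (approx f n) x i) (f x i) < e"
          using order_tendstoD(2)[OF lim e]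
        proof eventually_elim
          case (elim n)
          show ?case
          proof
            fix x assume x: "x \<in> ball z r"
            have d: "f - comb (approx f n) \<in> space" by (intro space_diff f comb_space approx)
            have "cmod (f x i - comb (approx f n) x i)
                \<le> dual_norm (f - comb (approx f n)) * sqrt (Re (K x x i i))"
              using eval_le[OF d, of x i] x r i by auto
            also have "\<dots> \<le> dual_norm (f - comb (approx f n)) * sqrt C"
              using C[OF x] dual_norm_nonneg[OF d] by (intro mult_left_mono) auto
            finally show "dist (comb (approx f n) x i) (f x i) < e"
              using elim by (simp add: dist_norm norm_minus_commute)
          qed
        qed
      qed
      then show "\<exists>r>0. ball z r \<subseteq> \<Omega> \<and>
          uniform_limit (ball z r) (\<lambda>n z. comb (approx f n) z i) (\<lambda>z. f z i) sequentially"
        using r by blast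
    qed
  qed
qed

end

section \<open>Scalar reproducing kernel Hilbert spaces\<close>

lemma cvec_UNIV [simp]: "cvec UNIV = UNIV"
  by (simp add: cvec_def)

text \<open>
  What sharpness of a scalar kernel provides: multiplication by the coordinates is bounded, and functionals
  that kill the ranges of all \<open>M\<^sub>l - w\<^sub>l\<close> are multiples of evaluation at \<open>w\<close>. Phrasing the latter with ranges
  instead of adjoints keeps the adjoint out of the arguments below.
\<close>

locale scalar_rkhs = rkhs H ip \<Omega> "UNIV :: unit set" "scalar_kernel K"
  for H :: "('m::finite, unit) vfun set" and ip and \<Omega> and K +
  assumes open_domain: "open \<Omega>"
    and mult_bounded: "bounded_operator H ip (mult_op l)"
    and diagonal: "w \<in> \<Omega> \<Longrightarrow> K w w \<noteq> 0"
    and joint_kernel: "w \<in> \<Omega> \<Longrightarrow> g \<in> H \<Longrightarrow>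
      (\<And>l f. f \<in> H \<Longrightarrow> ip (mult_op l f - fscale (w $ l) f) g = 0) \<Longrightarrow> \<exists>c. \<forall>f\<in>H. ip f g = c * f w ()"
begin

definition point :: "complex ^ 'm \<Rightarrow> ('m, unit) vfun" where
  "point w = kernel_section \<Omega> UNIV (scalar_kernel K) w (\<lambda>_. 1)"

lemma point_mem: "w \<in> \<Omega> \<Longrightarrow> point w \<in> H"
  unfolding point_def by (rule section_mem) auto

lemma ip_point: "f \<in> H \<Longrightarrow> w \<in> \<Omega> \<Longrightarrow> ip f (point w) = f w ()"
  using reproducing[of f w "\<lambda>_. 1"] by (simp add: point_def cvec_inner_def UNIV_unit cvec_def)

lemma ip_point_left: "f \<in> H \<Longrightarrow> w \<in> \<Omega> \<Longrightarrow> ip (point w) f = cnj (f w ())"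
  using ip_cnj[of f "point w"] ip_point point_mem by simp

lemma point_apply: "z \<in> \<Omega> \<Longrightarrow> point w z () = K z w"
  by (simp add: point_def kernel_section_def mat_app_def scalar_kernel_def UNIV_unit)

lemma ip_point_point: "z \<in> \<Omega> \<Longrightarrow> w \<in> \<Omega> \<Longrightarrow> ip (point w) (point z) = K z w"
  by (simp add: ip_point point_mem point_apply)

lemma kernel_cnj: "z \<in> \<Omega> \<Longrightarrow> w \<in> \<Omega> \<Longrightarrow> K w z = cnj (K z w)"
  using ip_cnj[OF point_mem point_mem, of w z] by (simp add: ip_point_point)

lemma hol: "f \<in> H \<Longrightarrow> holomorphic_several (\<lambda>z. f z ()) \<Omega>"
  using holomorphic by simp

lemma hol_deriv: "f \<in> H \<Longrightarrow> holomorphic_several (foldr dz ls (\<lambda>z. f z ())) \<Omega>"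
  by (intro holomorphic_several_foldr_dz open_domain hol)

text \<open>
  Derivative evaluations are weak limits of difference quotients of evaluations, hence bounded by
  the uniform boundedness principle.
\<close>

lemma derivative_representable:
  "w \<in> \<Omega> \<Longrightarrow> \<exists>g\<in>H. \<forall>f\<in>H. foldr dz ls (\<lambda>z. f z ()) w = ip f g"
proof (induction ls arbitrary: w)
  case Nil
  then show ?case using ip_point point_mem by (intro bexI[of _ "point w"]) auto
next
  case (Cons l ls)
  have "\<forall>w\<in>\<Omega>. \<exists>g\<in>H. \<forall>f\<in>H. foldr dz ls (\<lambda>z. f z ()) w = ip f g" using Cons.IH by blast
  then obtain G where GH: "\<And>w. w \<in> \<Omega> \<Longrightarrow> G w \<in> H"
    and G: "\<And>w f. w \<in> \<Omega> \<Longrightarrow> f \<in> H \<Longrightarrow> foldr dz ls (\<lambda>z. f z ()) w = ip f (G w)" by metis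
  obtain r where r: "r > 0" "ball w r \<subseteq> \<Omega>" using open_domain Cons.prems open_contains_ball by blast
  define e where "e n = r / 2 * inverse (real (Suc n))" for n
  have e: "e n > 0" "e n < r" for n
  proof -
    show "e n > 0" using r by (simp add: e_def)
    have "inverse (real (Suc n)) \<le> 1" by (simp add: inverse_le_1_iff)
    then have "e n \<le> r / 2 * 1" unfolding e_def using r by (intro mult_left_mono) auto
    then show "e n < r" using r by simp
  qed
  have pt: "w + of_real (e n) *s axis l 1 \<in> \<Omega>" for n
    using e[of n] r(2) by (auto simp: subset_iff dist_norm norm_smult norm_axis_complex)
  have e0: "(\<lambda>n. complex_of_real (e n)) \<longlonglongrightarrow> 0"
  proof -
    have "e \<longlonglongrightarrow> r / 2 * 0"
      unfolding e_def by (intro tendsto_mult_left LIMSEQ_inverse_real_of_nat)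
    then show ?thesis using tendsto_of_real[of e 0] by simp
  qed
  have fl: "filterlim (\<lambda>n. complex_of_real (e n)) (at 0) sequentially"
    using e0 e(1) by (intro filterlim_atI always_eventually allI) (auto simp: less_imp_neq[symmetric])
  define g where "g n = fscale (of_real (inverse (e n))) (G (w + of_real (e n) *s axis l 1) - G w)" for n
  show ?case
  proof (rule weak_limit)
    show "g n \<in> H" for n
      unfolding g_def by (intro scale_mem diff_mem GH pt Cons.prems)
    fix f assume f: "f \<in> H"
    define F where "F = foldr dz ls (\<lambda>z. f z ())"
    obtain L where L: "complex_deriv_at F w L"
      using hol_deriv[OF f] Cons.prems unfolding F_def holomorphic_several_iff by blast
    have "((\<lambda>t. F (w + t *s axis l 1)) has_field_derivative L (axis l 1)) (at 0)"
      using L by (intro complex_deriv_at_line) simp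
    then have "(\<lambda>h. (F (w + h *s axis l 1) - F w) / h) \<midarrow>0\<rightarrow> dz l F w"
      by (simp add: DERIV_def dz_eq[OF L])
    from filterlim_compose[OF this fl]
    have "(\<lambda>n. (F (w + of_real (e n) *s axis l 1) - F w) / of_real (e n)) \<longlonglongrightarrow> dz l F w" .
    moreover have "ip f (g n) = (F (w + of_real (e n) *s axis l 1) - F w) / of_real (e n)" for n
      unfolding g_def F_def
      using ip_scale_right[OF f diff_mem[OF GH[OF pt[of n]] GH[OF Cons.prems]]]
        ip_diff_right[OF GH[OF pt[of n]] GH[OF Cons.prems] f] G[OF pt[of n] f] G[OF Cons.prems f]
      by (simp add: divide_inverse mult.commute)
    ultimately show "(\<lambda>n. ip f (g n)) \<longlonglongrightarrow> foldr dz (l # ls) (\<lambda>z. f z ()) w"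
      by (simp add: F_def)
  qed
qed

definition repr :: "'m list \<Rightarrow> complex ^ 'm \<Rightarrow> ('m, unit) vfun" where
  "repr ls w = (SOME g. g \<in> H \<and> (\<forall>f\<in>H. foldr dz ls (\<lambda>z. f z ()) w = ip f g))"

lemma repr_mem: "w \<in> \<Omega> \<Longrightarrow> repr ls w \<in> H"
  and ip_repr: "w \<in> \<Omega> \<Longrightarrow> f \<in> H \<Longrightarrow> ip f (repr ls w) = foldr dz ls (\<lambda>z. f z ()) w"
proof -
  have "repr ls w \<in> H \<and> (\<forall>f\<in>H. foldr dz ls (\<lambda>z. f z ()) w = ip f (repr ls w))" if "w \<in> \<Omega>"
  proof -
    have "\<exists>g. g \<in> H \<and> (\<forall>f\<in>H. foldr dz ls (\<lambda>z. f z ()) w = ip f g)"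
      using derivative_representable[OF that] by blast
    from someI_ex[OF this] show ?thesis unfolding repr_def .
  qed
  then show "w \<in> \<Omega> \<Longrightarrow> repr ls w \<in> H"
    and "w \<in> \<Omega> \<Longrightarrow> f \<in> H \<Longrightarrow> ip f (repr ls w) = foldr dz ls (\<lambda>z. f z ()) w" by auto
qed

lemma repr_Nil: "w \<in> \<Omega> \<Longrightarrow> repr [] w = point w"
  by (rule eq_if_ip_eq) (auto simp: repr_mem point_mem ip_repr ip_point)

text \<open>
  Each function has bounded derivatives on a compact ball, so the representers are pointwise bounded there
  as functionals, and uniform boundedness applies.
\<close>

lemma repr_locally_bounded:
  assumes "z \<in> \<Omega>"
  shows "\<exists>r>0. ball z r \<subseteq> \<Omega> \<and> (\<exists>C. \<forall>x\<in>ball z r. hnorm ip (repr ls x) \<le> C)"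
proof -
  obtain r where r: "r > 0" "cball z r \<subseteq> \<Omega>" using open_domain assms open_contains_cball by blast
  have "\<exists>C. \<forall>g\<in>repr ls ` cball z r. hnorm ip g \<le> C"
  proof (rule uniform_boundedness)
    show "repr ls ` cball z r \<subseteq> H" using r repr_mem by blast
    fix f assume f: "f \<in> H"
    have "continuous_on (cball z r) (foldr dz ls (\<lambda>z. f z ()))"
      using holomorphic_several_continuous[OF hol_deriv[OF f]] r(2)
      by (intro continuous_at_imp_continuous_on) blast
    then have "bounded (foldr dz ls (\<lambda>z. f z ()) ` cball z r)"
      by (intro compact_imp_bounded compact_continuous_image compact_cball)
    then obtain C where "\<And>x. x \<in> cball z r \<Longrightarrow> cmod (foldr dz ls (\<lambda>z. f z ()) x) \<le> C"
      unfolding bounded_iff by blast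
    then show "\<exists>C. \<forall>g\<in>repr ls ` cball z r. cmod (ip f g) \<le> C"
      using r(2) ip_repr[OF _ f] by (intro exI[of _ C]) (auto simp: subset_iff)
  qed
  then obtain C where C: "\<forall>g\<in>repr ls ` cball z r. hnorm ip g \<le> C" by blast
  have "ball z r \<subseteq> \<Omega>" "\<forall>x\<in>ball z r. hnorm ip (repr ls x) \<le> C" using r C by auto
  then show ?thesis using r(1) by blast
qed

lemma foldr_dzbar_kernel:
  assumes "z \<in> \<Omega>" "w \<in> \<Omega>"
  shows "foldr dzbar ls (\<lambda>w'. K z w') w = repr ls w z ()"
proof -
  have eq: "point z w' () = cnj (K z w')" if "w' \<in> \<Omega>" for w'
    using that assms(1) kernel_cnj[of z w'] by (simp add: point_apply)
  have "holomorphic_several (\<lambda>w'. cnj (K z w')) \<Omega>"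
    by (rule holomorphic_several_cong[OF open_domain eq hol[OF point_mem[OF assms(1)]]])
  then have "foldr dzbar ls (\<lambda>w'. K z w') w = cnj (foldr dz ls (\<lambda>w'. cnj (K z w')) w)"
    by (rule foldr_dzbar[OF open_domain _ assms(2)])
  also have "foldr dz ls (\<lambda>w'. cnj (K z w')) w = foldr dz ls (\<lambda>w'. point z w' ()) w"
    by (rule foldr_dz_cong[OF open_domain _ assms(2)]) (simp add: eq)
  also have "\<dots> = ip (point z) (repr ls w)"
    by (simp add: ip_repr assms point_mem)
  also have "cnj \<dots> = repr ls w z ()"
    by (simp add: ip_point_left assms repr_mem)
  finally show ?thesis .
qed

lemma mixed_derivative_kernel:
  assumes "z \<in> \<Omega>" "w \<in> \<Omega>"
  shows "foldr dz ks (\<lambda>z'. foldr dzbar ls (\<lambda>w'. K z' w') w) z = ip (repr ls w) (repr ks z)"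
proof -
  have "foldr dz ks (\<lambda>z'. foldr dzbar ls (\<lambda>w'. K z' w') w) z = foldr dz ks (\<lambda>z'. repr ls w z' ()) z"
    by (rule foldr_dz_cong[OF open_domain _ assms(1)]) (rule foldr_dzbar_kernel[OF _ assms(2)])
  also have "\<dots> = ip (repr ls w) (repr ks z)"
    by (simp add: ip_repr assms repr_mem)
  finally show ?thesis .
qed

definition smul :: "complex ^ 'm \<Rightarrow> 'm multiset \<Rightarrow> ('m, unit) vfun \<Rightarrow> ('m, unit) vfun" where
  "smul w B f = (\<lambda>z i. shifted_monomial w B z * f z i)"

lemma smul_empty: "smul w {#} f = f"
  by (simp add: smul_def)

lemma smul_add_mset: "smul w (add_mset b B) f = mult_op b (smul w B f) - fscale (w $ b) (smul w B f)"
  by (simp add: smul_def mult_op_def fun_eq_iff algebra_simps)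

lemma smul_add_mset': "smul w (add_mset b B) f = smul w B (mult_op b f - fscale (w $ b) f)"
  by (simp add: smul_def mult_op_def fun_eq_iff algebra_simps)

lemma mult_op_mem: "f \<in> H \<Longrightarrow> mult_op l f \<in> H"
  using mult_bounded by (simp add: bounded_operator_def)

lemma smul_mem: "f \<in> H \<Longrightarrow> smul w B f \<in> H"
  by (induction B) (simp_all only: smul_empty smul_add_mset diff_mem mult_op_mem scale_mem)

lemma smul_adjoint_exists: "g \<in> H \<Longrightarrow> \<exists>g'\<in>H. \<forall>v\<in>H. ip (smul w B v) g = ip v g'"
proof (induction B arbitrary: g)
  case empty
  then show ?case by (auto simp: smul_empty)
next
  case (add b B)
  obtain g1 where g1: "g1 \<in> H" "\<And>f. f \<in> H \<Longrightarrow> ip (mult_op b f - fscale (w $ b) f) g = ip f g1"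
    using adjoint_exists[OF bounded_operator_shift[OF mult_bounded] add.prems] by blast
  obtain g2 where "g2 \<in> H" "\<And>v. v \<in> H \<Longrightarrow> ip (smul w B v) g1 = ip v g2" using add.IH[OF g1(1)] by blast
  moreover have "ip (smul w (add_mset b B) v) g = ip (smul w B v) g1" if "v \<in> H" for v
    unfolding smul_add_mset by (rule g1(2)[OF smul_mem[OF that]])
  ultimately show ?case by (intro bexI[of _ g2]) auto
qed

lemma derivative_smul:
  assumes "w \<in> \<Omega>" "length ls \<le> size B"
  shows "\<exists>c::nat. (\<forall>v\<in>H. foldr dz ls (\<lambda>z. smul w B v z ()) w = of_nat c * v w ()) \<and> (c \<noteq> 0 \<longleftrightarrow> mset ls = B)"
proof -
  obtain c :: nat where c: "\<And>h. holomorphic_several h \<Omega> \<Longrightarrow>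
      foldr dz ls (\<lambda>z. shifted_monomial w B z * h z) w = of_nat c * h w" "c \<noteq> 0 \<longleftrightarrow> mset ls = B"
    using foldr_dz_shifted_monomial[OF open_domain assms] by blast
  show ?thesis using c(2) c(1)[OF hol] by (intro exI[of _ c]) (simp add: smul_def)
qed

text \<open>
  Induction on \<open>n\<close>. Products of \<open>n - 1\<close> of the operators \<open>(M\<^sub>l - w\<^sub>l)\<^sup>*\<close> map a vector killed by all products of
  \<open>n\<close> of them into the joint kernel, that is, to multiples of the kernel function. The derivative representers
  of order \<open>n - 1\<close> can produce any such multiples, independently for each product; subtracting the right
  combination of them leaves a vector killed by all products of \<open>n - 1\<close> operators.
\<close>

lemma generalized_joint_kernel:
  assumes w: "w \<in> \<Omega>"
  shows "g \<in> H \<Longrightarrow> (\<And>B v. size B = n \<Longrightarrow> v \<in> H \<Longrightarrow> ip (smul w B v) g = 0) \<Longrightarrow>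
    \<exists>\<eta>. \<forall>v\<in>H. ip v g = (\<Sum>j | length (index_list j) < n. \<eta> j * foldr dz (index_list j) (\<lambda>z. v z ()) w)"
proof (induction n arbitrary: g)
  case 0
  have "ip v g = 0" if "v \<in> H" for v using "0.prems"(2)[of "{#}" v] that by (simp add: smul_empty)
  then show ?case by simp
next
  case (Suc n)
  define J where "J = {j :: 'm \<Rightarrow> nat. length (index_list j) = n}"
  define D where "D j v = foldr dz (index_list j) (\<lambda>z. v z ()) w" for j and v :: "('m, unit) vfun"
  have finJ: "finite J"
    by (rule finite_subset[OF _ finite_multi_indices[of n]]) (auto simp: J_def multi_indices_alt)
  have finL: "finite {j :: 'm \<Rightarrow> nat. length (index_list j) < n}"
    by (rule finite_subset[OF _ finite_multi_indices[of n]]) (auto simp: multi_indices_alt)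
  have ex_c: "\<exists>c. \<forall>v\<in>H. ip (smul w B v) g = c * v w ()" if B: "size B = n" for B
  proof -
    obtain g' where g': "g' \<in> H" "\<And>v. v \<in> H \<Longrightarrow> ip (smul w B v) g = ip v g'"
      using smul_adjoint_exists[OF Suc.prems(1)] by blast
    have "ip (mult_op l f - fscale (w $ l) f) g' = 0" if f: "f \<in> H" for l f
    proof -
      have "mult_op l f - fscale (w $ l) f \<in> H" by (intro diff_mem mult_op_mem scale_mem f)
      then have "ip (mult_op l f - fscale (w $ l) f) g' = ip (smul w (add_mset l B) f) g"
        by (simp only: g'(2)[symmetric] smul_add_mset')
      then show ?thesis using Suc.prems(2)[of "add_mset l B" f] B f by simp
    qed
    from joint_kernel[OF w g'(1) this] show ?thesis using g'(2) by simp
  qed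
  have "\<forall>j\<in>J. \<exists>c. \<forall>v\<in>H. ip (smul w (mset (index_list j)) v) g = c * v w ()"
    using ex_c by (simp add: J_def)
  then obtain c where c: "\<And>j v. j \<in> J \<Longrightarrow> v \<in> H \<Longrightarrow> ip (smul w (mset (index_list j)) v) g = c j * v w ()"
    by metis
  have "\<forall>j\<in>J. \<exists>N::nat. N \<noteq> 0 \<and> (\<forall>v\<in>H. D j (smul w (mset (index_list j)) v) = of_nat N * v w ())"
    using derivative_smul[OF w, of "index_list _" "mset (index_list _)"] unfolding D_def by (metis size_mset order_refl)
  then obtain N :: "_ \<Rightarrow> nat" where N: "\<And>j. j \<in> J \<Longrightarrow> N j \<noteq> 0"
    "\<And>j v. j \<in> J \<Longrightarrow> v \<in> H \<Longrightarrow> D j (smul w (mset (index_list j)) v) = of_nat (N j) * v w ()" by metis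
  have off: "D j (smul w (mset (index_list j')) v) = 0" if j: "j \<in> J" "j' \<in> J" "j \<noteq> j'" and v: "v \<in> H" for j j' v
  proof -
    have "length (index_list j) \<le> size (mset (index_list j'))" using j by (simp add: J_def)
    then obtain c' :: nat where "\<forall>v\<in>H. D j (smul w (mset (index_list j')) v) = of_nat c' * v w ()"
      "c' \<noteq> 0 \<longleftrightarrow> mset (index_list j) = mset (index_list j')"
      using derivative_smul[OF w] unfolding D_def by blast
    then show ?thesis using j(3) v by (simp add: mset_index_list_eq_iff)
  qed
  (* on the monomial with index j only the derivative with index j is nonzero, and it is N j there *)
  define a where "a j = c j / of_nat (N j)" for j
  define g' where "g' = g - (\<Sum>j\<in>J. fscale (cnj (a j)) (repr (index_list j) w))"
  have sH: "(\<Sum>j\<in>J. fscale (cnj (a j)) (repr (index_list j) w)) \<in> H"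
    by (intro sum_mem scale_mem repr_mem w)
  have g'H: "g' \<in> H" unfolding g'_def by (intro diff_mem Suc.prems(1) sH)
  have ipg': "ip v g' = ip v g - (\<Sum>j\<in>J. a j * D j v)" if v: "v \<in> H" for v
  proof -
    have "ip v (\<Sum>j\<in>J. fscale (cnj (a j)) (repr (index_list j) w))
        = (\<Sum>j\<in>J. ip v (fscale (cnj (a j)) (repr (index_list j) w)))"
      by (intro ip_sum_right scale_mem repr_mem w v)
    also have "\<dots> = (\<Sum>j\<in>J. a j * D j v)"
      by (intro sum.cong refl) (simp add: ip_scale_right v repr_mem w ip_repr D_def)
    finally show ?thesis unfolding g'_def ip_diff_right[OF Suc.prems(1) sH v] by simp
  qed
  have "ip (smul w B v) g' = 0" if B: "size B = n" and v: "v \<in> H" for B v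
  proof -
    define j0 where "j0 = count B"
    have B_eq: "mset (index_list j0) = B" by (simp add: j0_def mset_index_list_count)
    then have j0: "j0 \<in> J" using B unfolding J_def by (metis size_mset mem_Collect_eq)
    have "(\<Sum>j\<in>J. a j * D j (smul w B v)) = (\<Sum>j\<in>J. if j = j0 then c j0 * v w () else 0)"
    proof (rule sum.cong[OF refl])
      fix j assume j: "j \<in> J"
      show "a j * D j (smul w B v) = (if j = j0 then c j0 * v w () else 0)"
        using N(1)[OF j0] N(2)[OF j0 v] off[OF j j0 _ v] by (auto simp: B_eq a_def)
    qed
    also have "\<dots> = c j0 * v w ()" using finJ j0 by simp
    finally show ?thesis
      using ipg'[OF smul_mem[OF v]] c[OF j0 v] by (simp add: B_eq)
  qed
  from Suc.IH[OF g'H this] obtain \<eta> where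
    \<eta>: "\<And>v. v \<in> H \<Longrightarrow> ip v g' = (\<Sum>j | length (index_list j) < n. \<eta> j * D j v)"
    unfolding D_def by blast
  define \<eta>' where "\<eta>' j = (if j \<in> J then a j else \<eta> j)" for j
  have "ip v g = (\<Sum>j | length (index_list j) < Suc n. \<eta>' j * D j v)" if v: "v \<in> H" for v
  proof -
    have "{j :: 'm \<Rightarrow> nat. length (index_list j) < Suc n} = {j. length (index_list j) < n} \<union> J"
      by (auto simp: J_def)
    then have "(\<Sum>j | length (index_list j) < Suc n. \<eta>' j * D j v)
        = (\<Sum>j | length (index_list j) < n. \<eta>' j * D j v) + (\<Sum>j\<in>J. \<eta>' j * D j v)"
      using finJ finL by (simp add: sum.union_disjoint J_def disjoint_iff)
    also have "(\<Sum>j | length (index_list j) < n. \<eta>' j * D j v) = ip v g'"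
      unfolding \<eta>[OF v] by (intro sum.cong) (auto simp: \<eta>'_def J_def)
    also have "(\<Sum>j\<in>J. \<eta>' j * D j v) = (\<Sum>j\<in>J. a j * D j v)"
      by (intro sum.cong) (auto simp: \<eta>'_def)
    finally show ?thesis using ipg'[OF v] by simp
  qed
  then show ?case unfolding D_def by blast
qed

text \<open>
  Multiplying by \<open>z\<^sub>l - p\<^sub>l\<close>, where \<open>p\<close> and \<open>q\<close> differ in the coordinate \<open>l\<close>, creates a zero at \<open>p\<close> and keeps
  the value at \<open>q\<close> nonzero.
\<close>

lemma separating_function:
  assumes "finite Z" "Z \<subseteq> \<Omega>" "q \<in> \<Omega>" "q \<notin> Z"
  shows "\<exists>f\<in>H. f q () \<noteq> 0 \<and> (\<forall>p\<in>Z. f p () = 0)"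
  using assms
proof (induction Z)
  case empty
  then show ?case using point_mem point_apply diagonal by (intro bexI[of _ "point q"]) auto
next
  case (insert p Z)
  then obtain f where f: "f \<in> H" "f q () \<noteq> 0" "\<And>p. p \<in> Z \<Longrightarrow> f p () = 0" by auto
  obtain l where l: "q $ l \<noteq> p $ l" using insert.prems by (auto simp: vec_eq_iff)
  have "mult_op l f - fscale (p $ l) f \<in> H" by (intro diff_mem mult_op_mem scale_mem f)
  moreover have "(mult_op l f - fscale (p $ l) f) x () = (x $ l - p $ l) * f x ()" for x
    by (simp add: mult_op_def algebra_simps)
  ultimately show ?case using f l by (intro bexI[of _ "mult_op l f - fscale (p $ l) f"]) auto
qed

end

section \<open>The jet kernel\<close>

locale jet_kernel =
  A: scalar_rkhs H1 ip1 \<Omega> K1 + B: scalar_rkhs H2 ip2 \<Omega> K2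
  for H1 :: "('m::finite, unit) vfun set" and ip1 and H2 :: "('m, unit) vfun set" and ip2
    and \<Omega> and K1 and K2 +
  fixes k :: nat
begin

sublocale T: hilbert_tensor H1 ip1 H2 ip2 ..

abbreviation I :: "('m \<Rightarrow> nat) set" where "I \<equiv> multi_indices k"

abbreviation J :: "('m, 'm \<Rightarrow> nat) kernel" where "J \<equiv> J_res K1 K2"

definition \<kappa> :: "('m \<Rightarrow> nat) \<Rightarrow> complex ^ 'm \<Rightarrow> ('m, unit) vfun" where
  "\<kappa> j w = B.repr (index_list j) w"

text \<open>
  The jet kernel satisfies \<open>J(\<cdot>,w)\<eta> = K1(\<cdot>,w) \<sqdot> jet (\<xi> w \<eta>)\<close>, so \<open>K1(\<cdot>,w) \<otimes> \<xi> w \<eta>\<close> is the tensor behind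
  the pair \<open>(w, \<eta>)\<close>.
\<close>

definition \<xi> :: "complex ^ 'm \<Rightarrow> (('m \<Rightarrow> nat) \<Rightarrow> complex) \<Rightarrow> ('m, unit) vfun" where
  "\<xi> w \<eta> = (\<Sum>j\<in>I. fscale (\<eta> j) (\<kappa> j w))"

definition D :: "('m \<Rightarrow> nat) \<Rightarrow> ('m, unit) vfun \<Rightarrow> complex ^ 'm \<Rightarrow> complex" where
  "D j v w = foldr dz (index_list j) (\<lambda>z. v z ()) w"

lemma \<kappa>_mem: "w \<in> \<Omega> \<Longrightarrow> \<kappa> j w \<in> H2"
  by (simp add: \<kappa>_def B.repr_mem)

lemma ip_\<kappa>: "w \<in> \<Omega> \<Longrightarrow> v \<in> H2 \<Longrightarrow> ip2 v (\<kappa> j w) = D j v w"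
  by (simp add: \<kappa>_def D_def B.ip_repr)

lemma \<xi>_mem: "w \<in> \<Omega> \<Longrightarrow> \<xi> w \<eta> \<in> H2"
  unfolding \<xi>_def by (intro B.sum_mem B.scale_mem \<kappa>_mem)

lemma ip_\<xi>_left: "w \<in> \<Omega> \<Longrightarrow> g \<in> H2 \<Longrightarrow> ip2 (\<xi> w \<eta>) g = (\<Sum>j\<in>I. \<eta> j * ip2 (\<kappa> j w) g)"
proof -
  assume w: "w \<in> \<Omega>" and g: "g \<in> H2"
  have "ip2 (\<xi> w \<eta>) g = (\<Sum>j\<in>I. ip2 (fscale (\<eta> j) (\<kappa> j w)) g)"
    unfolding \<xi>_def by (intro B.ip_sum B.scale_mem \<kappa>_mem w g)
  then show ?thesis by (simp add: B.ip_scale \<kappa>_mem w g)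
qed

lemma J_eq:
  assumes "z \<in> \<Omega>" "w \<in> \<Omega>"
  shows "J z w i j = K1 z w * ip2 (\<kappa> j w) (\<kappa> i z)"
  unfolding J_res_def multi_deriv_eq_foldr \<kappa>_def B.mixed_derivative_kernel[OF assms] ..

lemma J_inner:
  assumes "z \<in> \<Omega>" "w \<in> \<Omega>"
  shows "cvec_inner I (mat_app I (J z w) \<eta>) \<zeta>
    = ip1 (A.point w) (A.point z) * ip2 (\<xi> w \<eta>) (\<xi> z \<zeta>)"
proof -
  have "ip2 (\<xi> w \<eta>) (\<xi> z \<zeta>) = (\<Sum>i\<in>I. ip2 (\<xi> w \<eta>) (fscale (\<zeta> i) (\<kappa> i z)))"
    unfolding \<xi>_def[of z] by (intro B.ip_sum_right B.scale_mem \<kappa>_mem \<xi>_mem assms)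
  also have "\<dots> = (\<Sum>i\<in>I. cnj (\<zeta> i) * (\<Sum>j\<in>I. \<eta> j * ip2 (\<kappa> j w) (\<kappa> i z)))"
    by (intro sum.cong refl) (simp add: B.ip_scale_right ip_\<xi>_left \<kappa>_mem \<xi>_mem assms)
  finally show ?thesis
    using assms
    by (simp add: cvec_inner_def mat_app_def J_eq A.ip_point_point sum_distrib_left sum_distrib_right
        mult.assoc mult.commute mult.left_commute)
qed

definition tens :: "((complex ^ 'm) \<times> (('m \<Rightarrow> nat) \<Rightarrow> complex)) list \<Rightarrow> _ list" where
  "tens cs = map (\<lambda>(w, \<eta>). (A.point w, \<xi> w \<eta>)) cs"

lemma tens_mem: "set cs \<subseteq> \<Omega> \<times> cvec I \<Longrightarrow> set (tens cs) \<subseteq> H1 \<times> H2"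
  by (auto simp: tens_def A.point_mem \<xi>_mem)

lemma J_sum_eq:
  assumes cs: "set cs \<subseteq> \<Omega> \<times> cvec I"
  shows "(\<Sum>(w, \<eta>)\<leftarrow>cs. \<Sum>(z, \<zeta>)\<leftarrow>cs. cvec_inner I (mat_app I (J z w) \<eta>) \<zeta>) = T.tensor_ip (tens cs) (tens cs)"
proof -
  have "(\<Sum>(w, \<eta>)\<leftarrow>as. \<Sum>(z, \<zeta>)\<leftarrow>bs. cvec_inner I (mat_app I (J z w) \<eta>) \<zeta>)
      = (\<Sum>(u, x)\<leftarrow>tens as. \<Sum>(v, y)\<leftarrow>tens bs. ip1 u v * ip2 x y)"
    if "set as \<subseteq> \<Omega> \<times> cvec I" "set bs \<subseteq> \<Omega> \<times> cvec I" for as bs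
  proof -
    have inner: "(\<Sum>(z, \<zeta>)\<leftarrow>bs. cvec_inner I (mat_app I (J z w) \<eta>) \<zeta>)
        = (\<Sum>(v, y)\<leftarrow>tens bs. ip1 (A.point w) v * ip2 (\<xi> w \<eta>) y)" if "w \<in> \<Omega>" for w \<eta>
      using \<open>set bs \<subseteq> \<Omega> \<times> cvec I\<close> that
      by (induction bs) (auto simp: tens_def J_inner)
    show ?thesis
      using \<open>set as \<subseteq> \<Omega> \<times> cvec I\<close>
    proof (induction as)
      case (Cons a as)
      obtain w \<eta> where a: "a = (w, \<eta>)" "w \<in> \<Omega>" using Cons.prems by auto
      have "tens (a # as) = (A.point w, \<xi> w \<eta>) # tens as" by (simp add: tens_def a)
      then show ?case using Cons inner[OF a(2)] by (simp add: a(1))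
    qed (simp add: tens_def)
  qed
  from this[OF cs cs] show ?thesis by (simp only: T.tensor_ip_def)
qed

lemma J_hermitian:
  assumes "z \<in> \<Omega>" "w \<in> \<Omega>"
  shows "J w z j i = cnj (J z w i j)"
  using A.kernel_cnj[OF assms] B.ip_cnj[OF \<kappa>_mem[OF assms(2)] \<kappa>_mem[OF assms(1)]]
  by (simp add: J_eq assms)

sublocale N: nonneg_kernel \<Omega> I J
proof
  show "finite I" by (rule finite_multi_indices)
  show "J w z j i = cnj (J z w i j)" if "z \<in> \<Omega>" "w \<in> \<Omega>" for z w i j
    by (rule J_hermitian[OF that])
  show "0 \<le> Re (\<Sum>(w, \<eta>)\<leftarrow>cs. \<Sum>(z, \<zeta>)\<leftarrow>cs. cvec_inner I (mat_app I (J z w) \<eta>) \<zeta>)"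
    if "set cs \<subseteq> \<Omega> \<times> cvec I" for cs
    unfolding J_sum_eq[OF that] by (rule T.tensor_ip_nonneg[OF tens_mem[OF that]])
qed

lemma pairing_comb_eq_tensor_ip: "N.valid cs \<Longrightarrow> N.pairing (N.comb cs) cs = T.tensor_ip (tens cs) (tens cs)"
  by (simp only: N.pairing_comb J_sum_eq)

lemma comb_norm_eq: "N.valid cs \<Longrightarrow> N.comb_norm cs = sqrt (Re (T.tensor_ip (tens cs) (tens cs)))"
  by (simp only: N.comb_norm_def pairing_comb_eq_tensor_ip)

lemma J_holomorphic:
  assumes w: "w \<in> \<Omega>"
  shows "holomorphic_several (\<lambda>z. J z w i j) \<Omega>"
proof (rule holomorphic_several_cong[OF A.open_domain])
  show "holomorphic_several (\<lambda>z. A.point w z () * D i (\<kappa> j w) z) \<Omega>"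
    unfolding D_def
    by (intro holomorphic_several_mult A.hol A.point_mem B.hol_deriv[unfolded eta_contract_eq] \<kappa>_mem w)
  fix z assume z: "z \<in> \<Omega>"
  show "A.point w z () * D i (\<kappa> j w) z = J z w i j"
    using z w by (simp add: J_eq A.point_apply ip_\<kappa> \<kappa>_mem)
qed

lemma J_sesqui_analytic: "sesqui_analytic \<Omega> I J"
  unfolding sesqui_analytic_def antiholomorphic_several_iff
proof (intro ballI conjI)
  fix i j w assume w: "w \<in> \<Omega>"
  show "holomorphic_several (\<lambda>z. J z w i j) \<Omega>" by (rule J_holomorphic[OF w])
  show "holomorphic_several (\<lambda>z. cnj (J w z i j)) \<Omega>"
    by (rule holomorphic_several_cong[OF A.open_domain _ J_holomorphic[OF w, of j i]])
      (rule J_hermitian[OF w])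
qed

text \<open>
  The diagonal entries are \<open>\<parallel>K1(\<cdot>,x)\<parallel>\<^sup>2 \<parallel>\<kappa> i x\<parallel>\<^sup>2\<close>.
\<close>

lemma J_locally_bounded:
  assumes z: "z \<in> \<Omega>"
  shows "\<exists>r>0. ball z r \<subseteq> \<Omega> \<and> (\<exists>C. \<forall>x\<in>ball z r. Re (J x x i i) \<le> C)"
proof -
  obtain r1 C1 where r1: "r1 > 0" "ball z r1 \<subseteq> \<Omega>" "\<And>x. x \<in> ball z r1 \<Longrightarrow> hnorm ip1 (A.repr [] x) \<le> C1"
    using A.repr_locally_bounded[OF z, of "[]"] by blast
  obtain r2 C2 where r2: "r2 > 0" "\<And>x. x \<in> ball z r2 \<Longrightarrow> hnorm ip2 (\<kappa> i x) \<le> C2"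
    using B.repr_locally_bounded[OF z, of "index_list i"] unfolding \<kappa>_def by blast
  define r where "r = min r1 r2"
  have "Re (J x x i i) \<le> C1\<^sup>2 * C2\<^sup>2" if x: "x \<in> ball z r" for x
  proof -
    have x12: "x \<in> ball z r1" "x \<in> ball z r2" using x by (simp_all add: r_def)
    have xO: "x \<in> \<Omega>" using x12(1) r1(2) by blast
    have n: "hnorm ip1 (A.point x) \<le> C1" "hnorm ip2 (\<kappa> i x) \<le> C2"
      using r1(3)[OF x12(1)] r2(2)[OF x12(2)] by (simp_all only: A.repr_Nil[OF xO])
    have "J x x i i = of_real ((hnorm ip1 (A.point x))\<^sup>2 * (hnorm ip2 (\<kappa> i x))\<^sup>2)"
      using xO by (simp add: J_eq A.ip_point_point[symmetric] A.ip_self B.ip_self A.point_mem \<kappa>_mem)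
    then have "Re (J x x i i) = (hnorm ip1 (A.point x))\<^sup>2 * (hnorm ip2 (\<kappa> i x))\<^sup>2"
      by (simp only: Re_complex_of_real)
    also have "\<dots> \<le> C1\<^sup>2 * C2\<^sup>2"
      using n xO by (intro mult_mono power_mono) (auto simp: A.point_mem \<kappa>_mem)
    finally show ?thesis .
  qed
  moreover have "r > 0" "ball z r \<subseteq> \<Omega>" using r1 r2 by (auto simp: r_def)
  ultimately show ?thesis by blast
qed

lemma J_rkhs: "rkhs N.space N.space_ip \<Omega> I J"
  by (rule N.rkhs_space[OF A.open_domain J_holomorphic J_locally_bounded])

sublocale R: rkhs N.space N.space_ip \<Omega> I J
  by (rule J_rkhs)

text \<open>
  If the quadratic form vanished on nonzero data, so would every bilinear form on the corresponding
  tensor. Pairing with a function that separates one of the points and with a function whose jet at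
  that point is triangular with respect to the order of the derivatives excludes this.
\<close>

lemma J_positive_definite: "positive_definite_kernel \<Omega> I J"
  unfolding positive_definite_kernel_def
proof (intro allI impI)
  fix Z and \<eta> :: "complex ^ 'm \<Rightarrow> ('m \<Rightarrow> nat) \<Rightarrow> complex"
  assume a: "finite Z \<and> Z \<subseteq> \<Omega> \<and> (\<forall>z\<in>Z. \<eta> z \<in> cvec I) \<and> (\<exists>z\<in>Z. \<eta> z \<noteq> 0)"
  define s where "s = (\<Sum>p\<in>Z. \<Sum>q\<in>Z. cvec_inner I (mat_app I (J p q) (\<eta> q)) (\<eta> p))"
  obtain zs where zs: "set zs = Z" "distinct zs" using finite_distinct_list a by blast
  define cs where "cs = map (\<lambda>z. (z, \<eta> z)) zs"
  have v: "N.valid cs" using a zs by (auto simp: cs_def)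
  have "s = (\<Sum>q\<in>Z. \<Sum>p\<in>Z. cvec_inner I (mat_app I (J p q) (\<eta> q)) (\<eta> p))"
    unfolding s_def by (rule sum.swap)
  also have "\<dots> = (\<Sum>(w, \<eta>)\<leftarrow>cs. \<Sum>(z, \<zeta>)\<leftarrow>cs. cvec_inner I (mat_app I (J z w) \<eta>) \<zeta>)"
    using zs by (simp add: cs_def comp_def sum_list_distinct_conv_sum_set)
  also have "\<dots> = T.tensor_ip (tens cs) (tens cs)" by (rule J_sum_eq[OF v])
  finally have s: "s = T.tensor_ip (tens cs) (tens cs)" .
  have real: "s \<in> \<real>"
    using N.pairing_comb_self[OF v] unfolding s pairing_comb_eq_tensor_ip[OF v] by (metis Reals_of_real)
  have "Re s \<noteq> 0"
  proof
    assume "Re s = 0"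
    then have zero: "tensor_eval B (tens cs) = 0" if "bilinear_pairing H1 H2 B" for B
      using T.tensor_eval_eq_0[OF tens_mem[OF v] _ that] s by simp
    obtain q where q: "q \<in> Z" "\<eta> q \<noteq> 0" using a by blast
    have qO: "q \<in> \<Omega>" using q a by blast
    define S where "S = {j \<in> I. \<eta> q j \<noteq> 0}"
    have "finite S" by (simp add: S_def N.finite_index)
    moreover have "S \<noteq> {}" using q a by (auto simp: S_def cvec_def fun_eq_iff)
    ultimately have "Max ((\<lambda>j. length (index_list j)) ` S) \<in> (\<lambda>j. length (index_list j)) ` S"
      by (intro Max_in) auto
    then obtain j0 where j0: "j0 \<in> S" and m: "Max ((\<lambda>j. length (index_list j)) ` S) = length (index_list j0)"
      by (rule imageE)
    have max: "length (index_list j) \<le> length (index_list j0)" if "j \<in> S" for j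
      unfolding m[symmetric] using \<open>finite S\<close> that by (intro Max_ge) auto
    obtain f where f: "f \<in> H1" "f q () \<noteq> 0" "\<And>p. p \<in> Z - {q} \<Longrightarrow> f p () = 0"
      using A.separating_function[of "Z - {q}" q] a qO by blast
    (* derivatives of order at most that of j0, other than the one with index j0, vanish at q *)
    define g where "g = B.smul q (mset (index_list j0)) (B.point q)"
    have gH: "g \<in> H2" unfolding g_def by (intro B.smul_mem B.point_mem qO)
    have Dg: "D j g q = 0" if j: "j \<in> S" "j \<noteq> j0" for j
    proof -
      obtain c :: nat where "D j g q = of_nat c * B.point q q ()"
        "c \<noteq> 0 \<longleftrightarrow> mset (index_list j) = mset (index_list j0)"
        using B.derivative_smul[OF qO, of "index_list j" "mset (index_list j0)"] max[OF j(1)]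
          B.point_mem[OF qO] unfolding D_def g_def by auto
      then show ?thesis using j(2) by (simp add: mset_index_list_eq_iff)
    qed
    have Dg0: "D j0 g q \<noteq> 0"
    proof -
      obtain c :: nat where "D j0 g q = of_nat c * B.point q q ()" "c \<noteq> 0"
        using B.derivative_smul[OF qO, of "index_list j0" "mset (index_list j0)"]
          B.point_mem[OF qO] unfolding D_def g_def by auto
      then show ?thesis using B.diagonal[OF qO] by (simp add: B.point_apply qO)
    qed
    have summand: "ip1 (A.point p) f * ip2 (\<xi> p (\<eta> p)) g = (if p = q then cnj (f q ()) * (\<eta> q j0 * cnj (D j0 g q)) else 0)"
      if p: "p \<in> Z" for p
    proof (cases "p = q")
      case False
      then show ?thesis using f(3)[of p] p a by (auto simp: A.ip_point_left f(1))
    next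
      case True
      have "ip2 (\<kappa> j q) g = cnj (D j g q)" for j
        using B.ip_cnj[OF gH \<kappa>_mem[OF qO]] ip_\<kappa>[OF qO gH] by simp
      then have "ip2 (\<xi> q (\<eta> q)) g = (\<Sum>j\<in>I. \<eta> q j * cnj (D j g q))"
        by (simp add: ip_\<xi>_left qO gH)
      also have "\<dots> = (\<Sum>j\<in>I. if j = j0 then \<eta> q j0 * cnj (D j0 g q) else 0)"
        using Dg by (intro sum.cong refl) (auto simp: S_def)
      also have "\<dots> = \<eta> q j0 * cnj (D j0 g q)"
        using j0 N.finite_index by (simp add: S_def)
      finally show ?thesis using True by (simp add: A.ip_point_left f(1) qO)
    qed
    have "tensor_eval (\<lambda>u x. ip1 u f * ip2 x g) (tens cs)
        = (\<Sum>p\<in>Z. ip1 (A.point p) f * ip2 (\<xi> p (\<eta> p)) g)"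
      using zs by (simp add: tensor_eval_def tens_def cs_def comp_def sum_list_distinct_conv_sum_set)
    also have "\<dots> = (\<Sum>p\<in>Z. if p = q then cnj (f q ()) * (\<eta> q j0 * cnj (D j0 g q)) else 0)"
      by (rule sum.cong[OF refl summand])
    also have "\<dots> = cnj (f q ()) * (\<eta> q j0 * cnj (D j0 g q))"
      using q(1) a by simp
    finally have "cnj (f q ()) * (\<eta> q j0 * cnj (D j0 g q)) = 0"
      using T.tensor_eval_eq_0[OF tens_mem[OF v] _ T.bilinear_ip[OF f(1) gH]] \<open>Re s = 0\<close> s by simp
    then show False using f(2) Dg0 j0 by (simp add: S_def)
  qed
  moreover have "0 \<le> Re s" unfolding s by (rule T.tensor_ip_nonneg[OF tens_mem[OF v]])
  ultimately show "let s = \<Sum>p\<in>Z. \<Sum>q\<in>Z. cvec_inner I (mat_app I (J p q) (\<eta> q)) (\<eta> p) in s \<in> \<real> \<and> 0 < Re s"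
    using real unfolding Let_def s_def[symmetric] by simp
qed

subsection \<open>Multiplication operators\<close>

text \<open>
  On the tensor side multiplication by \<open>z\<^sub>l\<close> is \<open>M\<^sub>l \<otimes> 1\<close>, whose adjoint multiplies the first factor
  \<open>K1(\<cdot>,w)\<close> by the conjugate of \<open>w\<^sub>l\<close>.
\<close>

lemma mult_op_bound:
  obtains C where "C \<ge> 0" "\<And>f. f \<in> N.space \<Longrightarrow> mult_op l f \<in> N.space \<and> N.dual_norm (mult_op l f) \<le> C * N.dual_norm f"
proof -
  obtain A C where A: "\<And>g. g \<in> H1 \<Longrightarrow> A g \<in> H1"
    "\<And>f g. f \<in> H1 \<Longrightarrow> g \<in> H1 \<Longrightarrow> ip1 (mult_op l f) g = ip1 f (A g)"
    "\<And>g h. g \<in> H1 \<Longrightarrow> h \<in> H1 \<Longrightarrow> A (g + h) = A g + A h"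
    "\<And>g c. g \<in> H1 \<Longrightarrow> A (fscale c g) = fscale c (A g)"
    and C: "C \<ge> 0" "\<And>g. g \<in> H1 \<Longrightarrow> hnorm ip1 (A g) \<le> C * hnorm ip1 g"
    by (rule A.adjoint_operator[OF A.mult_bounded[of l]]) (rule that)
  have Apoint: "A (A.point w) = fscale (cnj (w $ l)) (A.point w)" if w: "w \<in> \<Omega>" for w
  proof (rule A.eq_if_ip_eq)
    fix f assume f: "f \<in> H1"
    have "ip1 f (A (A.point w)) = mult_op l f w ()"
      using A(2)[OF f A.point_mem[OF w]] A.ip_point[OF A.mult_op_mem[OF f] w] by simp
    then show "ip1 f (A (A.point w)) = ip1 f (fscale (cnj (w $ l)) (A.point w))"
      by (simp add: A.ip_scale_right f A.point_mem w A.ip_point mult_op_def)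
  qed (intro A(1) A.scale_mem A.point_mem w)+
  define sh :: "((complex ^ 'm) \<times> (('m \<Rightarrow> nat) \<Rightarrow> complex)) list \<Rightarrow> _" where
    "sh = map (\<lambda>(w, \<eta>). (w, \<lambda>i. cnj (w $ l) * \<eta> i))"
  have valid_sh: "N.valid (sh cs)" if "N.valid cs" for cs
    using that by (auto simp: sh_def cvec_cmult)
  have pairing_sh: "N.pairing (mult_op l f) cs = N.pairing f (sh cs)" for f cs
    by (induction cs) (auto simp: sh_def mult_op_def cvec_inner_cmult_left cvec_inner_cmult_right)
  have norm_sh: "N.comb_norm (sh cs) \<le> C * N.comb_norm cs" if v: "N.valid cs" for cs
  proof -
    let ?At = "map (\<lambda>(u, x). (A u, x)) (tens cs)"
    have AtH: "set ?At \<subseteq> H1 \<times> H2" using tens_mem[OF v] A(1) by auto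
    have "T.same_tensor (tens (sh cs)) ?At"
      unfolding T.same_tensor_def
    proof (intro conjI allI impI tens_mem valid_sh v AtH)
      fix B :: "('m, unit) vfun \<Rightarrow> ('m, unit) vfun \<Rightarrow> complex"
      assume B: "bilinear_pairing H1 H2 B"
      have one: "B (A.point w) (\<xi> w (\<lambda>i. cnj (w $ l) * \<eta> i)) = B (A (A.point w)) (\<xi> w \<eta>)"
        if w: "w \<in> \<Omega>" for w \<eta>
      proof -
        have "\<xi> w (\<lambda>i. cnj (w $ l) * \<eta> i) = fscale (cnj (w $ l)) (\<xi> w \<eta>)"
          by (simp only: \<xi>_def fscale_sum fscale_fscale)
        then show ?thesis
          using B A.point_mem[OF w] \<xi>_mem[OF w] by (simp add: Apoint[OF w] bilinear_pairing_def)
      qed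
      show "tensor_eval B (tens (sh cs)) = tensor_eval B ?At"
        using v by (induction cs) (auto simp: sh_def tens_def one)
    qed
    then have "Re (T.tensor_ip (tens (sh cs)) (tens (sh cs))) = Re (T.tensor_ip ?At ?At)"
      by (simp add: T.tensor_ip_same)
    also have "\<dots> \<le> C\<^sup>2 * Re (T.tensor_ip (tens cs) (tens cs))"
      by (intro T.tensor_ip_operator_bound tens_mem v A C)
    finally have "sqrt (Re (T.tensor_ip (tens (sh cs)) (tens (sh cs))))
        \<le> sqrt (C\<^sup>2 * Re (T.tensor_ip (tens cs) (tens cs)))"
      by (rule real_sqrt_le_mono)
    then show ?thesis
      using C(1) by (simp add: comb_norm_eq v valid_sh real_sqrt_mult)
  qed
  show ?thesis
  proof (rule that[OF C(1)])
    fix f assume f: "f \<in> N.space"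
    have b: "N.bound (mult_op l f) (C * N.dual_norm f)"
      unfolding N.bound_def
    proof (intro conjI allI impI)
      show "0 \<le> C * N.dual_norm f" using C(1) N.dual_norm_nonneg[OF f] by simp
      fix cs assume v: "N.valid cs"
      have "cmod (N.pairing (mult_op l f) cs) \<le> N.dual_norm f * N.comb_norm (sh cs)"
        unfolding pairing_sh by (rule N.pairing_le[OF f valid_sh[OF v]])
      also have "\<dots> \<le> N.dual_norm f * (C * N.comb_norm cs)"
        by (intro mult_left_mono norm_sh v N.dual_norm_nonneg f)
      finally show "cmod (N.pairing (mult_op l f) cs) \<le> C * N.dual_norm f * N.comb_norm cs"
        by (simp add: mult.commute mult.left_commute)
    qed
    moreover have "mult_op l f z = 0" if "z \<notin> \<Omega>" for z
      using N.space_outside[OF f that] by (simp add: mult_op_def fun_eq_iff)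
    moreover have "mult_op l f z \<in> cvec I" for z
      using N.space_cvec[OF f, of z] by (simp add: mult_op_def cvec_def)
    ultimately show "mult_op l f \<in> N.space \<and> N.dual_norm (mult_op l f) \<le> C * N.dual_norm f"
      using N.dual_norm_le[OF b] unfolding N.space_def by blast
  qed
qed

lemma mult_op_bounded: "bounded_operator N.space N.space_ip (mult_op l)"
proof -
  obtain C where C: "C \<ge> 0"
    "\<And>f. f \<in> N.space \<Longrightarrow> mult_op l f \<in> N.space \<and> N.dual_norm (mult_op l f) \<le> C * N.dual_norm f"
    by (rule mult_op_bound[of l]) (rule that)
  show ?thesis
    unfolding bounded_operator_def
  proof (intro conjI ballI allI exI)
    fix f assume f: "f \<in> N.space"
    show "mult_op l f \<in> N.space" using C(2)[OF f] by blast
    then show "hnorm N.space_ip (mult_op l f) \<le> C * hnorm N.space_ip f"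
      using C(2)[OF f] f by (simp add: N.hnorm_space_ip)
  qed (auto simp: mult_op_def fun_eq_iff algebra_simps)
qed

subsection \<open>Products of functions and jets\<close>

definition jet :: "('m, unit) vfun \<Rightarrow> ('m, unit) vfun \<Rightarrow> ('m, 'm \<Rightarrow> nat) vfun" where
  "jet u v = (\<lambda>z i. if z \<in> \<Omega> \<and> i \<in> I then u z () * D i v z else 0)"

lemma D_add: "v \<in> H2 \<Longrightarrow> v' \<in> H2 \<Longrightarrow> z \<in> \<Omega> \<Longrightarrow> D i (v + v') z = D i v z + D i v' z"
  using foldr_dz_add[OF A.open_domain B.hol B.hol] by (simp add: D_def)

lemma D_fscale: "v \<in> H2 \<Longrightarrow> z \<in> \<Omega> \<Longrightarrow> D i (fscale c v) z = c * D i v z"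
  using foldr_dz_cmult[OF A.open_domain B.hol] by (simp add: D_def)

text \<open>
  The jet map is a contraction: pairing the product of \<open>u\<close> and the jet of \<open>v\<close> with a combination of kernel
  sections amounts to the inner product of \<open>u \<otimes> v\<close> with the corresponding tensor.
\<close>

lemma jet_space:
  assumes u: "u \<in> H1" and v: "v \<in> H2"
  shows "jet u v \<in> N.space" "N.dual_norm (jet u v) \<le> hnorm ip1 u * hnorm ip2 v"
proof -
  have pair: "N.pairing (jet u v) cs = cnj (tensor_eval (\<lambda>a x. ip1 a u * ip2 x v) (tens cs))"
    if "N.valid cs" for cs
    using that
  proof (induction cs)
    case (Cons c cs)
    obtain w \<eta> where c: "c = (w, \<eta>)" "w \<in> \<Omega>" using Cons.prems by auto
    have "ip2 (\<kappa> j w) v = cnj (D j v w)" for j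
      using B.ip_cnj[OF v \<kappa>_mem[OF c(2)]] ip_\<kappa>[OF c(2) v] by simp
    then have "cnj (ip1 (A.point w) u * ip2 (\<xi> w \<eta>) v) = u w () * (\<Sum>j\<in>I. D j v w * cnj (\<eta> j))"
      by (simp add: A.ip_point_left u ip_\<xi>_left v c(2) mult.commute)
    also have "\<dots> = cvec_inner I (jet u v w) \<eta>"
      by (simp add: cvec_inner_def jet_def c(2) sum_distrib_left mult.assoc)
    finally show ?case using Cons by (simp add: c(1) tens_def)
  qed (simp add: tens_def)
  have b: "N.bound (jet u v) (hnorm ip1 u * hnorm ip2 v)"
    unfolding N.bound_def
  proof (intro conjI allI impI)
    show "0 \<le> hnorm ip1 u * hnorm ip2 v" using u v by simp
    fix cs assume "N.valid cs"
    then show "cmod (N.pairing (jet u v) cs) \<le> hnorm ip1 u * hnorm ip2 v * N.comb_norm cs"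
      using T.tensor_functional_bound[OF tens_mem u v, of cs] by (simp add: pair comb_norm_eq)
  qed
  then show "N.dual_norm (jet u v) \<le> hnorm ip1 u * hnorm ip2 v" by (rule N.dual_norm_le)
  have "jet u v z = 0" if "z \<notin> \<Omega>" for z using that by (simp add: jet_def fun_eq_iff)
  moreover have "jet u v z \<in> cvec I" for z by (simp add: jet_def cvec_def)
  ultimately show "jet u v \<in> N.space" using b unfolding N.space_def by blast
qed

lemma section_eq_jet:
  assumes w: "w \<in> \<Omega>"
  shows "kernel_section \<Omega> I J w \<eta> = jet (A.point w) (\<xi> w \<eta>)"
proof (intro ext)
  fix z i
  show "kernel_section \<Omega> I J w \<eta> z i = jet (A.point w) (\<xi> w \<eta>) z i"
  proof (cases "z \<in> \<Omega> \<and> i \<in> I")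
    case True
    then have "D i (\<xi> w \<eta>) z = (\<Sum>j\<in>I. \<eta> j * ip2 (\<kappa> j w) (\<kappa> i z))"
      using ip_\<kappa>[of z "\<xi> w \<eta>" i] ip_\<xi>_left[OF w, of "\<kappa> i z" \<eta>] by (simp add: \<xi>_mem w \<kappa>_mem)
    then show ?thesis
      using True w
      by (simp add: kernel_section_def mat_app_def jet_def J_eq A.point_apply sum_distrib_left
          mult.commute mult.left_commute)
  qed (auto simp: kernel_section_def mat_app_def jet_def)
qed

lemma mult_op_jet: "mult_op l (jet u v) = jet (mult_op l u) v"
  by (simp add: mult_op_def jet_def fun_eq_iff)

lemma jet_add_left: "jet (u + u') v = jet u v + jet u' v"
  by (simp add: jet_def fun_eq_iff algebra_simps)

lemma jet_fscale_left: "jet (fscale c u) v = fscale c (jet u v)"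
  by (simp add: jet_def fun_eq_iff)

lemma jet_diff_left: "jet (u - u') v = jet u v - jet u' v"
  by (simp add: jet_def fun_eq_iff algebra_simps)

lemma jet_add_right: "v \<in> H2 \<Longrightarrow> v' \<in> H2 \<Longrightarrow> jet u (v + v') = jet u v + jet u v'"
  by (simp add: jet_def fun_eq_iff D_add algebra_simps)

lemma jet_fscale_right: "v \<in> H2 \<Longrightarrow> jet u (fscale c v) = fscale c (jet u v)"
  by (simp add: jet_def fun_eq_iff D_fscale)

lemma space_ip_jet_le:
  assumes "u \<in> H1" "v \<in> H2" "f \<in> N.space"
  shows "cmod (N.space_ip (jet u v) f) \<le> hnorm ip1 u * hnorm ip2 v * N.dual_norm f"
proof -
  have "cmod (N.space_ip (jet u v) f) \<le> N.dual_norm (jet u v) * N.dual_norm f"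
    using R.cauchy_schwarz[OF jet_space(1)[OF assms(1,2)] assms(3)] jet_space(1)[OF assms(1,2)] assms(3)
    by (simp add: N.hnorm_space_ip)
  also have "\<dots> \<le> (hnorm ip1 u * hnorm ip2 v) * N.dual_norm f"
    by (intro mult_right_mono jet_space N.dual_norm_nonneg assms)
  finally show ?thesis .
qed

lemma bounded_functional_jet_left:
  assumes "v \<in> H2" "f \<in> N.space"
  shows "A.bounded_functional (\<lambda>u. N.space_ip (jet u v) f)"
  unfolding A.bounded_functional_def
proof (intro conjI ballI allI exI)
  fix u assume "u \<in> H1"
  from space_ip_jet_le[OF this assms]
  show "cmod (N.space_ip (jet u v) f) \<le> (hnorm ip2 v * N.dual_norm f) * hnorm ip1 u"
    by (simp add: ac_simps)
qed (use assms in \<open>simp_all add: jet_add_left jet_fscale_left R.ip_add R.ip_scale jet_space\<close>)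

lemma bounded_functional_jet_right:
  assumes "u \<in> H1" "f \<in> N.space"
  shows "B.bounded_functional (\<lambda>v. c * N.space_ip (jet u v) f)"
  unfolding B.bounded_functional_def
proof (intro conjI ballI allI exI)
  fix v assume "v \<in> H2"
  from mult_left_mono[OF space_ip_jet_le[OF assms(1) this assms(2)], of "cmod c"]
  show "cmod (c * N.space_ip (jet u v) f) \<le> (cmod c * hnorm ip1 u * N.dual_norm f) * hnorm ip2 v"
    by (simp add: norm_mult ac_simps)
qed (use assms in \<open>simp_all add: jet_add_right jet_fscale_right R.ip_add R.ip_scale jet_space algebra_simps\<close>)

text \<open>
  The function \<open>z \<mapsto> u(z) \<partial>\<^sup>i(\<Prod>\<^sub>b(\<zeta>\<^sub>b - z\<^sub>b) v(\<zeta>))\<close> at \<open>\<zeta> = z\<close>, the image of \<open>\<Prod>\<^sub>b(1 \<otimes> M\<^sub>b - M\<^sub>b \<otimes> 1)(u \<otimes> v)\<close>.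
\<close>

definition diagonal_jet :: "'m multiset \<Rightarrow> ('m, unit) vfun \<Rightarrow> ('m, unit) vfun \<Rightarrow> ('m, 'm \<Rightarrow> nat) vfun" where
  "diagonal_jet S u v = (\<lambda>z i. if z \<in> \<Omega> \<and> i \<in> I then u z () * D i (B.smul z S v) z else 0)"

lemma diagonal_jet_add_mset:
  assumes "v \<in> H2"
  shows "diagonal_jet (add_mset b S) u v = diagonal_jet S u (mult_op b v) - diagonal_jet S (mult_op b u) v"
proof (intro ext)
  fix z i
  show "diagonal_jet (add_mset b S) u v z i = (diagonal_jet S u (mult_op b v) - diagonal_jet S (mult_op b u) v) z i"
  proof (cases "z \<in> \<Omega> \<and> i \<in> I")
    case True
    have "B.smul z (add_mset b S) v = B.smul z S (mult_op b v) + fscale (- (z $ b)) (B.smul z S v)"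
      by (simp add: B.smul_def mult_op_def fun_eq_iff algebra_simps)
    then have "D i (B.smul z (add_mset b S) v) z
        = D i (B.smul z S (mult_op b v)) z - z $ b * D i (B.smul z S v) z"
      using True by (simp only: D_add D_fscale B.smul_mem B.mult_op_mem B.scale_mem assms) simp
    moreover have "mult_op b u z () = z $ b * u z ()" by (simp add: mult_op_def)
    ultimately show ?thesis using True by (simp add: diagonal_jet_def right_diff_distrib)
  qed (auto simp: diagonal_jet_def)
qed

text \<open>
  A derivative of order at most \<open>k\<close> of a function vanishing to order \<open>k + 1\<close> is zero.
\<close>

lemma diagonal_jet_vanishes:
  assumes "size S = Suc k" "v \<in> H2"
  shows "diagonal_jet S u v = 0"
proof (intro ext)
  fix z and i :: "'m \<Rightarrow> nat"
  show "diagonal_jet S u v z i = 0 z i"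
  proof (cases "z \<in> \<Omega> \<and> i \<in> I")
    case True
    then have l: "length (index_list i) \<le> k" by (simp add: multi_indices_alt)
    then obtain c :: nat where "D i (B.smul z S v) z = of_nat c * v z ()"
      "c \<noteq> 0 \<longleftrightarrow> mset (index_list i) = S"
      using B.derivative_smul[of z "index_list i" S] True assms unfolding D_def by auto
    moreover have "mset (index_list i) \<noteq> S" using l assms(1) by auto
    ultimately show ?thesis by (simp add: diagonal_jet_def)
  qed (auto simp: diagonal_jet_def)
qed

text \<open>
  The two sharpness assumptions act one after the other: on \<open>H1\<close> to evaluate the first factor at \<open>w\<close>,
  and on \<open>H2\<close>, once the vanishing of diagonal jets has been transported to \<open>g\<close>, to identify \<open>g\<close>.
  Agreement of \<open>f\<close> with the section on all products of functions and jets suffices, since the kernel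
  sections are among them.
\<close>

lemma joint_kernel_J:
  assumes w: "w \<in> \<Omega>" and f: "f \<in> N.space"
    and orth: "\<And>l h. h \<in> N.space \<Longrightarrow> N.space_ip (mult_op l h - fscale (w $ l) h) f = 0"
  shows "\<exists>\<zeta>\<in>cvec I. f = kernel_section \<Omega> I J w \<zeta>"
proof -
  have K1w: "K1 w w \<noteq> 0" by (rule A.diagonal[OF w])
  (* the multiple of evaluation at w, read off at the function K1(.,w) *)
  define \<phi> where "\<phi> v = inverse (K1 w w) * N.space_ip (jet (A.point w) v) f" for v
  have step1: "N.space_ip (jet u v) f = u w () * \<phi> v" if u: "u \<in> H1" and v: "v \<in> H2" for u v
  proof -
    obtain g where g: "g \<in> H1" "\<And>u. u \<in> H1 \<Longrightarrow> N.space_ip (jet u v) f = ip1 u g"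
      using A.riesz[OF bounded_functional_jet_left[OF v f]] by blast
    have "ip1 (mult_op l h - fscale (w $ l) h) g = 0" if h: "h \<in> H1" for l h
    proof -
      have "mult_op l h - fscale (w $ l) h \<in> H1"
        by (intro A.diff_mem A.mult_op_mem A.scale_mem h)
      then have "ip1 (mult_op l h - fscale (w $ l) h) g
          = N.space_ip (mult_op l (jet h v) - fscale (w $ l) (jet h v)) f"
        by (simp only: g(2)[symmetric] jet_diff_left jet_fscale_left mult_op_jet)
      then show ?thesis using orth[OF jet_space(1)[OF h v]] by simp
    qed
    from A.joint_kernel[OF w g(1) this] obtain c where c: "\<And>u. u \<in> H1 \<Longrightarrow> N.space_ip (jet u v) f = c * u w ()"
      using g(2) by auto
    have "\<phi> v = c" using c[OF A.point_mem[OF w]] K1w by (simp add: \<phi>_def A.point_apply w)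
    then show ?thesis using c[OF u] by (simp add: mult.commute)
  qed
  obtain g where g: "g \<in> H2" "\<And>v. v \<in> H2 \<Longrightarrow> \<phi> v = ip2 v g"
    using B.riesz[OF bounded_functional_jet_right[OF A.point_mem[OF w] f]] unfolding \<phi>_def by blast
  have diag: "diagonal_jet S u v \<in> N.space \<and> N.space_ip (diagonal_jet S u v) f = u w () * ip2 (B.smul w S v) g"
    if "u \<in> H1" "v \<in> H2" for S u v
    using that
  proof (induction S arbitrary: u v)
    case empty
    have "diagonal_jet {#} u v = jet u v" unfolding diagonal_jet_def jet_def B.smul_empty ..
    then show ?case using empty jet_space step1 g(2) by (simp add: B.smul_empty)
  next
    case (add b S)
    note m = B.mult_op_mem[OF add.prems(2), of b] A.mult_op_mem[OF add.prems(1), of b]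
    note IH1 = add.IH[OF add.prems(1) m(1)] and IH2 = add.IH[OF m(2) add.prems(2)]
    have "B.smul w (add_mset b S) v = B.smul w S (mult_op b v) - fscale (w $ b) (B.smul w S v)"
      by (simp add: B.smul_def mult_op_def fun_eq_iff algebra_simps)
    then have "ip2 (B.smul w (add_mset b S) v) g = ip2 (B.smul w S (mult_op b v)) g - w $ b * ip2 (B.smul w S v) g"
      using m add.prems by (simp only: B.ip_diff B.ip_scale B.smul_mem B.scale_mem g(1))
    moreover have "N.space_ip (diagonal_jet (add_mset b S) u v) f
        = N.space_ip (diagonal_jet S u (mult_op b v)) f - N.space_ip (diagonal_jet S (mult_op b u) v) f"
      unfolding diagonal_jet_add_mset[OF add.prems(2)] using IH1 IH2 f by (intro R.ip_diff) auto
    moreover have "mult_op b u w () = w $ b * u w ()" by (simp add: mult_op_def)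
    moreover have "diagonal_jet (add_mset b S) u v \<in> N.space"
      unfolding diagonal_jet_add_mset[OF add.prems(2)] using IH1 IH2 by (intro N.space_diff) auto
    ultimately show ?case using IH1 IH2 by (simp add: right_diff_distrib ac_simps)
  qed
  have "ip2 (B.smul w S v) g = 0" if S: "size S = Suc k" and v: "v \<in> H2" for S v
  proof -
    have "A.point w w () * ip2 (B.smul w S v) g = N.space_ip (diagonal_jet S (A.point w) v) f"
      using diag[OF A.point_mem[OF w] v, of S] by simp
    also have "\<dots> = 0"
      unfolding diagonal_jet_vanishes[OF S v] by (rule R.ip_zero_left[OF f])
    finally show ?thesis using K1w by (simp add: A.point_apply w)
  qed
  from B.generalized_joint_kernel[OF w g(1) this] obtain \<eta> where
    "\<forall>v\<in>H2. ip2 v g = (\<Sum>j | length (index_list j) < Suc k. \<eta> j * foldr dz (index_list j) (\<lambda>z. v z ()) w)"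
    by blast
  moreover have "{j :: 'm \<Rightarrow> nat. length (index_list j) < Suc k} = I" by (auto simp: multi_indices_alt)
  ultimately have \<eta>: "ip2 v g = (\<Sum>j\<in>I. \<eta> j * D j v w)" if "v \<in> H2" for v
    using that by (simp add: D_def)
  define \<zeta> where "\<zeta> j = (if j \<in> I then cnj (\<eta> j) else 0)" for j
  have \<zeta>: "\<zeta> \<in> cvec I" by (simp add: \<zeta>_def cvec_def)
  have same: "N.space_ip (jet u v) f = N.space_ip (jet u v) (kernel_section \<Omega> I J w \<zeta>)"
    if u: "u \<in> H1" and v: "v \<in> H2" for u v
  proof -
    have "N.space_ip (jet u v) (kernel_section \<Omega> I J w \<zeta>) = cvec_inner I (jet u v w) \<zeta>"
      by (rule R.reproducing[OF jet_space(1)[OF u v] w \<zeta>])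
    also have "\<dots> = u w () * (\<Sum>j\<in>I. \<eta> j * D j v w)"
      by (simp add: cvec_inner_def jet_def \<zeta>_def w sum_distrib_left mult.commute mult.left_commute)
    also have "\<dots> = N.space_ip (jet u v) f"
      using step1[OF u v] g(2)[OF v] \<eta>[OF v] by simp
    finally show ?thesis by simp
  qed
  have sH: "kernel_section \<Omega> I J w \<zeta> \<in> N.space" by (rule R.section_mem[OF w \<zeta>])
  have "f = kernel_section \<Omega> I J w \<zeta>"
  proof (intro ext)
    fix z i
    show "f z i = kernel_section \<Omega> I J w \<zeta> z i"
    proof (cases "z \<in> \<Omega> \<and> i \<in> I")
      case True
      then have z: "z \<in> \<Omega>" and e: "unit_vec i \<in> cvec I" by (auto intro: unit_vec_cvec)
      have ev: "h z i = cnj (N.space_ip (jet (A.point z) (\<xi> z (unit_vec i))) h)" if h: "h \<in> N.space" for h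
      proof -
        have "h z i = N.space_ip h (kernel_section \<Omega> I J z (unit_vec i))"
          using R.reproducing[OF h z e] True N.finite_index by (simp add: cvec_inner_unit_vec)
        then show ?thesis
          using R.ip_cnj[OF R.section_mem[OF z e] h] section_eq_jet[OF z] by simp
      qed
      show ?thesis
        unfolding ev[OF f] ev[OF sH] using same[OF A.point_mem[OF z] \<xi>_mem[OF z]] by simp
    next
      case False
      then show ?thesis
        using N.space_outside[OF f, of z] N.space_cvec[OF f, of z]
        by (auto simp: kernel_section_def mat_app_def cvec_def)
    qed
  qed
  then show ?thesis using \<zeta> by blast
qed

lemma J_sharp: "sharp_kernel \<Omega> I J"
proof -
  have "ker_D N.space (mult_shift_adjoint N.space N.space_ip w) = kernel_section \<Omega> I J w ` cvec I"
    if w: "w \<in> \<Omega>" for w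
  proof -
    have iff: "f \<in> ker_D N.space (mult_shift_adjoint N.space N.space_ip w) \<longleftrightarrow>
        f \<in> N.space \<and> (\<forall>l. \<forall>h\<in>N.space. N.space_ip (mult_op l h - fscale (w $ l) h) f = 0)" for f
      unfolding ker_D_def D_tuple_def mult_shift_adjoint_def
      using R.hilbert_adjoint_eq_0_iff[OF R.bounded_operator_shift[OF mult_op_bounded], of f]
      by (auto simp: fun_eq_iff[of _ 0])
    show ?thesis
    proof (intro equalityI subsetI)
      fix f assume "f \<in> ker_D N.space (mult_shift_adjoint N.space N.space_ip w)"
      then show "f \<in> kernel_section \<Omega> I J w ` cvec I"
        unfolding iff using joint_kernel_J[OF w] by blast
    next
      fix f assume "f \<in> kernel_section \<Omega> I J w ` cvec I"
      then obtain \<eta> where \<eta>: "\<eta> \<in> cvec I" "f = kernel_section \<Omega> I J w \<eta>" by blast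
      have "N.space_ip (mult_op l h - fscale (w $ l) h) f = 0" if h: "h \<in> N.space" for l h
      proof -
        have "mult_op l h - fscale (w $ l) h \<in> N.space"
          using R.bounded_operator_shift[OF mult_op_bounded] h by (simp add: bounded_operator_def)
        from R.reproducing[OF this w \<eta>(1)] show ?thesis
          by (simp add: \<eta>(2) cvec_inner_def mult_op_def)
      qed
      then show "f \<in> ker_D N.space (mult_shift_adjoint N.space N.space_ip w)"
        unfolding iff using R.section_mem[OF w \<eta>(1)] \<eta>(2) by blast
    qed
  qed
  then show ?thesis
    unfolding sharp_kernel_def
    using N.finite_index J_sesqui_analytic J_positive_definite J_rkhs mult_op_bounded by blast
qed

end

lemma sharp_scalar_rkhs:
  assumes "open \<Omega>" and sharp: "sharp_kernel \<Omega> UNIV (scalar_kernel K)"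
  shows "\<exists>H ip. scalar_rkhs H ip \<Omega> K"
proof -
  obtain H ip where rk: "rkhs H ip \<Omega> UNIV (scalar_kernel K)"
    and bd: "\<And>l. bounded_operator H ip (mult_op l)"
    and ker: "\<And>w. w \<in> \<Omega> \<Longrightarrow>
      ker_D H (mult_shift_adjoint H ip w) = kernel_section \<Omega> UNIV (scalar_kernel K) w ` cvec UNIV"
    and pd: "positive_definite_kernel \<Omega> UNIV (scalar_kernel K)"
    using sharp unfolding sharp_kernel_def by blast
  interpret rkhs H ip \<Omega> UNIV "scalar_kernel K" by (rule rk)
  have "scalar_rkhs H ip \<Omega> K"
  proof
    show "open \<Omega>" by fact
    show "bounded_operator H ip (mult_op l)" for l by (rule bd)
    show "K w w \<noteq> 0" if "w \<in> \<Omega>" for w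
    proof -
      define \<eta> :: "complex ^ 'a \<Rightarrow> unit \<Rightarrow> complex" where "\<eta> = (\<lambda>_ _. 1)"
      have "0 < Re (\<Sum>p\<in>{w}. \<Sum>q\<in>{w}. cvec_inner UNIV (mat_app UNIV (scalar_kernel K p q) (\<eta> q)) (\<eta> p))"
        using pd[unfolded positive_definite_kernel_def Let_def, rule_format, of "{w}" \<eta>] that
        by (simp add: \<eta>_def cvec_def fun_eq_iff)
      then show ?thesis by (auto simp: cvec_inner_def mat_app_def scalar_kernel_def \<eta>_def UNIV_unit)
    qed
    fix w g assume w: "w \<in> \<Omega>" and g: "g \<in> H"
      and orth: "\<And>l f. f \<in> H \<Longrightarrow> ip (mult_op l f - fscale (w $ l) f) g = 0"
    have "hilbert_adjoint H ip (\<lambda>f. mult_op l f - fscale (w $ l) f) g = 0" for l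
      using orth hilbert_adjoint_eq_0_iff[OF bounded_operator_shift[OF bd] g] by blast
    then have "g \<in> ker_D H (mult_shift_adjoint H ip w)"
      using g by (simp add: ker_D_def D_tuple_def mult_shift_adjoint_def zero_fun_def)
    then obtain \<eta> where "g = kernel_section \<Omega> UNIV (scalar_kernel K) w \<eta>" using ker[OF w] by blast
    then have "ip f g = cnj (\<eta> ()) * f w ()" if "f \<in> H" for f
      using reproducing[OF that w, of \<eta>] by (simp add: cvec_inner_def UNIV_unit cvec_def mult.commute)
    then show "\<exists>c. \<forall>f\<in>H. ip f g = c * f w ()" by blast
  qed
  then show ?thesis by blast
qed

theorem theorem4p17:
  fixes \<Omega> :: "(complex ^ 'm::finite) set"
    and K1 K2 :: "complex ^ 'm \<Rightarrow> complex ^ 'm \<Rightarrow> complex"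
    and k :: nat
  assumes "open \<Omega>" and "connected \<Omega>" and "\<Omega> \<noteq> {}" and "bounded \<Omega>"
    and "sharp_kernel \<Omega> UNIV (scalar_kernel K1)"
    and "sharp_kernel \<Omega> UNIV (scalar_kernel K2)"
  shows "sharp_kernel \<Omega> (multi_indices k) (J_res K1 K2)"
proof -
  obtain H1 ip1 where "scalar_rkhs H1 ip1 \<Omega> K1" using sharp_scalar_rkhs assms by blast
  moreover obtain H2 ip2 where "scalar_rkhs H2 ip2 \<Omega> K2" using sharp_scalar_rkhs assms by blast
  ultimately interpret jet_kernel H1 ip1 H2 ip2 \<Omega> K1 K2 k
    by (simp add: jet_kernel_def)
  show ?thesis by (rule J_sharp)
qed

end
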